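(* Let $\mathbb Z[\varepsilon]=\mathbb Z[T]/(T^2)$ be the ring of dual integers and $\operatorname{proj}(\mathbb Z)$ the category of finitely generated free abelian groups. The following categories are equivalent: $$C^b(\operatorname{proj}(\mathbb Z))/[1]\;\cong\;\operatorname{sub}(\mathbb Z[\varepsilon])\;\cong\;\operatorname{G-proj}\mathbb Z[\varepsilon].$$
   Context: All modules are finitely generated right modules. $C^b(\operatorname{proj}(\mathbb Z))$ is the category of bounded complexes of finitely generated free abelian groups (morphisms are chain maps), with shift $[1]$. The orbit category $C^b/[1]$ has the same objects as $C^b$ and $\operatorname{Hom}_{C^b/[1]}(X,Y)=\bigoplus_{i\in\mathbb Z}\operatorname{Hom}_{C^b}(X,Y[i])$, with composition of $f:X\to Y[i]$ and $g:Y\to Z[k]$ given by $g[i]\circ f$. $\operatorname{sub}(\mathbb Z[\varepsilon])$ is the full subcategory of $\operatorname{mod}\mathbb Z[\varepsilon]$ of torsionless modules, i.e. modules (isomorphic to) submodules of $\mathbb Z[\varepsilon]^n$ for some $n$. A $\Lambda$-module $M$ is Gorenstein-projective if there is a doubly infinite exact sequence $P^\bullet:\cdots\to P^{-1}\to P^0\xrightarrow{d^0}P^1\to\cdots$ of finitely generated projective $\Lambda$-modules such that $\operatorname{Hom}_\Lambda(P^\bullet,\Lambda)$ is exact and $M\cong\operatorname{Ker}d^0$; $\operatorname{G-proj}\Lambda$ is the full subcategory of $\operatorname{mod}\Lambda$ of such modules. *)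

theory Defs
  imports
    "HOL-Algebra.UnivPoly"
    "HOL-Algebra.QuotRing"
    "HOL-Algebra.Product_Groups"
    "HOL-Algebra.Free_Abelian_Groups"
begin

section \<open>Categories and equivalences\<close>

text \<open>
  Morphism sets need not be disjoint, and the representing function of a morphism does not
  determine its source and target; so composition takes the objects as arguments:
  \<open>Comp C X Y Z g f\<close> is the composite of \<open>f : X \<rightarrow> Y\<close> and \<open>g : Y \<rightarrow> Z\<close>.
\<close>

record ('o, 'm) category =
  Obj :: "'o set"
  Mor :: "'o \<Rightarrow> 'o \<Rightarrow> 'm set"
  Ident :: "'o \<Rightarrow> 'm"
  Comp :: "'o \<Rightarrow> 'o \<Rightarrow> 'o \<Rightarrow> 'm \<Rightarrow> 'm \<Rightarrow> 'm"

locale category =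
  fixes C :: "('o, 'm) category"
  assumes Ident_closed: "X \<in> Obj C \<Longrightarrow> Ident C X \<in> Mor C X X"
    and Comp_closed: "\<lbrakk>X \<in> Obj C; Y \<in> Obj C; Z \<in> Obj C; f \<in> Mor C X Y; g \<in> Mor C Y Z\<rbrakk>
      \<Longrightarrow> Comp C X Y Z g f \<in> Mor C X Z"
    and Comp_Ident: "\<lbrakk>X \<in> Obj C; Y \<in> Obj C; f \<in> Mor C X Y\<rbrakk> \<Longrightarrow> Comp C X X Y f (Ident C X) = f"
    and Ident_Comp: "\<lbrakk>X \<in> Obj C; Y \<in> Obj C; f \<in> Mor C X Y\<rbrakk> \<Longrightarrow> Comp C X Y Y (Ident C Y) f = f"
    and Comp_assoc: "\<lbrakk>W \<in> Obj C; X \<in> Obj C; Y \<in> Obj C; Z \<in> Obj C;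
        f \<in> Mor C W X; g \<in> Mor C X Y; h \<in> Mor C Y Z\<rbrakk>
      \<Longrightarrow> Comp C W X Z (Comp C X Y Z h g) f = Comp C W Y Z h (Comp C W X Y g f)"

locale category_functor = source: category C + target: category D
  for C :: "('o, 'm) category" and D :: "('p, 'n) category" +
  fixes FO :: "'o \<Rightarrow> 'p" and FM :: "'o \<Rightarrow> 'o \<Rightarrow> 'm \<Rightarrow> 'n"
  assumes FO_closed: "X \<in> Obj C \<Longrightarrow> FO X \<in> Obj D"
    and FM_closed: "\<lbrakk>X \<in> Obj C; Y \<in> Obj C; f \<in> Mor C X Y\<rbrakk> \<Longrightarrow> FM X Y f \<in> Mor D (FO X) (FO Y)"
    and FM_Ident: "X \<in> Obj C \<Longrightarrow> FM X X (Ident C X) = Ident D (FO X)"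
    and FM_Comp: "\<lbrakk>X \<in> Obj C; Y \<in> Obj C; Z \<in> Obj C; f \<in> Mor C X Y; g \<in> Mor C Y Z\<rbrakk>
      \<Longrightarrow> FM X Z (Comp C X Y Z g f) = Comp D (FO X) (FO Y) (FO Z) (FM Y Z g) (FM X Y f)"

definition isomorphisms :: "('o, 'm) category \<Rightarrow> 'o \<Rightarrow> 'o \<Rightarrow> 'm set" where
  "isomorphisms C X Y = {f \<in> Mor C X Y. \<exists>g \<in> Mor C Y X.
     Comp C X Y X g f = Ident C X \<and> Comp C Y X Y f g = Ident C Y}"

definition naturally_isomorphic ::
  "('o, 'm) category \<Rightarrow> ('p, 'n) category \<Rightarrow> ('o \<Rightarrow> 'p) \<Rightarrow> ('o \<Rightarrow> 'o \<Rightarrow> 'm \<Rightarrow> 'n)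
    \<Rightarrow> ('o \<Rightarrow> 'p) \<Rightarrow> ('o \<Rightarrow> 'o \<Rightarrow> 'm \<Rightarrow> 'n) \<Rightarrow> bool" where
  "naturally_isomorphic C D FO FM GO GM \<longleftrightarrow>
    (\<exists>\<eta>. (\<forall>X \<in> Obj C. \<eta> X \<in> isomorphisms D (FO X) (GO X)) \<and>
         (\<forall>X \<in> Obj C. \<forall>Y \<in> Obj C. \<forall>f \<in> Mor C X Y.
            Comp D (FO X) (GO X) (GO Y) (GM X Y f) (\<eta> X) =
            Comp D (FO X) (FO Y) (GO Y) (\<eta> Y) (FM X Y f)))"

definition equivalent_categories :: "('o, 'm) category \<Rightarrow> ('p, 'n) category \<Rightarrow> bool" where
  "equivalent_categories C D \<longleftrightarrow>
    (\<exists>FO FM GO GM.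
       category_functor C D FO FM \<and> category_functor D C GO GM \<and>
       naturally_isomorphic C C
         (\<lambda>X. GO (FO X)) (\<lambda>X Y f. GM (FO X) (FO Y) (FM X Y f)) (\<lambda>X. X) (\<lambda>X Y f. f) \<and>
       naturally_isomorphic D D
         (\<lambda>X. FO (GO X)) (\<lambda>X Y f. FM (GO X) (GO Y) (GM X Y f)) (\<lambda>X. X) (\<lambda>X Y f. f))"

definition full_subcategory :: "('o, 'm) category \<Rightarrow> ('o \<Rightarrow> bool) \<Rightarrow> ('o, 'm) category" where
  "full_subcategory C P = C\<lparr>Obj := {X \<in> Obj C. P X}\<rparr>"

text \<open>
  \<open>G X Y\<close> is the abelian group of morphisms \<open>X \<rightarrow> Y\<close>, written multiplicatively, and \<open>SO i\<close>,
  \<open>SM i\<close> is the action of the \<open>i\<close>-th power of an automorphism of \<open>C\<close> on objects and morphisms.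
  A morphism of the orbit category is a finitely supported family of \<open>f i : X \<rightarrow> SO i Y\<close>.  The
  degree \<open>m\<close> component of a composite is the sum of the \<open>SM i (g (m - i)) \<circ> f i\<close> over all \<open>i\<close>;
  \<open>gfinprod\<close> is the product of the finitely many nontrivial terms.
\<close>

definition orbit_category ::
  "('o, 'm) category \<Rightarrow> ('o \<Rightarrow> 'o \<Rightarrow> 'm monoid) \<Rightarrow> (int \<Rightarrow> 'o \<Rightarrow> 'o) \<Rightarrow> (int \<Rightarrow> 'm \<Rightarrow> 'm)
    \<Rightarrow> ('o, int \<Rightarrow> 'm) category" where
  "orbit_category C G SO SM =
    \<lparr>Obj = Obj C,
     Mor = (\<lambda>X Y. carrier (sum_group UNIV (\<lambda>i. G X (SO i Y)))),
     Ident = (\<lambda>X i. if i = 0 then Ident C X else \<one>\<^bsub>G X (SO i X)\<^esub>),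
     Comp = (\<lambda>X Y Z g f m. gfinprod (G X (SO m Z))
       (\<lambda>i. Comp C X (SO i Y) (SO m Z) (SM i (g (m - i))) (f i)) UNIV)\<rparr>"


section \<open>Bounded complexes of finitely generated free abelian groups\<close>

text \<open>Abelian groups are written multiplicatively, as in the group theory of the library.\<close>

definition fg_free_abelian_group :: "'a monoid \<Rightarrow> bool" where
  "fg_free_abelian_group A \<longleftrightarrow> comm_group A \<and> (\<exists>n::nat. A \<cong> free_Abelian_group {..<n})"

text \<open>
  Homomorphisms are extensional (undefined outside the carrier), so that equality of functions
  is equality of homomorphisms.
\<close>

definition group_homs :: "'a monoid \<Rightarrow> 'b monoid \<Rightarrow> ('a \<Rightarrow> 'b) set" where
  "group_homs A B = hom A B \<inter> extensional (carrier A)"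

record 'a cochain_complex =
  cgrp :: "int \<Rightarrow> 'a monoid"
  cdif :: "int \<Rightarrow> 'a \<Rightarrow> 'a"

definition bounded_free_complexes :: "'a cochain_complex set" where
  "bounded_free_complexes = {X.
     (\<forall>n. fg_free_abelian_group (cgrp X n)) \<and>
     (\<forall>n. cdif X n \<in> group_homs (cgrp X n) (cgrp X (n + 1))) \<and>
     (\<forall>n. \<forall>x \<in> carrier (cgrp X n). cdif X (n + 1) (cdif X n x) = \<one>\<^bsub>cgrp X (n + 2)\<^esub>) \<and>
     finite {n. carrier (cgrp X n) \<noteq> {\<one>\<^bsub>cgrp X n\<^esub>}}}"

definition chain_map_group ::
  "'a cochain_complex \<Rightarrow> 'a cochain_complex \<Rightarrow> (int \<Rightarrow> 'a \<Rightarrow> 'a) monoid" where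
  "chain_map_group X Y =
    \<lparr>carrier = {f. \<forall>n. f n \<in> group_homs (cgrp X n) (cgrp Y n) \<and>
        (\<forall>x \<in> carrier (cgrp X n). f (n + 1) (cdif X n x) = cdif Y n (f n x))},
     monoid.mult = (\<lambda>f g n. \<lambda>x \<in> carrier (cgrp X n). f n x \<otimes>\<^bsub>cgrp Y n\<^esub> g n x),
     one = (\<lambda>n. \<lambda>x \<in> carrier (cgrp X n). \<one>\<^bsub>cgrp Y n\<^esub>)\<rparr>"

definition bounded_complex_category :: "('a cochain_complex, int \<Rightarrow> 'a \<Rightarrow> 'a) category" where
  "bounded_complex_category =
    \<lparr>Obj = bounded_free_complexes,
     Mor = (\<lambda>X Y. carrier (chain_map_group X Y)),
     Ident = (\<lambda>X n. \<lambda>x \<in> carrier (cgrp X n). x),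
     Comp = (\<lambda>X Y Z g f n. compose (carrier (cgrp X n)) (g n) (f n))\<rparr>"

text \<open>The shift \<open>[i]\<close>: the differential is multiplied by \<open>(-1)\<^sup>i\<close>, morphisms keep their sign.\<close>

definition shift_complex :: "int \<Rightarrow> 'a cochain_complex \<Rightarrow> 'a cochain_complex" where
  "shift_complex i X =
    \<lparr>cgrp = (\<lambda>n. cgrp X (n + i)),
     cdif = (\<lambda>n. \<lambda>x \<in> carrier (cgrp X (n + i)).
       if even i then cdif X (n + i) x else inv\<^bsub>cgrp X (n + i + 1)\<^esub> (cdif X (n + i) x))\<rparr>"

definition shift_chain_map :: "int \<Rightarrow> (int \<Rightarrow> 'a \<Rightarrow> 'a) \<Rightarrow> (int \<Rightarrow> 'a \<Rightarrow> 'a)" where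
  "shift_chain_map i f = (\<lambda>n. f (n + i))"

definition complex_orbit_category ::
  "('a cochain_complex, int \<Rightarrow> int \<Rightarrow> 'a \<Rightarrow> 'a) category" where
  "complex_orbit_category =
    orbit_category bounded_complex_category chain_map_group shift_complex shift_chain_map"


section \<open>Finitely generated modules\<close>

text \<open>
  The locale \<^locale>\<open>module\<close> is about modules over commutative rings (so left and right modules
  agree) and leaves the fields \<open>mult\<close> and \<open>one\<close> of a module record unconstrained; no notion
  below depends on them.
\<close>

definition module_homs ::
  "('r, 'k) ring_scheme \<Rightarrow> ('r, 'a) module \<Rightarrow> ('r, 'b) module \<Rightarrow> ('a \<Rightarrow> 'b) set" where
  "module_homs R M N = {f \<in> hom (add_monoid M) (add_monoid N) \<inter> extensional (carrier M).
     \<forall>r \<in> carrier R. \<forall>x \<in> carrier M. f (r \<odot>\<^bsub>M\<^esub> x) = r \<odot>\<^bsub>N\<^esub> f x}"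

definition isomorphic_modules ::
  "('r, 'k) ring_scheme \<Rightarrow> ('r, 'a) module \<Rightarrow> ('r, 'b) module \<Rightarrow> bool" where
  "isomorphic_modules R M N \<longleftrightarrow> (\<exists>f \<in> module_homs R M N. bij_betw f (carrier M) (carrier N))"

definition fg_module :: "('r, 'k) ring_scheme \<Rightarrow> ('r, 'b) module \<Rightarrow> bool" where
  "fg_module R M \<longleftrightarrow> module R M \<and>
    (\<exists>S. finite S \<and> S \<subseteq> carrier M \<and> (\<forall>N. submodule N R M \<longrightarrow> S \<subseteq> N \<longrightarrow> N = carrier M))"

definition module_category ::
  "('r, 'k) ring_scheme \<Rightarrow> (('r, 'b) module, 'b \<Rightarrow> 'b) category" where
  "module_category R =
    \<lparr>Obj = {M. fg_module R M},
     Mor = module_homs R,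
     Ident = (\<lambda>M. \<lambda>x \<in> carrier M. x),
     Comp = (\<lambda>L M N g f. compose (carrier L) g f)\<rparr>"

definition regular_module :: "('r, 'k) ring_scheme \<Rightarrow> ('r, 'r) module" where
  "regular_module R = \<lparr>carrier = carrier R, monoid.mult = monoid.mult R, one = one R,
     ring.zero = ring.zero R, ring.add = ring.add R, smult = monoid.mult R\<rparr>"

definition free_module :: "('r, 'k) ring_scheme \<Rightarrow> nat \<Rightarrow> ('r, nat \<Rightarrow> 'r) module" where
  "free_module R n = \<lparr>carrier = {..<n} \<rightarrow>\<^sub>E carrier R, monoid.mult = undefined, one = undefined,
     ring.zero = (\<lambda>i \<in> {..<n}. \<zero>\<^bsub>R\<^esub>),
     ring.add = (\<lambda>x y. \<lambda>i \<in> {..<n}. x i \<oplus>\<^bsub>R\<^esub> y i),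
     smult = (\<lambda>r x. \<lambda>i \<in> {..<n}. r \<otimes>\<^bsub>R\<^esub> x i)\<rparr>"

definition torsionless_module :: "('r, 'k) ring_scheme \<Rightarrow> ('r, 'b) module \<Rightarrow> bool" where
  "torsionless_module R M \<longleftrightarrow> (\<exists>n N. submodule N R (free_module R n) \<and>
     isomorphic_modules R M ((free_module R n)\<lparr>carrier := N\<rparr>))"

text \<open>
  The lifting property is tested on modules whose carriers lie in the same type \<open>'b\<close> as that of
  \<open>P\<close>.  If \<open>'b\<close> is infinite, \<open>R\<close> is countable and \<open>P\<close> is finitely generated, this is no
  restriction: \<open>'b\<close> then contains a copy of every \<open>free_module R n\<close>, so \<open>P\<close> is a direct summand
  of one of them.
\<close>

definition projective_module :: "('r, 'k) ring_scheme \<Rightarrow> ('r, 'b) module \<Rightarrow> bool" where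
  "projective_module R P \<longleftrightarrow> module R P \<and>
    (\<forall>(M :: ('r, 'b) module) (N :: ('r, 'b) module) g f.
       module R M \<longrightarrow> module R N \<longrightarrow>
       g \<in> module_homs R M N \<longrightarrow> g ` carrier M = carrier N \<longrightarrow> f \<in> module_homs R P N \<longrightarrow>
       (\<exists>h \<in> module_homs R P M. compose (carrier P) g h = f))"

text \<open>
  The last but one conjunct is exactness of \<open>Hom\<^sub>R(P, R)\<close> at \<open>Hom\<^sub>R(P\<^sup>n\<^sup>+\<^sup>1, R)\<close>: the image of
  precomposition with \<open>d (n + 1)\<close> is the kernel of precomposition with \<open>d n\<close>.
\<close>

definition Gorenstein_projective :: "('r, 'k) ring_scheme \<Rightarrow> ('r, 'b) module \<Rightarrow> bool" where
  "Gorenstein_projective R M \<longleftrightarrow>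
    (\<exists>(P :: int \<Rightarrow> ('r, 'b) module) (d :: int \<Rightarrow> 'b \<Rightarrow> 'b).
       (\<forall>n. fg_module R (P n) \<and> projective_module R (P n)) \<and>
       (\<forall>n. d n \<in> module_homs R (P n) (P (n + 1))) \<and>
       (\<forall>n. d n ` carrier (P n) = a_kernel (P (n + 1)) (P (n + 2)) (d (n + 1))) \<and>
       (\<forall>n. (\<lambda>\<psi>. compose (carrier (P (n + 1))) \<psi> (d (n + 1)))
              ` module_homs R (P (n + 2)) (regular_module R) =
            {\<phi> \<in> module_homs R (P (n + 1)) (regular_module R).
               \<forall>x \<in> carrier (P n). \<phi> (d n x) = \<zero>\<^bsub>R\<^esub>}) \<and>
       isomorphic_modules R M ((P 0)\<lparr>carrier := a_kernel (P 0) (P 1) (d 0)\<rparr>))"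

definition sub_category :: "('r, 'k) ring_scheme \<Rightarrow> (('r, 'b) module, 'b \<Rightarrow> 'b) category" where
  "sub_category R = full_subcategory (module_category R) (torsionless_module R)"

definition Gproj_category :: "('r, 'k) ring_scheme \<Rightarrow> (('r, 'b) module, 'b \<Rightarrow> 'b) category" where
  "Gproj_category R = full_subcategory (module_category R) (Gorenstein_projective R)"

definition dual_integers :: "(nat \<Rightarrow> int) set ring" where
  "dual_integers = UP INTEG Quot (PIdl\<^bsub>UP INTEG\<^esub> (monom (UP INTEG) 1 2))"

end

theory Submission
  imports Defs
begin

text \<open>
  A module over \<open>\<int>[\<epsilon>]\<close> is an abelian group with a square-zero endomorphism \<open>\<epsilon>\<close>.  A finitely
  generated module is torsionless if and only if its additive group is free: coordinates
  \<open>\<phi>\<^sub>i\<close> of \<open>M\<close> give the embedding \<open>x \<mapsto> (\<phi>\<^sub>i (\<epsilon> x) + \<phi>\<^sub>i x \<epsilon>)\<^sub>i\<close> into a free module.  The same condition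
  characterizes Gorenstein projectivity, because for \<open>M\<close> with free additive group the induced module
  \<open>M \<otimes> \<int>[\<epsilon>]\<close> is projective and the maps \<open>a + b\<epsilon> \<mapsto> -\<delta> a + (a - \<delta> b)\<epsilon>\<close>, for \<open>\<delta>\<close> alternating between
  \<open>\<epsilon>\<close> and \<open>-\<epsilon>\<close>, form a complete resolution of \<open>M\<close>.  Hence the last two categories are equal.

  A bounded complex \<open>X\<close> is sent to its total group with \<open>\<epsilon>\<close> acting as \<open>(-1)\<^sup>n d\<close> in degree \<open>n\<close>.  A
  homomorphism of total modules is determined by its homogeneous components, which are chain maps
  into the shifts, so this functor on the orbit category is fully faithful.  It is essentially
  surjective because \<open>\<epsilon>\<close> splits over its image, a free group, so that \<open>M\<close> is the total module of the
  inclusion of the image of \<open>\<epsilon>\<close> into its kernel.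
\<close>

section \<open>Fully faithful functors\<close>

text \<open>The sign in the total module is forced. A chain map f into Y[i] satisfies f d = (-1)^i d
  f; multiplied by (-1)^n in degree n this becomes f ((-1)^n d) = ((-1)^(n+i) d) f, which is
  linearity over \<open>\<epsilon>\<close>. Boundedness turns the product over all degrees into a
  finite sum and makes every family of components finitely supported, so no finiteness condition
  separates the two kinds of morphisms.

  The formula of the embedding is the bijection between linear forms M ->
  Z[\<open>\<epsilon>\<close>] and additive maps M -> Z that takes the
  \<open>\<epsilon>\<close>-part. The same bijection supplies the preimages that make the dual of
  the resolution exact.

  The obstacle is that the carriers of complexes and modules lie in fixed types, so every
  constructed group has to be moved into the right one. Freeness is therefore expressed by finitely
  many homomorphisms to the integers with trivial common kernel: such a family pulls back along
  injections, combines over products, and embeds the group into integer lists. The group is thus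
  countable and has a copy in every infinite type.\<close>

lemma (in category) isomorphismsE:
  assumes "f \<in> isomorphisms C X Y"
  obtains g where "f \<in> Mor C X Y" "g \<in> Mor C Y X"
    "Comp C X Y X g f = Ident C X" "Comp C Y X Y f g = Ident C Y"
  using assms by (auto simp: isomorphisms_def)

lemma (in category) Ident_in_isomorphisms: "X \<in> Obj C \<Longrightarrow> Ident C X \<in> isomorphisms C X X"
  unfolding isomorphisms_def using Ident_closed Comp_Ident by auto

lemma (in category) equivalent_categories_refl: "equivalent_categories C C"
proof -
  have F: "category_functor C C (\<lambda>X. X) (\<lambda>X Y f. f)"
    by unfold_locales auto
  have N: "naturally_isomorphic C C (\<lambda>X. X) (\<lambda>X Y f. f) (\<lambda>X. X) (\<lambda>X Y f. f)"
    unfolding naturally_isomorphic_def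
    by (rule exI[of _ "Ident C"]) (auto simp: Ident_in_isomorphisms Comp_Ident Ident_Comp)
  show ?thesis unfolding equivalent_categories_def
    by (rule exI[of _ "\<lambda>X. X"], rule exI[of _ "\<lambda>X Y f. f"],
        rule exI[of _ "\<lambda>X. X"], rule exI[of _ "\<lambda>X Y f. f"]) (use F N in simp)
qed

lemma (in category) full_subcategory: "category (full_subcategory C P)"
  unfolding full_subcategory_def
  by unfold_locales (auto simp: Ident_closed Comp_closed Comp_Ident Ident_Comp Comp_assoc)

text \<open>The category laws of \<open>C\<close> are not assumed: they are reflected by a faithful functor.\<close>

locale fully_faithful = target: category D
  for C :: "('o, 'm) category" and D :: "('p, 'n) category" +
  fixes FO :: "'o \<Rightarrow> 'p" and FM :: "'o \<Rightarrow> 'o \<Rightarrow> 'm \<Rightarrow> 'n"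
  assumes Ident_C: "X \<in> Obj C \<Longrightarrow> Ident C X \<in> Mor C X X"
    and Comp_C: "\<lbrakk>X \<in> Obj C; Y \<in> Obj C; Z \<in> Obj C; f \<in> Mor C X Y; g \<in> Mor C Y Z\<rbrakk>
      \<Longrightarrow> Comp C X Y Z g f \<in> Mor C X Z"
    and FO: "X \<in> Obj C \<Longrightarrow> FO X \<in> Obj D"
    and FM_bij: "\<lbrakk>X \<in> Obj C; Y \<in> Obj C\<rbrakk> \<Longrightarrow> bij_betw (FM X Y) (Mor C X Y) (Mor D (FO X) (FO Y))"
    and FM_Id: "X \<in> Obj C \<Longrightarrow> FM X X (Ident C X) = Ident D (FO X)"
    and FM_Co: "\<lbrakk>X \<in> Obj C; Y \<in> Obj C; Z \<in> Obj C; f \<in> Mor C X Y; g \<in> Mor C Y Z\<rbrakk>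
      \<Longrightarrow> FM X Z (Comp C X Y Z g f) = Comp D (FO X) (FO Y) (FO Z) (FM Y Z g) (FM X Y f)"
begin

lemma FM: "\<lbrakk>X \<in> Obj C; Y \<in> Obj C; f \<in> Mor C X Y\<rbrakk> \<Longrightarrow> FM X Y f \<in> Mor D (FO X) (FO Y)"
  using FM_bij bij_betwE by blast

lemma FM_eqD:
  "\<lbrakk>FM X Y f = FM X Y g; X \<in> Obj C; Y \<in> Obj C; f \<in> Mor C X Y; g \<in> Mor C X Y\<rbrakk> \<Longrightarrow> f = g"
  using FM_bij[of X Y] unfolding bij_betw_def inj_on_def by blast

lemma source: "category C"
proof
  show "Comp C X X Y f (Ident C X) = f" if "X \<in> Obj C" "Y \<in> Obj C" "f \<in> Mor C X Y" for X Y f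
    by (rule FM_eqD[of X Y])
      (use that in \<open>auto simp: Ident_C Comp_C FM_Co FM_Id FM FO target.Comp_Ident\<close>)
  show "Comp C X Y Y (Ident C Y) f = f" if "X \<in> Obj C" "Y \<in> Obj C" "f \<in> Mor C X Y" for X Y f
    by (rule FM_eqD[of X Y])
      (use that in \<open>auto simp: Ident_C Comp_C FM_Co FM_Id FM FO target.Ident_Comp\<close>)
  show "Comp C W X Z (Comp C X Y Z h g) f = Comp C W Y Z h (Comp C W X Y g f)"
    if "W \<in> Obj C" "X \<in> Obj C" "Y \<in> Obj C" "Z \<in> Obj C"
      "f \<in> Mor C W X" "g \<in> Mor C X Y" "h \<in> Mor C Y Z" for W X Y Z f g h
    by (rule FM_eqD[of W Z])
      (use that in \<open>auto simp: Comp_C FM_Co FM FO target.Comp_assoc\<close>)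
qed (auto simp: Ident_C Comp_C)

sublocale source: category C by (rule source)

sublocale category_functor C D FO FM
  by unfold_locales (auto simp: FO FM FM_Id FM_Co)

definition lift where "lift X Y h = inv_into (Mor C X Y) (FM X Y) h"

lemma lift: "\<lbrakk>X \<in> Obj C; Y \<in> Obj C; h \<in> Mor D (FO X) (FO Y)\<rbrakk> \<Longrightarrow> lift X Y h \<in> Mor C X Y"
  unfolding lift_def by (metis FM_bij bij_betw_imp_surj_on inv_into_into)

lemma FM_lift: "\<lbrakk>X \<in> Obj C; Y \<in> Obj C; h \<in> Mor D (FO X) (FO Y)\<rbrakk> \<Longrightarrow> FM X Y (lift X Y h) = h"
  unfolding lift_def by (meson FM_bij bij_betw_inv_into_right)

lemma lift_isomorphism:
  assumes "X \<in> Obj C" "Y \<in> Obj C" "h \<in> isomorphisms D (FO X) (FO Y)"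
  shows "lift X Y h \<in> isomorphisms C X Y"
proof -
  obtain k where k: "h \<in> Mor D (FO X) (FO Y)" "k \<in> Mor D (FO Y) (FO X)"
    "Comp D (FO X) (FO Y) (FO X) k h = Ident D (FO X)"
    "Comp D (FO Y) (FO X) (FO Y) h k = Ident D (FO Y)"
    using assms target.isomorphismsE by metis
  have "Comp C X Y X (lift Y X k) (lift X Y h) = Ident C X"
    by (rule FM_eqD[of X X]) (use assms k in \<open>auto simp: Ident_C Comp_C lift FM_Co FM_lift FM_Id\<close>)
  moreover have "Comp C Y X Y (lift X Y h) (lift Y X k) = Ident C Y"
    by (rule FM_eqD[of Y Y]) (use assms k in \<open>auto simp: Ident_C Comp_C lift FM_Co FM_lift FM_Id\<close>)
  ultimately show ?thesis
    unfolding isomorphisms_def using assms k lift by auto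
qed

text \<open>On morphisms the inverse functor conjugates with the chosen isomorphisms and then
  applies \<open>lift\<close>. Every identity in \<open>C\<close> is tested after applying the
  faithful \<open>FM\<close>, where it becomes a cancellation of \<open>u\<close> against
  \<open>v\<close> in \<open>D\<close>.\<close>

theorem equivalent_categories_if_essentially_surjective:
  assumes "\<And>Z. Z \<in> Obj D \<Longrightarrow> \<exists>X \<in> Obj C. isomorphisms D (FO X) Z \<noteq> {}"
  shows "equivalent_categories C D"
proof -
  have "\<exists>X u v. X \<in> Obj C \<and> u \<in> Mor D (FO X) Z \<and> v \<in> Mor D Z (FO X) \<and>
      Comp D (FO X) Z (FO X) v u = Ident D (FO X) \<and> Comp D Z (FO X) Z u v = Ident D Z"
    if "Z \<in> Obj D" for Z
    using assms[OF that] by (auto simp: isomorphisms_def)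
  then obtain GO u v where GO: "\<And>Z. Z \<in> Obj D \<Longrightarrow> GO Z \<in> Obj C"
    and u: "\<And>Z. Z \<in> Obj D \<Longrightarrow> u Z \<in> Mor D (FO (GO Z)) Z"
    and v: "\<And>Z. Z \<in> Obj D \<Longrightarrow> v Z \<in> Mor D Z (FO (GO Z))"
    and vu: "\<And>Z. Z \<in> Obj D \<Longrightarrow> Comp D (FO (GO Z)) Z (FO (GO Z)) (v Z) (u Z) = Ident D (FO (GO Z))"
    and uv: "\<And>Z. Z \<in> Obj D \<Longrightarrow> Comp D Z (FO (GO Z)) Z (u Z) (v Z) = Ident D Z"
    by metis
  note dist = target.Comp_assoc target.Comp_closed target.Ident_closed target.Comp_Ident
    target.Ident_Comp
  define K where "K Y Z h = Comp D (FO (GO Y)) Z (FO (GO Z)) (v Z) (Comp D (FO (GO Y)) Y Z h (u Y))"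
    for Y Z h
  define GM where "GM Y Z h = lift (GO Y) (GO Z) (K Y Z h)" for Y Z h
  have K: "K Y Z h \<in> Mor D (FO (GO Y)) (FO (GO Z))"
    if "Y \<in> Obj D" "Z \<in> Obj D" "h \<in> Mor D Y Z" for Y Z h
    unfolding K_def using that by (intro target.Comp_closed FO GO u v) auto
  have vu': "Comp D W Z (FO (GO Z)) (v Z) (Comp D W (FO (GO Z)) Z (u Z) h) = h"
    if "Z \<in> Obj D" "W \<in> Obj D" "h \<in> Mor D W (FO (GO Z))" for W Z h
    using target.Comp_assoc[of W "FO (GO Z)" Z "FO (GO Z)" h "u Z" "v Z"] that
    by (simp add: vu FO GO u v target.Ident_Comp)
  have uv': "Comp D W (FO (GO Z)) Z (u Z) (Comp D W Z (FO (GO Z)) (v Z) h) = h"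
    if "Z \<in> Obj D" "W \<in> Obj D" "h \<in> Mor D W Z" for W Z h
    using target.Comp_assoc[of W Z "FO (GO Z)" Z h "v Z" "u Z"] that
    by (simp add: uv FO GO u v target.Ident_Comp)
  have uK: "Comp D (FO (GO Y)) (FO (GO Z)) Z (u Z) (K Y Z h) = Comp D (FO (GO Y)) Y Z h (u Y)"
    if "Y \<in> Obj D" "Z \<in> Obj D" "h \<in> Mor D Y Z" for Y Z h
    unfolding K_def by (rule uv') (use that in \<open>auto intro: target.Comp_closed FO GO u\<close>)
  have FGM: "FM (GO Y) (GO Z) (GM Y Z h) = K Y Z h"
    if "Y \<in> Obj D" "Z \<in> Obj D" "h \<in> Mor D Y Z" for Y Z h
    unfolding GM_def by (rule FM_lift) (use that in \<open>auto intro: GO K\<close>)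
  have GM: "GM Y Z h \<in> Mor C (GO Y) (GO Z)"
    if "Y \<in> Obj D" "Z \<in> Obj D" "h \<in> Mor D Y Z" for Y Z h
    unfolding GM_def by (rule lift) (use that in \<open>auto intro: GO K\<close>)
  have G: "category_functor D C GO GM"
  proof unfold_locales
    show "GM X X (Ident D X) = Ident C (GO X)" if "X \<in> Obj D" for X
      by (rule FM_eqD[of "GO X" "GO X"])
        (use that in \<open>auto simp: GM GO Ident_C target.Ident_closed FGM FM_Id K_def
          target.Ident_Comp FO u vu\<close>)
    show "GM X Z (Comp D X Y Z g f) = Comp C (GO X) (GO Y) (GO Z) (GM Y Z g) (GM X Y f)"
      if X: "X \<in> Obj D" "Y \<in> Obj D" "Z \<in> Obj D" "f \<in> Mor D X Y" "g \<in> Mor D Y Z" for X Y Z f g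
    proof (rule FM_eqD[of "GO X" "GO Z"])
      have "K X Z (Comp D X Y Z g f) = Comp D (FO (GO X)) Z (FO (GO Z)) (v Z)
          (Comp D (FO (GO X)) Y Z g (Comp D (FO (GO X)) X Y f (u X)))"
        unfolding K_def using X by (simp add: dist FO GO u)
      also have "Comp D (FO (GO X)) X Y f (u X) =
          Comp D (FO (GO X)) (FO (GO Y)) Y (u Y) (K X Y f)"
        using X by (simp add: uK)
      also have "Comp D (FO (GO X)) Z (FO (GO Z)) (v Z) (Comp D (FO (GO X)) Y Z g
            (Comp D (FO (GO X)) (FO (GO Y)) Y (u Y) (K X Y f))) =
          Comp D (FO (GO X)) (FO (GO Y)) (FO (GO Z)) (K Y Z g) (K X Y f)"
        unfolding K_def[of Y Z] using X K by (simp add: dist FO GO u v)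
      finally show "FM (GO X) (GO Z) (GM X Z (Comp D X Y Z g f)) =
          FM (GO X) (GO Z) (Comp C (GO X) (GO Y) (GO Z) (GM Y Z g) (GM X Y f))"
        using X by (simp add: FGM target.Comp_closed FM_Co GO GM)
    qed (use X in \<open>auto simp: GM GO Comp_C target.Comp_closed\<close>)
  qed (auto simp: GO GM)
  have uiso: "u Z \<in> isomorphisms D (FO (GO Z)) Z" if "Z \<in> Obj D" for Z
    using u[OF that] v[OF that] uv[OF that] vu[OF that] unfolding isomorphisms_def by blast
  \<comment> \<open>The isomorphism \<open>u\<close> at \<open>FO X\<close> runs between two objects
    in the image of \<open>FO\<close>, so fullness pulls it back to \<open>C\<close>; its naturality
    is then \<open>uK\<close> seen through \<open>FM\<close>.\<close>
  define \<eta> where "\<eta> X = lift (GO (FO X)) X (u (FO X))" for X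
  have \<eta>: "\<eta> X \<in> isomorphisms C (GO (FO X)) X" if "X \<in> Obj C" for X
    unfolding \<eta>_def by (rule lift_isomorphism) (use that in \<open>auto simp: FO GO uiso\<close>)
  have \<eta>M: "\<eta> X \<in> Mor C (GO (FO X)) X" if "X \<in> Obj C" for X
    using \<eta>[OF that] by (simp add: isomorphisms_def)
  have F\<eta>: "FM (GO (FO X)) X (\<eta> X) = u (FO X)" if "X \<in> Obj C" for X
    unfolding \<eta>_def by (rule FM_lift) (use that in \<open>auto simp: FO GO u\<close>)
  have "naturally_isomorphic C C (\<lambda>X. GO (FO X)) (\<lambda>X Y f. GM (FO X) (FO Y) (FM X Y f))
      (\<lambda>X. X) (\<lambda>X Y f. f)"
    unfolding naturally_isomorphic_def
  proof (intro exI[of _ \<eta>] conjI ballI \<eta>)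
    fix X Y f assume X: "X \<in> Obj C" "Y \<in> Obj C" "f \<in> Mor C X Y"
    show "Comp C (GO (FO X)) X Y f (\<eta> X) =
        Comp C (GO (FO X)) (GO (FO Y)) Y (\<eta> Y) (GM (FO X) (FO Y) (FM X Y f))"
      by (rule FM_eqD[of "GO (FO X)" Y])
        (use X in \<open>simp_all add: Comp_C GO FO GM FM \<eta>M FM_Co F\<eta> FGM uK\<close>)
  qed
  moreover have "naturally_isomorphic D D (\<lambda>X. FO (GO X)) (\<lambda>X Y f. FM (GO X) (GO Y) (GM X Y f))
      (\<lambda>X. X) (\<lambda>X Y f. f)"
    unfolding naturally_isomorphic_def
    by (intro exI[of _ u] conjI ballI uiso) (simp_all add: FGM uK)
  moreover have "category_functor C D FO FM" ..
  ultimately show ?thesis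
    unfolding equivalent_categories_def using G by blast
qed

end

section \<open>Finitely generated free abelian groups\<close>

lemma comm_group_imp_group: "comm_group G \<Longrightarrow> group G"
  by (simp add: comm_group_def)

lemma group_hom_if_hom: "\<lbrakk>comm_group G; comm_group H; h \<in> hom G H\<rbrakk> \<Longrightarrow> group_hom G H h"
  by (simp add: group_hom_def group_hom_axioms_def comm_group_imp_group)

lemma (in comm_group) subgroup_comm_group:
  assumes "subgroup H G" shows "comm_group (G\<lparr>carrier := H\<rparr>)"
proof (rule group.group_comm_groupI)
  show "group (G\<lparr>carrier := H\<rparr>)" using assms by (simp add: subgroup_imp_group)
  show "x \<otimes>\<^bsub>G\<lparr>carrier := H\<rparr>\<^esub> y = y \<otimes>\<^bsub>G\<lparr>carrier := H\<rparr>\<^esub> x"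
    if "x \<in> carrier (G\<lparr>carrier := H\<rparr>)" "y \<in> carrier (G\<lparr>carrier := H\<rparr>)" for x y
    using that subgroup.subset[OF assms] by (auto intro: m_comm)
qed

lemma hom_restrict_carrier:
  "h \<in> hom G H \<Longrightarrow> K \<subseteq> carrier G \<Longrightarrow> h \<in> hom (G\<lparr>carrier := K\<rparr>) H"
  by (auto simp: hom_def)

lemma fg_free_iso:
  assumes "fg_free_abelian_group A" "comm_group B" "h \<in> iso A B"
  shows "fg_free_abelian_group B"
proof -
  have "A \<cong> B" using assms by (auto simp: is_iso_def)
  then have "B \<cong> A" using assms group.iso_sym by (auto simp: fg_free_abelian_group_def comm_group_def)
  then show ?thesis
    using assms iso_trans unfolding fg_free_abelian_group_def by blast
qed

section \<open>Freeness through integer-valued coordinates\<close>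

lemma fg_free_basis:
  assumes "fg_free_abelian_group A"
  obtains n h where "h \<in> iso (free_Abelian_group {..<n::nat}) A" "comm_group A"
proof -
  obtain n where n: "comm_group A" "A \<cong> free_Abelian_group {..<n::nat}"
    using assms by (auto simp: fg_free_abelian_group_def)
  then have "free_Abelian_group {..<n} \<cong> A" using group.iso_sym comm_group_imp_group by blast
  then show ?thesis using that n by (auto simp: is_iso_def)
qed

text \<open>The coordinates with respect to a basis separate points. Together with the converse
  \<open>fg_free_if_coordinates\<close> this gives a criterion for freeness that mentions no
  basis.\<close>

lemma fg_free_coordinates:
  assumes "fg_free_abelian_group A"
  obtains \<Phi> where "finite \<Phi>" "\<Phi> \<subseteq> hom A integer_group"
    "\<And>x. \<lbrakk>x \<in> carrier A; \<And>\<phi>. \<phi> \<in> \<Phi> \<Longrightarrow> \<phi> x = 0\<rbrakk> \<Longrightarrow> x = \<one>\<^bsub>A\<^esub>"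
proof -
  obtain n h where h: "h \<in> iso A (free_Abelian_group {..<n::nat})" and A: "comm_group A"
    using assms by (auto simp: fg_free_abelian_group_def is_iso_def)
  interpret h: group_hom A "free_Abelian_group {..<n}" h
    using h A by (simp add: group_hom_def group_hom_axioms_def iso_def comm_group_imp_group)
  define \<Phi> where "\<Phi> = (\<lambda>i x. poly_mapping.lookup (h x) i) ` {..<n}"
  show ?thesis
  proof
    show "finite \<Phi>" by (simp add: \<Phi>_def)
    show "\<Phi> \<subseteq> hom A integer_group" by (auto simp: \<Phi>_def hom_def lookup_add)
    fix x assume x: "x \<in> carrier A" "\<And>\<phi>. \<phi> \<in> \<Phi> \<Longrightarrow> \<phi> x = 0"
    have "Poly_Mapping.keys (h x) \<subseteq> {..<n}" using h.hom_closed[OF x(1)] by simp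
    then have "h x = 0"
      using x(2) by (intro poly_mapping_eqI) (auto simp: \<Phi>_def in_keys_iff subset_iff)
    then show "x = \<one>\<^bsub>A\<^esub>"
      using h x h.inj_on_one_iff by (auto simp: iso_def bij_betw_def)
  qed
qed

text \<open>Unless \<open>\<phi>\<close> vanishes, its image is generated by its least positive
  value \<open>\<phi> a\<close>, so \<open>A\<close> is the direct sum of the kernel and the
  infinite cyclic group of \<open>a\<close>. This is the inductive step of
  \<open>fg_free_if_coordinates\<close>.\<close>

lemma fg_free_extension:
  assumes A: "comm_group A" and \<phi>: "\<phi> \<in> hom A integer_group"
    and K: "fg_free_abelian_group (A\<lparr>carrier := kernel A integer_group \<phi>\<rparr>)"
  shows "fg_free_abelian_group A"
proof (cases "\<forall>x \<in> carrier A. \<phi> x = 0")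
  case True
  then have "kernel A integer_group \<phi> = carrier A" by (auto simp: kernel_def)
  with K show ?thesis by simp
next
  case False
  interpret A: comm_group A by (rule A)
  interpret \<phi>: group_hom A integer_group \<phi>
    using A \<phi> by (simp add: group_hom_if_hom abelian_integer_group)
  obtain x where x: "x \<in> carrier A" "\<phi> x \<noteq> 0" using False by auto
  let ?P = "\<lambda>a. a \<in> carrier A \<and> 0 < \<phi> a"
  have "\<exists>a. ?P a"
  proof (cases "\<phi> x > 0")
    case False
    then show ?thesis using x by (intro exI[of _ "inv\<^bsub>A\<^esub> x"]) (auto simp: \<phi>.hom_inv)
  qed (use x in auto)
  then obtain a0 where "?P a0" by blast
  \<comment> \<open>Positive values of \<open>\<phi>\<close> are compared through
    \<open>nat\<close>, which makes a least one available.\<close>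
  then obtain a where "?P a" and min: "\<forall>y. ?P y \<longrightarrow> nat (\<phi> a) \<le> nat (\<phi> y)"
    using ex_has_least_nat[of ?P a0 "\<lambda>a. nat (\<phi> a)"] by auto
  then have a: "a \<in> carrier A" "0 < \<phi> a"
    and amin: "\<And>y. y \<in> carrier A \<Longrightarrow> 0 < \<phi> y \<Longrightarrow> nat (\<phi> a) \<le> nat (\<phi> y)"
    by auto
  have \<phi>pow: "\<phi> (a [^]\<^bsub>A\<^esub> c) = c * \<phi> a" for c :: int
    using a by (simp add: \<phi>.hom_int_pow group_int_pow_integer_group)
  \<comment> \<open>The remainder of \<open>\<phi> y\<close> modulo \<open>\<phi> a\<close> is again
    a value of \<open>\<phi>\<close>, so minimality forces it to be 0.\<close>
  have dvd: "\<phi> y = (\<phi> y div \<phi> a) * \<phi> a" if y: "y \<in> carrier A" for y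
  proof -
    have "\<phi> (y \<otimes>\<^bsub>A\<^esub> a [^]\<^bsub>A\<^esub> (- (\<phi> y div \<phi> a))) = \<phi> y mod \<phi> a"
      using y a \<phi>pow[of "- (\<phi> y div \<phi> a)"] by (simp add: minus_div_mult_eq_mod)
    moreover have "y \<otimes>\<^bsub>A\<^esub> a [^]\<^bsub>A\<^esub> (- (\<phi> y div \<phi> a)) \<in> carrier A" using y a by simp
    moreover have "\<phi> y mod \<phi> a < \<phi> a" "0 \<le> \<phi> y mod \<phi> a" using a by auto
    ultimately have "\<phi> y mod \<phi> a = 0" using amin by (metis a(2) nat_less_eq_zless not_le order_le_less)
    then show ?thesis by (metis div_mult_mod_eq add.right_neutral)
  qed
  let ?K = "A\<lparr>carrier := kernel A integer_group \<phi>\<rparr>"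
  obtain n h where h: "h \<in> iso (free_Abelian_group {..<n::nat}) ?K"
    using fg_free_basis[OF K] by blast
  have hK: "h y \<in> carrier A" "\<phi> (h y) = 0" if "Poly_Mapping.keys y \<subseteq> {..<n}" for y
    using hom_in_carrier[of h "free_Abelian_group {..<n}" ?K y] h that
    by (auto simp: iso_def kernel_def)
  \<comment> \<open>The basis of the kernel keeps the indices below \<open>n\<close>; the new index
    \<open>n\<close> goes to \<open>a\<close>.\<close>
  obtain u where u: "u \<in> hom (free_Abelian_group {..<Suc n}) A"
    and uf: "\<And>i. i < Suc n \<Longrightarrow> u (frag_of i) = (if i < n then h (frag_of i) else a)"
  proof (rule A.free_Abelian_group_universal[of "\<lambda>i. if i < n then h (frag_of i) else a" "{..<Suc n}"])
    show "(\<lambda>i. if i < n then h (frag_of i) else a) ` {..<Suc n} \<subseteq> carrier A"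
      using hK(1)[of "frag_of _"] a by auto
  qed auto
  interpret u: group_hom "free_Abelian_group {..<Suc n}" A u
    using u A by (simp add: group_hom_def group_hom_axioms_def comm_group_imp_group)
  interpret h: group_hom "free_Abelian_group {..<n}" ?K h
    using h K by (simp add: group_hom_def group_hom_axioms_def iso_def fg_free_abelian_group_def
        comm_group_imp_group)
  have le: "{..<n} \<subseteq> {..<Suc n}" by auto
  have uh: "u y = h y" if "Poly_Mapping.keys y \<subseteq> {..<n}" for y
    using that
  proof (induction rule: free_Abelian_group_induct[consumes 1, case_names zero diff one])
    case zero
    show ?case using u.hom_one h.hom_one by simp
  next
    case (diff x y)
    have xy: "Poly_Mapping.keys x \<subseteq> {..<Suc n}" "Poly_Mapping.keys (-y) \<subseteq> {..<Suc n}"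
      "Poly_Mapping.keys y \<subseteq> {..<Suc n}" using diff le by auto
    have "u (x + - y) = u x \<otimes>\<^bsub>A\<^esub> inv\<^bsub>A\<^esub> u y"
      using u.hom_mult[of x "-y"] u.hom_inv[of y] xy by simp
    moreover have "h (x + - y) = h x \<otimes>\<^bsub>A\<^esub> inv\<^bsub>?K\<^esub> h y"
      using h.hom_mult[of x "-y"] h.hom_inv[of y] diff by simp
    moreover have "inv\<^bsub>?K\<^esub> h y = inv\<^bsub>A\<^esub> h y"
      using A.m_inv_consistent[OF \<phi>.subgroup_kernel] h.hom_closed[of y] diff by simp
    ultimately show ?case using diff by simp
  qed (use uf in auto)
  have un: "u (frag_cmul c (frag_of n)) = a [^]\<^bsub>A\<^esub> c" for c
    using u.hom_int_pow[of "frag_of n" c] uf[of n] by simp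
  have split: "u (y + frag_cmul c (frag_of n)) = h y \<otimes>\<^bsub>A\<^esub> a [^]\<^bsub>A\<^esub> c"
    if "Poly_Mapping.keys y \<subseteq> {..<n}" for y c
  proof -
    have "Poly_Mapping.keys (frag_cmul c (frag_of n)) \<subseteq> {..<Suc n}"
      using keys_cmul[of c "frag_of n"] by auto
    then have "u (y + frag_cmul c (frag_of n)) = u y \<otimes>\<^bsub>A\<^esub> u (frag_cmul c (frag_of n))"
      using u.hom_mult[of y "frag_cmul c (frag_of n)"] order_trans[OF that le] by simp
    then show ?thesis by (simp only: un uh[OF that])
  qed
  have "u \<in> iso (free_Abelian_group {..<Suc n}) A"
    unfolding iso_iff
  proof (intro conjI u)
    have "y \<in> u ` carrier (free_Abelian_group {..<Suc n})" if y: "y \<in> carrier A" for y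
    proof -
      let ?c = "\<phi> y div \<phi> a" and ?z = "y \<otimes>\<^bsub>A\<^esub> a [^]\<^bsub>A\<^esub> (- (\<phi> y div \<phi> a))"
      have z: "?z \<in> carrier A" "\<phi> ?z = \<phi> y - ?c * \<phi> a"
        using y a \<phi>pow[of "-?c"] by auto
      then have "?z \<in> carrier ?K" using dvd[OF y] by (simp add: kernel_def)
      then have "?z \<in> h ` carrier (free_Abelian_group {..<n})"
        using h unfolding iso_iff by blast
      then obtain w where w: "Poly_Mapping.keys w \<subseteq> {..<n}" "h w = ?z"
        unfolding image_iff carrier_free_Abelian_group_iff Bex_def by metis
      have "u (w + frag_cmul ?c (frag_of n)) = y \<otimes>\<^bsub>A\<^esub> (a [^]\<^bsub>A\<^esub> (- ?c) \<otimes>\<^bsub>A\<^esub> a [^]\<^bsub>A\<^esub> ?c)"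
        using split[OF w(1)] w(2) y a by (simp add: A.m_assoc)
      also have "\<dots> = y" using y a by (simp flip: A.int_pow_mult)
      finally have "u (w + frag_cmul ?c (frag_of n)) = y" .
      moreover have "w + frag_cmul ?c (frag_of n) \<in> carrier (free_Abelian_group {..<Suc n})"
        using keys_add[of w "frag_cmul ?c (frag_of n)"] keys_cmul[of ?c "frag_of n"] w(1) le
        by fastforce
      ultimately show ?thesis by (metis image_eqI)
    qed
    then show "u ` carrier (free_Abelian_group {..<Suc n}) = carrier A" using u.hom_closed by blast
    show "inj_on u (carrier (free_Abelian_group {..<Suc n}))"
      unfolding u.inj_on_one_iff
    proof (intro allI impI)
      fix x assume x: "x \<in> carrier (free_Abelian_group {..<Suc n})" "u x = \<one>\<^bsub>A\<^esub>"
      \<comment> \<open>Split off the coordinate of index \<open>n\<close>. The rest lands in the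
        kernel of \<open>\<phi>\<close>, so applying \<open>\<phi>\<close> shows that this
        coordinate is 0.\<close>
      let ?c = "poly_mapping.lookup x n" and ?y = "x - frag_cmul (poly_mapping.lookup x n) (frag_of n)"
      have y: "Poly_Mapping.keys ?y \<subseteq> {..<n}"
      proof
        fix i assume "i \<in> Poly_Mapping.keys ?y"
        then have "poly_mapping.lookup x i \<noteq> 0 \<and> i \<noteq> n"
          by (auto simp: in_keys_iff lookup_minus lookup_single when_def split: if_splits)
        then show "i \<in> {..<n}" using x(1) by (auto simp: in_keys_iff subset_iff less_Suc_eq)
      qed
      have eq: "h ?y \<otimes>\<^bsub>A\<^esub> a [^]\<^bsub>A\<^esub> ?c = \<one>\<^bsub>A\<^esub>" using split[OF y, of ?c] x by simp
      then have "\<phi> (h ?y \<otimes>\<^bsub>A\<^esub> a [^]\<^bsub>A\<^esub> ?c) = 0" by simp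
      then have "?c * \<phi> a = 0" using hK[OF y] a \<phi>pow by simp
      then have c: "?c = 0" using a by simp
      then have "h ?y = \<one>\<^bsub>?K\<^esub>" using eq hK[OF y] by simp
      then have "?y = 0" using h y h.inj_on_one_iff by (auto simp: iso_iff)
      then show "x = \<one>\<^bsub>free_Abelian_group {..<Suc n}\<^esub>" using c by simp
    qed
  qed
  then have "A \<cong> free_Abelian_group {..<Suc n}"
    using group.iso_sym[OF group_free_Abelian_group] by (auto simp: is_iso_def)
  then show ?thesis using A unfolding fg_free_abelian_group_def by blast
qed

text \<open>On the kernel of one functional the remaining ones still have trivial common kernel, and
  \<open>fg_free_extension\<close> restores the functional that was split off. The group is kept
  arbitrary because the induction passes to that kernel.\<close>

lemma fg_free_if_coordinates:
  assumes "finite \<Phi>" "comm_group A" "\<Phi> \<subseteq> hom A integer_group"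
    "\<And>x. \<lbrakk>x \<in> carrier A; \<And>\<phi>. \<phi> \<in> \<Phi> \<Longrightarrow> \<phi> x = 0\<rbrakk> \<Longrightarrow> x = \<one>\<^bsub>A\<^esub>"
  shows "fg_free_abelian_group (A :: 'a monoid)"
  using assms
proof (induction arbitrary: A rule: finite_induct)
  case empty
  interpret comm_group A by (rule empty)
  have "carrier A = {\<one>\<^bsub>A\<^esub>}" using empty by auto
  then have "(\<lambda>x. 0) \<in> iso A (free_Abelian_group {..<0::nat})"
    by (auto simp: iso_def hom_def bij_betw_def free_Abelian_group_def)
  then show ?case using empty unfolding fg_free_abelian_group_def is_iso_def by blast
next
  case (insert \<phi> \<Phi>)
  interpret A: comm_group A by (rule insert)
  interpret \<phi>: group_hom A integer_group \<phi>
    using insert by (simp add: group_hom_if_hom abelian_integer_group)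
  show ?case
  proof (rule fg_free_extension)
    show "fg_free_abelian_group (A\<lparr>carrier := kernel A integer_group \<phi>\<rparr>)"
    proof (rule insert.IH)
      show "comm_group (A\<lparr>carrier := kernel A integer_group \<phi>\<rparr>)"
        by (rule A.subgroup_comm_group[OF \<phi>.subgroup_kernel])
      show "\<Phi> \<subseteq> hom (A\<lparr>carrier := kernel A integer_group \<phi>\<rparr>) integer_group"
        using insert.prems by (auto simp: kernel_def intro!: hom_restrict_carrier)
      show "x = \<one>\<^bsub>A\<lparr>carrier := kernel A integer_group \<phi>\<rparr>\<^esub>"
        if "x \<in> carrier (A\<lparr>carrier := kernel A integer_group \<phi>\<rparr>)"
          "\<And>\<phi>. \<phi> \<in> \<Phi> \<Longrightarrow> \<phi> x = 0" for x
        using that insert.prems(3)[of x] by (auto simp: kernel_def)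
    qed
  qed (use insert in auto)
qed

text \<open>The coordinates of \<open>B\<close> composed with \<open>f\<close> separate the points
  of \<open>A\<close>. This contains the theorem that subgroups of finitely generated free abelian
  groups are again such groups.\<close>

lemma fg_free_inj:
  fixes A :: "'a monoid"
  assumes "fg_free_abelian_group B" "comm_group A" "f \<in> hom A B" "inj_on f (carrier A)"
  shows "fg_free_abelian_group A"
proof -
  obtain \<Phi> where \<Phi>: "finite \<Phi>" "\<Phi> \<subseteq> hom B integer_group"
    "\<And>x. \<lbrakk>x \<in> carrier B; \<And>\<phi>. \<phi> \<in> \<Phi> \<Longrightarrow> \<phi> x = 0\<rbrakk> \<Longrightarrow> x = \<one>\<^bsub>B\<^esub>"
    using fg_free_coordinates[OF assms(1)] by blast
  interpret f: group_hom A B f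
    using assms by (simp add: group_hom_if_hom fg_free_abelian_group_def)
  show ?thesis
  proof (rule fg_free_if_coordinates)
    show "finite ((\<lambda>\<phi>. \<phi> \<circ> f) ` \<Phi>)" using \<Phi> by simp
    show "(\<lambda>\<phi>. \<phi> \<circ> f) ` \<Phi> \<subseteq> hom A integer_group"
      using \<Phi>(2) assms(3) hom_compose by blast
    show "x = \<one>\<^bsub>A\<^esub>" if "x \<in> carrier A" "\<And>\<phi>. \<phi> \<in> (\<lambda>\<phi>. \<phi> \<circ> f) ` \<Phi> \<Longrightarrow> \<phi> x = 0" for x
    proof -
      have "f x = \<one>\<^bsub>B\<^esub>"
      proof (rule \<Phi>(3))
        show "\<phi> (f x) = 0" if "\<phi> \<in> \<Phi>" for \<phi>
          using \<open>\<And>\<phi>. \<phi> \<in> (\<lambda>\<phi>. \<phi> \<circ> f) ` \<Phi> \<Longrightarrow> \<phi> x = 0\<close>[of "\<phi> \<circ> f"] that by simp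
      qed (use that in simp)
      then show ?thesis using that assms(4) f.inj_on_one_iff by blast
    qed
  qed (rule assms)
qed

lemma fg_free_subgroup:
  assumes "fg_free_abelian_group (A :: 'a monoid)" "subgroup H A"
  shows "fg_free_abelian_group (A\<lparr>carrier := H\<rparr>)"
proof (rule fg_free_inj[OF assms(1)])
  show "comm_group (A\<lparr>carrier := H\<rparr>)"
    using assms by (simp add: fg_free_abelian_group_def comm_group.subgroup_comm_group)
  show "(\<lambda>x. x) \<in> hom (A\<lparr>carrier := H\<rparr>) A"
    using subgroup.subset[OF assms(2)] by (auto simp: hom_def)
qed auto

lemma fg_free_DirProd:
  fixes A :: "'a monoid" and B :: "'b monoid"
  assumes "fg_free_abelian_group A" "fg_free_abelian_group B"
  shows "fg_free_abelian_group (A \<times>\<times> B)"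
proof -
  interpret A: comm_group A using assms by (simp add: fg_free_abelian_group_def)
  interpret B: comm_group B using assms by (simp add: fg_free_abelian_group_def)
  obtain \<Phi> where \<Phi>: "finite \<Phi>" "\<Phi> \<subseteq> hom A integer_group"
    "\<And>x. \<lbrakk>x \<in> carrier A; \<And>\<phi>. \<phi> \<in> \<Phi> \<Longrightarrow> \<phi> x = 0\<rbrakk> \<Longrightarrow> x = \<one>\<^bsub>A\<^esub>"
    using fg_free_coordinates[OF assms(1)] by blast
  obtain \<Psi> where \<Psi>: "finite \<Psi>" "\<Psi> \<subseteq> hom B integer_group"
    "\<And>x. \<lbrakk>x \<in> carrier B; \<And>\<phi>. \<phi> \<in> \<Psi> \<Longrightarrow> \<phi> x = 0\<rbrakk> \<Longrightarrow> x = \<one>\<^bsub>B\<^esub>"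
    using fg_free_coordinates[OF assms(2)] by blast
  show ?thesis
  proof (rule fg_free_if_coordinates)
    show "comm_group (A \<times>\<times> B)"
      by (rule group.group_comm_groupI)
        (auto simp: DirProd_group A.group_axioms B.group_axioms A.m_comm B.m_comm)
    show "finite ((\<lambda>\<phi>. \<phi> \<circ> fst) ` \<Phi> \<union> (\<lambda>\<psi>. \<psi> \<circ> snd) ` \<Psi>)" using \<Phi> \<Psi> by simp
    show "(\<lambda>\<phi>. \<phi> \<circ> fst) ` \<Phi> \<union> (\<lambda>\<psi>. \<psi> \<circ> snd) ` \<Psi> \<subseteq> hom (A \<times>\<times> B) integer_group"
      using \<Phi>(2) \<Psi>(2) by (auto simp: hom_def)
    show "x = \<one>\<^bsub>A \<times>\<times> B\<^esub>" if "x \<in> carrier (A \<times>\<times> B)"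
      "\<And>\<phi>. \<phi> \<in> (\<lambda>\<phi>. \<phi> \<circ> fst) ` \<Phi> \<union> (\<lambda>\<psi>. \<psi> \<circ> snd) ` \<Psi> \<Longrightarrow> \<phi> x = 0" for x
      using \<Phi>(3)[of "fst x"] \<Psi>(3)[of "snd x"] that by (cases x) (force simp: one_DirProd)
  qed
qed

section \<open>Lifting, change of carrier type, generators and products\<close>

lemma fg_free_projective:
  assumes "fg_free_abelian_group A" "comm_group B" "comm_group C" "g \<in> hom B C"
    "g ` carrier B = carrier C" "f \<in> hom A C"
  obtains h where "h \<in> hom A B" "\<And>x. x \<in> carrier A \<Longrightarrow> g (h x) = f x"
proof -
  obtain n b where b: "b \<in> iso (free_Abelian_group {..<n::nat}) A" and A: "comm_group A"
    using fg_free_basis[OF assms(1)] by blast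
  let ?F = "free_Abelian_group {..<n}"
  interpret B: comm_group B by fact
  have bA: "b x \<in> carrier A" if "x \<in> carrier ?F" for x
    using b that by (auto simp: iso_def hom_def)
  have "\<exists>y. y \<in> carrier B \<and> g y = f (b (frag_of i))" if "i < n" for i
  proof -
    have "b (frag_of i) \<in> carrier A" using bA[of "frag_of i"] that by simp
    then have "f (b (frag_of i)) \<in> g ` carrier B" using assms(5,6) by (auto simp: hom_def)
    then show ?thesis by force
  qed
  then obtain y where y: "\<And>i. i < n \<Longrightarrow> y i \<in> carrier B \<and> g (y i) = f (b (frag_of i))" by metis
  obtain u where u: "u \<in> hom ?F B" and uf: "\<And>i. i \<in> {..<n} \<Longrightarrow> u (frag_of i) = y i"
    using B.free_Abelian_group_universal[of y "{..<n}"] y by (metis image_subset_iff lessThan_iff)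
  let ?c = "inv_into (carrier ?F) b"
  have c: "?c \<in> hom A ?F"
    using group.iso_set_sym[OF group_free_Abelian_group b] by (simp add: iso_def)
  have gu: "g \<circ> u \<in> hom ?F C" using u assms(4) by (rule hom_compose)
  have fb: "f \<circ> b \<in> hom ?F C" using b assms(6) by (auto simp: iso_def intro: hom_compose)
  interpret gu: group_hom ?F C "g \<circ> u"
    using gu assms by (simp add: group_hom_def group_hom_axioms_def comm_group_imp_group)
  interpret fb: group_hom ?F C "f \<circ> b"
    using fb assms by (simp add: group_hom_def group_hom_axioms_def comm_group_imp_group)
  have eq: "(g \<circ> u) x = (f \<circ> b) x" if "Poly_Mapping.keys x \<subseteq> {..<n}" for x
    using that
  proof (induction rule: free_Abelian_group_induct[consumes 1, case_names zero diff one])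
    case zero
    show ?case using gu.hom_one fb.hom_one by simp
  next
    case (diff x z)
    then show ?case
      using gu.hom_mult[of x "-z"] gu.hom_inv[of z] fb.hom_mult[of x "-z"] fb.hom_inv[of z]
      by simp
  qed (use uf y in auto)
  show ?thesis
  proof
    show "u \<circ> ?c \<in> hom A B" using c u by (rule hom_compose)
    fix x assume x: "x \<in> carrier A"
    have "?c x \<in> carrier ?F" using c x by (rule hom_in_carrier)
    then have "g (u (?c x)) = f (b (?c x))" using eq[of "?c x"] by simp
    also have "b (?c x) = x" using b x by (simp add: iso_def bij_betw_def f_inv_into_f)
    finally show "g ((u \<circ> ?c) x) = f x" by simp
  qed
qed

text \<open>A finite separating family embeds \<open>A\<close> into integer lists; hence
  \<open>A\<close> is countable and fits into any infinite type. All later changes of carrier type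
  rest on this.\<close>

lemma fg_free_transport:
  assumes "fg_free_abelian_group (A :: 'a monoid)" "infinite (UNIV :: 'b set)"
  obtains \<theta> and B :: "'b monoid" where "comm_group B" "\<theta> \<in> iso A B"
proof -
  obtain \<Phi> where \<Phi>: "finite \<Phi>" "\<Phi> \<subseteq> hom A integer_group"
    "\<And>x. \<lbrakk>x \<in> carrier A; \<And>\<phi>. \<phi> \<in> \<Phi> \<Longrightarrow> \<phi> x = 0\<rbrakk> \<Longrightarrow> x = \<one>\<^bsub>A\<^esub>"
    using fg_free_coordinates[OF assms(1)] by blast
  interpret A: comm_group A using assms by (simp add: fg_free_abelian_group_def)
  obtain \<phi>s where \<phi>s: "set \<phi>s = \<Phi>" using \<Phi>(1) finite_list by blast
  have "inj_on (\<lambda>x. map (\<lambda>\<phi>. \<phi> x) \<phi>s) (carrier A)"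
  proof
    fix x y assume x: "x \<in> carrier A" and y: "y \<in> carrier A"
      and xy: "map (\<lambda>\<phi>. \<phi> x) \<phi>s = map (\<lambda>\<phi>. \<phi> y) \<phi>s"
    have "x \<otimes>\<^bsub>A\<^esub> inv\<^bsub>A\<^esub> y = \<one>\<^bsub>A\<^esub>"
    proof (rule \<Phi>(3))
      fix \<phi> assume p: "\<phi> \<in> \<Phi>"
      then interpret p: group_hom A integer_group \<phi>
        using \<Phi>(2) by (auto intro: group_hom_if_hom A.comm_group_axioms abelian_integer_group)
      show "\<phi> (x \<otimes>\<^bsub>A\<^esub> inv\<^bsub>A\<^esub> y) = 0"
        using xy \<phi>s p x y by (simp add: p.hom_inv)
    qed (use x y in auto)
    then show "x = y" using x y by (metis A.inv_closed A.inv_equality A.inv_inv)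
  qed
  moreover have "countable ((\<lambda>x. map (\<lambda>\<phi>. \<phi> x) \<phi>s) ` carrier A)"
    by (rule countableI_type)
  ultimately have "countable (carrier A)" by (rule countable_image_inj_on[rotated])
  obtain k :: "nat \<Rightarrow> 'b" where k: "inj k"
    using assms(2) infinite_countable_subset by blast
  define \<theta> where "\<theta> = k \<circ> to_nat_on (carrier A)"
  have inj: "inj_on \<theta> (carrier A)"
    unfolding \<theta>_def using \<open>countable (carrier A)\<close> k
    by (metis comp_inj_on inj_on_subset inj_on_to_nat_on subset_UNIV)
  let ?i = "inv_into (carrier A) \<theta>"
  define B where "B = \<lparr>carrier = \<theta> ` carrier A, monoid.mult = (\<lambda>x y. \<theta> (?i x \<otimes>\<^bsub>A\<^esub> ?i y)), one = \<theta> \<one>\<^bsub>A\<^esub>\<rparr>"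
  have \<theta>: "\<theta> \<in> iso A B" using inj by (auto simp: B_def iso_def hom_def bij_betw_def)
  then have "\<theta> \<in> hom A B" by (simp add: iso_def)
  then have "comm_group (B\<lparr>carrier := \<theta> ` carrier A, one := \<theta> \<one>\<^bsub>A\<^esub>\<rparr>)"
    by (rule A.hom_imp_img_comm_group)
  then have "comm_group B" by (simp add: B_def)
  then show ?thesis using that \<theta> by blast
qed

lemma fg_free_generators:
  assumes "fg_free_abelian_group A"
  obtains S where "finite S" "S \<subseteq> carrier A" "\<And>N. \<lbrakk>subgroup N A; S \<subseteq> N\<rbrakk> \<Longrightarrow> N = carrier A"
proof -
  obtain n b where b: "b \<in> iso (free_Abelian_group {..<n::nat}) A" and A: "comm_group A"
    using fg_free_basis[OF assms(1)] by blast
  let ?F = "free_Abelian_group {..<n}"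
  interpret b: group_hom ?F A b
    using b A by (simp add: group_hom_def group_hom_axioms_def iso_def comm_group_imp_group)
  show ?thesis
  proof
    show "finite ((\<lambda>i. b (frag_of i)) ` {..<n})" by simp
    show "(\<lambda>i. b (frag_of i)) ` {..<n} \<subseteq> carrier A" using b.hom_closed by auto
    fix N assume N: "subgroup N A" "(\<lambda>i. b (frag_of i)) ` {..<n} \<subseteq> N"
    interpret N: subgroup N A by fact
    have "b x \<in> N" if "Poly_Mapping.keys x \<subseteq> {..<n}" for x
      using that
    proof (induction rule: free_Abelian_group_induct[consumes 1, case_names zero diff one])
      case zero
      show ?case using b.hom_one by simp
    next
      case (diff x y)
      then show ?case using b.hom_mult[of x "-y"] b.hom_inv[of y] by simp
    qed (use N in auto)
    then have "b ` carrier ?F \<subseteq> N" by auto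
    then show "N = carrier A" using b N.subset by (auto simp: iso_iff)
  qed
qed

lemma comm_group_product_group:
  assumes "\<And>i. i \<in> I \<Longrightarrow> comm_group (G i)"
  shows "comm_group (product_group I G)"
proof (rule group.group_comm_groupI)
  show "group (product_group I G)" using assms by (simp add: comm_group_imp_group)
  show "x \<otimes>\<^bsub>product_group I G\<^esub> y = y \<otimes>\<^bsub>product_group I G\<^esub> x"
    if "x \<in> carrier (product_group I G)" "y \<in> carrier (product_group I G)" for x y
    using that assms
    by (auto simp: PiE_iff fun_eq_iff intro!: comm_monoid.m_comm comm_group.axioms(1))
qed

text \<open>Only the finitely many nontrivial factors contribute coordinates, so \<open>I\<close>
  may be infinite. The total group of a bounded complex is the case where \<open>I\<close> consists
  of all integers.\<close>

lemma fg_free_product_group: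
  fixes G :: "'i \<Rightarrow> 'a monoid"
  assumes "\<And>i. i \<in> I \<Longrightarrow> fg_free_abelian_group (G i)"
    and "finite {i \<in> I. carrier (G i) \<noteq> {\<one>\<^bsub>G i\<^esub>}}"
  shows "fg_free_abelian_group (product_group I G)"
proof -
  let ?J = "{i \<in> I. carrier (G i) \<noteq> {\<one>\<^bsub>G i\<^esub>}}"
  have "\<exists>\<Phi>. finite \<Phi> \<and> \<Phi> \<subseteq> hom (G i) integer_group \<and>
      (\<forall>x \<in> carrier (G i). (\<forall>\<phi> \<in> \<Phi>. \<phi> x = 0) \<longrightarrow> x = \<one>\<^bsub>G i\<^esub>)" if i: "i \<in> I" for i
    using fg_free_coordinates[OF assms(1)[OF i]] by metis
  then obtain \<Phi> where \<Phi>: "\<And>i. i \<in> I \<Longrightarrow> finite (\<Phi> i)"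
    "\<And>i. i \<in> I \<Longrightarrow> \<Phi> i \<subseteq> hom (G i) integer_group"
    "\<And>i x. \<lbrakk>i \<in> I; x \<in> carrier (G i); \<forall>\<phi> \<in> \<Phi> i. \<phi> x = 0\<rbrakk> \<Longrightarrow> x = \<one>\<^bsub>G i\<^esub>"
    by metis
  let ?\<Psi> = "\<Union>i \<in> ?J. (\<lambda>\<phi> x. \<phi> (x i)) ` \<Phi> i"
  show ?thesis
  proof (rule fg_free_if_coordinates)
    show "finite ?\<Psi>" using assms(2) \<Phi>(1) by auto
    show "comm_group (product_group I G)"
      by (rule comm_group_product_group) (use assms(1) in \<open>auto simp: fg_free_abelian_group_def\<close>)
    show "?\<Psi> \<subseteq> hom (product_group I G) integer_group"
    proof clarify
      fix i \<phi> assume i: "i \<in> I" "\<phi> \<in> \<Phi> i"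
      then have "\<phi> \<in> hom (G i) integer_group" using \<Phi>(2) by blast
      then show "(\<lambda>x. \<phi> (x i)) \<in> hom (product_group I G) integer_group"
        using i by (auto simp: hom_def PiE_iff)
    qed
    fix x assume x: "x \<in> carrier (product_group I G)" "\<And>\<psi>. \<psi> \<in> ?\<Psi> \<Longrightarrow> \<psi> x = 0"
    have "x i = \<one>\<^bsub>G i\<^esub>" if i: "i \<in> I" for i
    proof (cases "i \<in> ?J")
      case True
      have "\<phi> (x i) = 0" if "\<phi> \<in> \<Phi> i" for \<phi>
        using x(2)[of "\<lambda>x. \<phi> (x i)"] True that by auto
      then show ?thesis using \<Phi>(3)[of i "x i"] i x(1) by (auto simp: PiE_iff)
    next
      case False
      then show ?thesis using i x(1) by (auto simp: PiE_iff)
    qed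
    then show "x = \<one>\<^bsub>product_group I G\<^esub>" using x(1) by (auto simp: PiE_iff extensional_def)
  qed
qed

section \<open>The ring of dual integers\<close>

abbreviation (input) ZX :: "(int, nat \<Rightarrow> int) up_ring" where "ZX \<equiv> UP INTEG"

abbreviation (input) square_ideal :: "(nat \<Rightarrow> int) set" where
  "square_ideal \<equiv> PIdl\<^bsub>ZX\<^esub> (monom ZX 1 2)"

lemma INTEG_simps [simp]: "\<zero>\<^bsub>INTEG\<^esub> = 0" "\<one>\<^bsub>INTEG\<^esub> = 1" "x \<oplus>\<^bsub>INTEG\<^esub> y = x + y"
  by (simp_all add: INTEG_def)

lemma square_ideal: "ideal square_ideal ZX"
  by (simp add: INTEG.P.cgenideal_ideal)

lemma coeff_square_ideal:
  assumes "p \<in> square_ideal"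
  shows "coeff ZX p 0 = 0" "coeff ZX p 1 = 0"
proof -
  obtain q where q: "q \<in> carrier ZX" "p = q \<otimes>\<^bsub>ZX\<^esub> monom ZX 1 2"
    using assms by (auto simp: cgenideal_def)
  show "coeff ZX p 0 = 0" "coeff ZX p 1 = 0"
    using q by (simp_all add: INTEG.coeff_mult INTEG.coeff_monom atMost_Suc)
qed

text \<open>With \<open>coeff_square_ideal\<close> this identifies the ideal as the polynomials
  without constant and linear term, so the coefficients 0 and 1 are coordinates on the
  quotient.\<close>

lemma square_ideal_if_coeff:
  assumes p: "p \<in> carrier ZX" "coeff ZX p 0 = 0" "coeff ZX p 1 = 0"
  shows "p \<in> square_ideal"
proof -
  have pup: "p \<in> up INTEG" and cp: "coeff ZX p = p" using p(1) by (simp_all add: UP_def)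
  \<comment> \<open>Division by T^2 moves the coefficients down by two places.\<close>
  define q where "q = (\<lambda>n. p (n + 2))"
  obtain m where m: "bound \<zero>\<^bsub>INTEG\<^esub> m p" using pup by blast
  have "bound \<zero>\<^bsub>INTEG\<^esub> m q" unfolding q_def by (rule bound.intro) (use bound.bound[OF m] in simp)
  then have qup: "q \<in> up INTEG" by (intro mem_upI) auto
  then have q: "q \<in> carrier ZX" and cq: "coeff ZX q = q" by (simp_all add: UP_def)
  have "p = q \<otimes>\<^bsub>ZX\<^esub> monom ZX 1 2"
  proof (rule INTEG.up_eqI)
    fix n
    have "coeff ZX (q \<otimes>\<^bsub>ZX\<^esub> monom ZX 1 2) n =
        (\<Oplus>\<^bsub>INTEG\<^esub>i \<in> {..n}. q i * (if 2 = n - i then 1 else \<zero>\<^bsub>INTEG\<^esub>))"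
      using q by (simp add: INTEG.coeff_mult INTEG.coeff_monom cq)
    also have "\<dots> = p n"
    proof (cases "n < 2")
      case True
      then have "(\<Oplus>\<^bsub>INTEG\<^esub>i \<in> {..n}. q i * (if 2 = n - i then 1 else \<zero>\<^bsub>INTEG\<^esub>)) = (\<Oplus>\<^bsub>INTEG\<^esub>i \<in> {..n}. \<zero>\<^bsub>INTEG\<^esub>)"
        by (intro INTEG.R.finsum_cong') auto
      moreover have "n = 0 \<or> n = 1" using True by auto
      ultimately show ?thesis using p(2,3) cp by auto
    next
      case False
      have "(\<Oplus>\<^bsub>INTEG\<^esub>i \<in> {..n}. q i * (if 2 = n - i then 1 else \<zero>\<^bsub>INTEG\<^esub>)) =
          (\<Oplus>\<^bsub>INTEG\<^esub>i \<in> {..n}. if n - 2 = i then q i else \<zero>\<^bsub>INTEG\<^esub>)"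
        using False by (intro INTEG.R.finsum_cong') auto
      also have "\<dots> = q (n - 2)"
        using INTEG.R.finsum_singleton[of "n - 2" "{..n}" q] by simp
      also have "\<dots> = p n" using le_add_diff_inverse2[of 2 n] False by (simp only: q_def not_less)
      finally show ?thesis .
    qed
    finally show "coeff ZX p n = coeff ZX (q \<otimes>\<^bsub>ZX\<^esub> monom ZX 1 2) n" by (simp add: cp)
  qed (use p q in auto)
  then show ?thesis using q by (auto simp: cgenideal_def)
qed

text \<open>The integers \<open>a\<close> and \<open>b\<close> of \<open>r = a + b\<epsilon>\<close>; by \<open>coset_coeff\<close> the choice of the polynomial does not matter.\<close>

definition dual_re :: "(nat \<Rightarrow> int) set \<Rightarrow> int" where
  "dual_re r = coeff ZX (SOME p. p \<in> r) 0"

definition dual_im :: "(nat \<Rightarrow> int) set \<Rightarrow> int" where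
  "dual_im r = coeff ZX (SOME p. p \<in> r) 1"

definition dual :: "int \<Rightarrow> int \<Rightarrow> (nat \<Rightarrow> int) set" where
  "dual a b = square_ideal +>\<^bsub>ZX\<^esub> (monom ZX a 0 \<oplus>\<^bsub>ZX\<^esub> monom ZX b 1)"

lemma cring_dual_integers: "cring dual_integers"
  unfolding dual_integers_def
  using ideal.quotient_is_cring[OF square_ideal INTEG.P.is_cring] by simp

lemma coset_closed [simp]: "p \<in> carrier ZX \<Longrightarrow> square_ideal +>\<^bsub>ZX\<^esub> p \<in> carrier dual_integers"
  by (auto simp: dual_integers_def FactRing_def A_RCOSETS_defs a_r_coset_def r_coset_def)

lemma dual_integers_cases:
  assumes "r \<in> carrier dual_integers"
  obtains p where "p \<in> carrier ZX" "r = square_ideal +>\<^bsub>ZX\<^esub> p"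
  using assms by (auto simp: dual_integers_def FactRing_def A_RCOSETS_defs a_r_coset_def r_coset_def)

lemma coset_hom: "(+>\<^bsub>ZX\<^esub>) square_ideal \<in> ring_hom ZX dual_integers"
  unfolding dual_integers_def using ideal.rcos_ring_hom[OF square_ideal] by simp

lemma coset_coeff:
  assumes "p \<in> carrier ZX"
  shows "dual_re (square_ideal +>\<^bsub>ZX\<^esub> p) = coeff ZX p 0" "dual_im (square_ideal +>\<^bsub>ZX\<^esub> p) = coeff ZX p 1"
proof -
  let ?q = "SOME q. q \<in> square_ideal +>\<^bsub>ZX\<^esub> p"
  have I: "square_ideal \<subseteq> carrier ZX" "\<zero>\<^bsub>ZX\<^esub> \<in> square_ideal"
    using square_ideal by (auto simp: ideal_def additive_subgroup.a_subset additive_subgroup.zero_closed)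
  have "p \<in> square_ideal +>\<^bsub>ZX\<^esub> p"
    using I assms by (force simp: a_r_coset_def r_coset_def)
  then have "?q \<in> square_ideal +>\<^bsub>ZX\<^esub> p" by (rule someI[of "\<lambda>q. q \<in> square_ideal +>\<^bsub>ZX\<^esub> p"])
  then obtain i where i: "i \<in> square_ideal" "?q = i \<oplus>\<^bsub>ZX\<^esub> p"
    by (auto simp: a_r_coset_def r_coset_def)
  then show "dual_re (square_ideal +>\<^bsub>ZX\<^esub> p) = coeff ZX p 0"
    "dual_im (square_ideal +>\<^bsub>ZX\<^esub> p) = coeff ZX p 1"
    using assms I coeff_square_ideal[OF i(1)] unfolding dual_re_def dual_im_def
    by (auto simp: INTEG.coeff_add)
qed

lemma dual_closed [simp]: "dual a b \<in> carrier dual_integers"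
  by (simp add: dual_def)

lemma dual_re_dual [simp]: "dual_re (dual a b) = a" and dual_im_dual [simp]: "dual_im (dual a b) = b"
  by (simp_all add: dual_def coset_coeff)

text \<open>A polynomial and its truncation after the linear term differ by a multiple of T^2, so
  they have the same coset.\<close>

lemma dual_collapse: "r \<in> carrier dual_integers \<Longrightarrow> dual (dual_re r) (dual_im r) = r"
proof (elim dual_integers_cases)
  fix p assume p: "p \<in> carrier ZX" "r = square_ideal +>\<^bsub>ZX\<^esub> p"
  let ?m = "monom ZX (coeff ZX p 0) 0 \<oplus>\<^bsub>ZX\<^esub> monom ZX (coeff ZX p 1) 1"
  have m: "?m \<in> carrier ZX" by simp
  have inv: "coeff ZX (\<ominus>\<^bsub>ZX\<^esub> p) n = - coeff ZX p n" for n
  proof -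
    have "coeff ZX (\<ominus>\<^bsub>ZX\<^esub> p \<oplus>\<^bsub>ZX\<^esub> p) n = 0" using p INTEG.P.l_neg by (simp add: INTEG.coeff_zero)
    then show ?thesis using p by simp
  qed
  have "?m \<ominus>\<^bsub>ZX\<^esub> p \<in> square_ideal"
    by (rule square_ideal_if_coeff) (use p m in \<open>auto simp: a_minus_def inv\<close>)
  then have "square_ideal +>\<^bsub>ZX\<^esub> ?m = r"
    using INTEG.P.quotient_eq_iff_same_a_r_cos[OF square_ideal m p(1)] p by simp
  then show ?thesis using p by (simp add: dual_def coset_coeff)
qed

lemma dual_eqI:
  "\<lbrakk>r \<in> carrier dual_integers; s \<in> carrier dual_integers; dual_re r = dual_re s; dual_im r = dual_im s\<rbrakk>
    \<Longrightarrow> r = s"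
  by (metis dual_collapse)

lemma dual_re_one [simp]: "dual_re \<one>\<^bsub>dual_integers\<^esub> = 1"
  and dual_im_one [simp]: "dual_im \<one>\<^bsub>dual_integers\<^esub> = 0"
  using ring_hom_one[OF coset_hom] coset_coeff[OF INTEG.P.one_closed] by simp_all

lemma dual_add:
  assumes "r \<in> carrier dual_integers" "s \<in> carrier dual_integers"
  shows "dual_re (r \<oplus>\<^bsub>dual_integers\<^esub> s) = dual_re r + dual_re s"
    "dual_im (r \<oplus>\<^bsub>dual_integers\<^esub> s) = dual_im r + dual_im s"
  by (use assms in \<open>auto elim!: dual_integers_cases simp: coset_coeff simp flip: ring_hom_add[OF coset_hom]\<close>)

lemma dual_zero [simp]: "dual_re \<zero>\<^bsub>dual_integers\<^esub> = 0" "dual_im \<zero>\<^bsub>dual_integers\<^esub> = 0"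
proof -
  interpret R: cring dual_integers by (rule cring_dual_integers)
  show "dual_re \<zero>\<^bsub>dual_integers\<^esub> = 0" "dual_im \<zero>\<^bsub>dual_integers\<^esub> = 0"
    using dual_add[of "\<zero>\<^bsub>dual_integers\<^esub>" "\<zero>\<^bsub>dual_integers\<^esub>"] by simp_all
qed

lemma dual_mult:
  assumes "r \<in> carrier dual_integers" "s \<in> carrier dual_integers"
  shows "dual_re (r \<otimes>\<^bsub>dual_integers\<^esub> s) = dual_re r * dual_re s"
    "dual_im (r \<otimes>\<^bsub>dual_integers\<^esub> s) = dual_re r * dual_im s + dual_im r * dual_re s"
  by (use assms in \<open>auto elim!: dual_integers_cases
      simp: coset_coeff INTEG.coeff_mult atMost_Suc simp flip: ring_hom_mult[OF coset_hom]\<close>)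

section \<open>Modules over the dual integers\<close>

text \<open>
  The library's \<open>add_monoid M\<close> keeps the extension fields of the record \<open>M\<close> in its type, so it is
  not of type \<open>'a monoid\<close> for a module \<open>M\<close>.
\<close>

definition additive_group :: "('a, 'k) ring_scheme \<Rightarrow> 'a monoid" where
  "additive_group M = \<lparr>carrier = carrier M, monoid.mult = ring.add M, one = ring.zero M\<rparr>"

lemma additive_group_simps [simp]:
  "carrier (additive_group M) = carrier M" "monoid.mult (additive_group M) = ring.add M"
  "\<one>\<^bsub>additive_group M\<^esub> = \<zero>\<^bsub>M\<^esub>"
  by (simp_all add: additive_group_def)

lemma hom_add_monoid: "hom (add_monoid M) (add_monoid N) = hom (additive_group M) (additive_group N)"
  by (simp add: hom_def)

lemma subgroup_add_monoid: "subgroup H (add_monoid M) \<longleftrightarrow> subgroup H (additive_group M)"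
  by (simp add: subgroup_def m_inv_def)

lemma comm_group_add_monoid: "comm_group (add_monoid M) \<longleftrightarrow> comm_group (additive_group M)"
  by (simp add: comm_group_def comm_monoid_def comm_monoid_axioms_def group_def group_axioms_def
      monoid_def Units_def)

lemma fg_free_dual_integers: "fg_free_abelian_group (additive_group dual_integers)"
proof (rule fg_free_if_coordinates)
  interpret R: cring dual_integers by (rule cring_dual_integers)
  show "finite {dual_re, dual_im}" by simp
  show "comm_group (additive_group dual_integers)" 
    using R.a_comm_group by (simp only: comm_group_add_monoid)
  show "{dual_re, dual_im} \<subseteq> hom (additive_group dual_integers) integer_group"
    by (auto simp: hom_def dual_add)
  show "x = \<one>\<^bsub>additive_group dual_integers\<^esub>" if "x \<in> carrier (additive_group dual_integers)"
    "\<And>\<phi>. \<phi> \<in> {dual_re, dual_im} \<Longrightarrow> \<phi> x = 0" for x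
    using that dual_eqI[of x "\<zero>\<^bsub>dual_integers\<^esub>"] by simp
qed

definition differential_group :: "'a monoid \<Rightarrow> ('a \<Rightarrow> 'a) \<Rightarrow> bool" where
  "differential_group A e \<longleftrightarrow> comm_group A \<and> e \<in> hom A A \<and> (\<forall>x \<in> carrier A. e (e x) = \<one>\<^bsub>A\<^esub>)"

text \<open>The scalar a + b\<open>\<epsilon>\<close> acts as a x + b (\<open>\<epsilon>\<close> x),
  where powers are integer multiples in multiplicative notation. By \<open>smult_eq\<close> the
  scalars of every module over the dual integers act in this way.\<close>

definition dual_module :: "'a monoid \<Rightarrow> ('a \<Rightarrow> 'a) \<Rightarrow> ((nat \<Rightarrow> int) set, 'a) module" where
  "dual_module A e = \<lparr>carrier = carrier A, monoid.mult = undefined, one = undefined,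
     ring.zero = \<one>\<^bsub>A\<^esub>, ring.add = monoid.mult A,
     smult = (\<lambda>r x. x [^]\<^bsub>A\<^esub> dual_re r \<otimes>\<^bsub>A\<^esub> e x [^]\<^bsub>A\<^esub> dual_im r)\<rparr>"

definition eps :: "((nat \<Rightarrow> int) set, 'a) module \<Rightarrow> 'a \<Rightarrow> 'a" where
  "eps M x = dual 0 1 \<odot>\<^bsub>M\<^esub> x"

lemma dual_module_simps [simp]:
  "carrier (dual_module A e) = carrier A"
  "\<zero>\<^bsub>dual_module A e\<^esub> = \<one>\<^bsub>A\<^esub>" "x \<oplus>\<^bsub>dual_module A e\<^esub> y = x \<otimes>\<^bsub>A\<^esub> y"
  by (simp_all add: dual_module_def)

lemma additive_group_dual_module [simp]: "additive_group (dual_module A e) = A"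
  by (simp add: dual_module_def additive_group_def)

lemma module_dual_module:
  assumes "differential_group A e"
  shows "module dual_integers (dual_module A e)"
proof -
  interpret A: comm_group A using assms by (simp add: differential_group_def)
  interpret e: group_hom A A e
    using assms by (simp add: differential_group_def group_hom_if_hom)
  have ee [simp]: "e (e x) = \<one>\<^bsub>A\<^esub>" if "x \<in> carrier A" for x
    using assms that by (simp add: differential_group_def)
  show ?thesis
  proof (rule moduleI)
    show "cring dual_integers" by (rule cring_dual_integers)
    show "abelian_group (dual_module A e)"
      by (rule comm_group_abelian_groupI)
        (simp only: comm_group_add_monoid additive_group_dual_module A.comm_group_axioms)
    show "r \<odot>\<^bsub>dual_module A e\<^esub> x \<in> carrier (dual_module A e)"
      if "x \<in> carrier (dual_module A e)" for r x
      using that by (simp add: dual_module_def)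
    show "(r \<oplus>\<^bsub>dual_integers\<^esub> s) \<odot>\<^bsub>dual_module A e\<^esub> x =
        r \<odot>\<^bsub>dual_module A e\<^esub> x \<oplus>\<^bsub>dual_module A e\<^esub> s \<odot>\<^bsub>dual_module A e\<^esub> x"
      if "r \<in> carrier dual_integers" "s \<in> carrier dual_integers" "x \<in> carrier (dual_module A e)" for r s x
      using that by (simp add: dual_module_def dual_add A.int_pow_mult A.m_ac)
    show "r \<odot>\<^bsub>dual_module A e\<^esub> (x \<oplus>\<^bsub>dual_module A e\<^esub> y) =
        r \<odot>\<^bsub>dual_module A e\<^esub> x \<oplus>\<^bsub>dual_module A e\<^esub> r \<odot>\<^bsub>dual_module A e\<^esub> y"
      if "x \<in> carrier (dual_module A e)" "y \<in> carrier (dual_module A e)" for r x y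
      using that by (simp add: dual_module_def A.int_pow_distrib A.m_ac)
    show "(r \<otimes>\<^bsub>dual_integers\<^esub> s) \<odot>\<^bsub>dual_module A e\<^esub> x =
        r \<odot>\<^bsub>dual_module A e\<^esub> (s \<odot>\<^bsub>dual_module A e\<^esub> x)"
      if "r \<in> carrier dual_integers" "s \<in> carrier dual_integers" "x \<in> carrier (dual_module A e)" for r s x
      using that by (simp add: dual_module_def dual_mult A.int_pow_mult A.int_pow_distrib
          A.int_pow_pow e.hom_int_pow mult.commute A.m_ac)
    show "\<one>\<^bsub>dual_integers\<^esub> \<odot>\<^bsub>dual_module A e\<^esub> x = x" if "x \<in> carrier (dual_module A e)" for x
      using that by (simp add: dual_module_def)
  qed
qed

lemma eps_dual_module:
  assumes "differential_group A e" "x \<in> carrier A"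
  shows "eps (dual_module A e) x = e x"
proof -
  interpret A: comm_group A using assms by (simp add: differential_group_def)
  interpret e: group_hom A A e
    using assms by (simp add: differential_group_def group_hom_if_hom)
  show ?thesis using assms(2) by (simp add: eps_def dual_module_def)
qed

lemma hom_integer_group_eq_pow:
  assumes "group G" "h \<in> hom integer_group G"
  shows "h k = h 1 [^]\<^bsub>G\<^esub> (k :: int)"
proof -
  interpret h: group_hom integer_group G h
    using assms by (simp add: group_hom_def group_hom_axioms_def)
  show ?thesis using h.hom_int_pow[of 1 k] by simp
qed

locale dual_integers_module = module dual_integers M for M :: "((nat \<Rightarrow> int) set, 'b) module" (structure)
begin

lemma comm_group_add: "comm_group (additive_group M)" 
  using M.a_comm_group by (simp only: comm_group_add_monoid)

sublocale A: comm_group "additive_group M"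
  rewrites "carrier (additive_group M) = carrier M" and "monoid.mult (additive_group M) = ring.add M"
    and "one (additive_group M) = ring.zero M"
  by (rule comm_group_add) simp_all

lemma eps_closed [simp]: "x \<in> carrier M \<Longrightarrow> eps M x \<in> carrier M"
  by (simp add: eps_def)

lemma eps_add: "\<lbrakk>x \<in> carrier M; y \<in> carrier M\<rbrakk> \<Longrightarrow> eps M (x \<oplus> y) = eps M x \<oplus> eps M y"
  by (simp add: eps_def smult_r_distr)

lemma eps_eps [simp]: "x \<in> carrier M \<Longrightarrow> eps M (eps M x) = \<zero>"
proof -
  assume x: "x \<in> carrier M"
  have "dual 0 1 \<otimes>\<^bsub>dual_integers\<^esub> dual 0 1 = \<zero>\<^bsub>dual_integers\<^esub>"
    by (rule dual_eqI) (simp_all add: dual_mult)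
  then show ?thesis using x smult_assoc1[of "dual 0 1" "dual 0 1" x] by (simp add: eps_def)
qed

lemma differential_group: "differential_group (additive_group M) (eps M)"
  using comm_group_add by (auto simp: differential_group_def hom_def eps_add)

text \<open>The actions of k and of k\<open>\<epsilon>\<close> are additive in the integer k, and a
  homomorphism out of the integers is determined by its value at 1. Hence \<open>eps\<close> and the
  additive group determine the whole module structure.\<close>

lemma smult_eq:
  assumes r: "r \<in> carrier dual_integers" and x: "x \<in> carrier M"
  shows "r \<odot> x = x [^]\<^bsub>additive_group M\<^esub> dual_re r \<oplus> eps M x [^]\<^bsub>additive_group M\<^esub> dual_im r"
proof -
  have "dual (dual_re r) 0 \<oplus>\<^bsub>dual_integers\<^esub> dual 0 (dual_im r) = r"
    by (rule dual_eqI) (simp_all add: r dual_add)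
  then have "r \<odot> x = dual (dual_re r) 0 \<odot> x \<oplus> dual 0 (dual_im r) \<odot> x"
    using x by (metis smult_l_distr dual_closed)
  also have "dual k 0 \<odot> x = x [^]\<^bsub>additive_group M\<^esub> k" for k
  proof -
    have "dual (k + l) 0 = dual k 0 \<oplus>\<^bsub>dual_integers\<^esub> dual l 0" for k l
      by (rule dual_eqI) (simp_all add: dual_add)
    then have "(\<lambda>k. dual k 0 \<odot> x) \<in> hom integer_group (additive_group M)"
      using x by (auto simp: hom_def smult_l_distr)
    moreover have "dual 1 0 = \<one>\<^bsub>dual_integers\<^esub>" by (rule dual_eqI) simp_all
    ultimately show ?thesis
      using hom_integer_group_eq_pow[OF A.group_axioms, of "\<lambda>k. dual k 0 \<odot> x" k] x by simp
  qed
  also have "dual 0 k \<odot> x = eps M x [^]\<^bsub>additive_group M\<^esub> k" for k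
  proof -
    have "dual 0 (k + l) = dual 0 k \<oplus>\<^bsub>dual_integers\<^esub> dual 0 l" for k l
      by (rule dual_eqI) (simp_all add: dual_add)
    then have "(\<lambda>k. dual 0 k \<odot> x) \<in> hom integer_group (additive_group M)"
      using x by (auto simp: hom_def smult_l_distr)
    then show ?thesis
      using hom_integer_group_eq_pow[OF A.group_axioms, of "\<lambda>k. dual 0 k \<odot> x" k] x
      by (simp add: eps_def)
  qed
  finally show ?thesis .
qed

lemma submodule_iff:
  "submodule N dual_integers M \<longleftrightarrow> subgroup N (additive_group M) \<and> (\<forall>x \<in> N. eps M x \<in> N)"
proof
  assume "submodule N dual_integers M"
  then interpret submodule N dual_integers M .
  show "subgroup N (additive_group M) \<and> (\<forall>x \<in> N. eps M x \<in> N)"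
    using smult_closed subgroup_axioms by (simp add: subgroup_add_monoid eps_def)
next
  assume N: "subgroup N (additive_group M) \<and> (\<forall>x \<in> N. eps M x \<in> N)"
  then interpret N: subgroup N "additive_group M" by simp
  have pow: "x [^]\<^bsub>additive_group M\<^esub> (k :: int) \<in> N" if "x \<in> N" for x k
    using A.subgroup_int_pow_closed[of N x k] N that by simp
  have "r \<odot> x \<in> N" if "r \<in> carrier dual_integers" "x \<in> N" for r x
  proof -
    have "x \<in> carrier M" using N.subset that by auto
    then show ?thesis using that pow N N.m_closed by (simp add: smult_eq)
  qed
  then show "submodule N dual_integers M"
    using N by (simp add: submodule_def submodule_axioms_def subgroup_add_monoid)
qed

end

lemma dual_integers_module_dual_module:
  "differential_group A e \<Longrightarrow> dual_integers_module (dual_module A e)"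
  by (simp add: dual_integers_module_def module_dual_module)

text \<open>By \<open>smult_eq\<close> scalars act through powers and \<open>eps\<close>. Group
  homomorphisms respect powers, so commuting with \<open>eps\<close> is all that linearity
  adds.\<close>

lemma module_homs_dual_integers:
  assumes "dual_integers_module M" "dual_integers_module N"
  shows "module_homs dual_integers M N =
    {f \<in> hom (additive_group M) (additive_group N) \<inter> extensional (carrier M).
      \<forall>x \<in> carrier M. f (eps M x) = eps N (f x)}"
proof -
  interpret M: dual_integers_module M by (rule assms)
  interpret N: dual_integers_module N by (rule assms)
  have "f (r \<odot>\<^bsub>M\<^esub> x) = r \<odot>\<^bsub>N\<^esub> f x"
    if f: "f \<in> hom (additive_group M) (additive_group N)" "\<forall>x \<in> carrier M. f (eps M x) = eps N (f x)"
      and r: "r \<in> carrier dual_integers" and x: "x \<in> carrier M" for f r x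
  proof -
    interpret f: group_hom "additive_group M" "additive_group N" f
      using f M.comm_group_add N.comm_group_add by (simp add: group_hom_if_hom)
    have fx: "f x \<in> carrier N" using f.hom_closed x by simp
    have p: "y [^]\<^bsub>additive_group M\<^esub> (k :: int) \<in> carrier M" if "y \<in> carrier M" for y k
      using M.A.int_pow_closed[of y k] that by simp
    have "f (y [^]\<^bsub>additive_group M\<^esub> (k :: int)) = f y [^]\<^bsub>additive_group N\<^esub> k" if "y \<in> carrier M" for y k
      using f.hom_int_pow[of y k] that by simp
    moreover have "f (y \<oplus>\<^bsub>M\<^esub> z) = f y \<oplus>\<^bsub>N\<^esub> f z" if "y \<in> carrier M" "z \<in> carrier M" for y z
      using f.hom_mult[of y z] that by simp
    ultimately show ?thesis
      by (simp only: M.smult_eq[OF r x] N.smult_eq[OF r fx] p x M.eps_closed bspec[OF f(2)])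
  qed
  then have "f \<in> module_homs dual_integers M N"
    if "f \<in> hom (additive_group M) (additive_group N)" "f \<in> extensional (carrier M)"
      "\<forall>x \<in> carrier M. f (eps M x) = eps N (f x)" for f
    using that unfolding module_homs_def hom_add_monoid by blast
  moreover have "f (eps M x) = eps N (f x)"
    if "f \<in> module_homs dual_integers M N" "x \<in> carrier M" for f x
    unfolding eps_def using that dual_closed by (simp only: module_homs_def) blast
  moreover have "module_homs dual_integers M N \<subseteq>
      hom (additive_group M) (additive_group N) \<inter> extensional (carrier M)"
    unfolding module_homs_def hom_add_monoid by blast
  ultimately show ?thesis by blast
qed

section \<open>Torsionless modules\<close>

lemma fg_module_if_fg_free:
  assumes "module dual_integers M" "fg_free_abelian_group (additive_group M)"
  shows "fg_module dual_integers M"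
proof -
  obtain S where S: "finite S" "S \<subseteq> carrier (additive_group M)"
    "\<And>N. \<lbrakk>subgroup N (additive_group M); S \<subseteq> N\<rbrakk> \<Longrightarrow> N = carrier (additive_group M)"
    using fg_free_generators[OF assms(2)] by blast
  then show ?thesis
    using assms(1) unfolding fg_module_def submodule_def subgroup_add_monoid by (intro conjI exI[of _ S]) auto
qed

lemma additive_group_free_module:
  "additive_group (free_module R n) = product_group {..<n} (\<lambda>i. additive_group R)"
  by (simp add: free_module_def product_group_def additive_group_def)

lemma module_free_module:
  fixes R (structure)
  assumes "cring R" shows "module R (free_module R n)"
proof -
  interpret R: cring R by (rule assms)
  show ?thesis
  proof (rule moduleI)
    show "abelian_group (free_module R n)"
      by (rule comm_group_abelian_groupI)
        (auto simp only: comm_group_add_monoid additive_group_free_module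
          intro: comm_group_product_group R.a_comm_group[unfolded comm_group_add_monoid])
  qed (auto simp: assms free_module_def PiE_iff extensional_def R.l_distr R.r_distr R.m_assoc
      intro!: restrict_ext)
qed

text \<open>Freeness descends from free modules along injections. Conversely, a linear form F is
  determined by its \<open>\<epsilon>\<close>-part: comparing \<open>\<epsilon>\<close>-parts in
  F(\<open>\<epsilon>\<close> x) = \<open>\<epsilon>\<close> F(x) shows that the constant part of
  F(x) is the \<open>\<epsilon>\<close>-part of F(\<open>\<epsilon>\<close> x). So each coordinate
  extends to exactly one linear form, and these forms are the components of
  \<open>\<iota>\<close>.\<close>

lemma torsionless_iff_fg_free:
  assumes M: "module dual_integers M"
  shows "torsionless_module dual_integers M \<longleftrightarrow> fg_free_abelian_group (additive_group M)"
proof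
  interpret M: dual_integers_module M using M by (simp add: dual_integers_module_def)
  assume "torsionless_module dual_integers M"
  then obtain n N f where N: "submodule N dual_integers (free_module dual_integers n)"
    and f: "f \<in> module_homs dual_integers M ((free_module dual_integers n)\<lparr>carrier := N\<rparr>)"
    and bij: "bij_betw f (carrier M) N"
    by (auto simp: torsionless_module_def isomorphic_modules_def)
  have "N \<subseteq> carrier (free_module dual_integers n)"
    using N subgroup.subset[of N "additive_group (free_module dual_integers n)"]
    by (auto simp: submodule_def subgroup_add_monoid)
  then have "f \<in> hom (additive_group M) (additive_group (free_module dual_integers n))"
    using f by (auto simp: module_homs_def hom_def)
  moreover have "fg_free_abelian_group (additive_group (free_module dual_integers n))"
    by (simp add: additive_group_free_module fg_free_product_group fg_free_dual_integers)
  ultimately show "fg_free_abelian_group (additive_group M)"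
    using bij M.comm_group_add by (intro fg_free_inj[of _ "additive_group M" f]) (auto simp: bij_betw_def)
next
  interpret M: dual_integers_module M using M by (simp add: dual_integers_module_def)
  assume free: "fg_free_abelian_group (additive_group M)"
  then obtain \<Phi> where \<Phi>: "finite \<Phi>" "\<Phi> \<subseteq> hom (additive_group M) integer_group"
    "\<And>x. \<lbrakk>x \<in> carrier (additive_group M); \<And>\<phi>. \<phi> \<in> \<Phi> \<Longrightarrow> \<phi> x = 0\<rbrakk> \<Longrightarrow> x = \<one>\<^bsub>additive_group M\<^esub>"
    using fg_free_coordinates by blast
  obtain \<phi>s where \<phi>s: "set \<phi>s = \<Phi>" using \<Phi>(1) finite_list by blast
  define n where "n = length \<phi>s"
  let ?F = "free_module dual_integers n"
  interpret F: dual_integers_module ?F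
    by (simp add: dual_integers_module_def module_free_module cring_dual_integers)
  define \<iota> where "\<iota> = (\<lambda>x \<in> carrier M. \<lambda>i \<in> {..<n}. dual ((\<phi>s ! i) (eps M x)) ((\<phi>s ! i) x))"
  have hom: "\<phi>s ! i \<in> hom (additive_group M) integer_group" if "i < n" for i
    using that \<phi>s \<Phi>(2) by (auto simp: n_def)
  have zero: "(\<phi>s ! i) \<zero>\<^bsub>M\<^esub> = 0" if "i < n" for i
    using hom_one[OF hom[OF that]] M.A.group_axioms by simp
  have add: "dual (a + c) (b + d) = dual a b \<oplus>\<^bsub>dual_integers\<^esub> dual c d" for a b c d
    by (rule dual_eqI) (simp_all add: dual_add)
  have \<iota>_hom: "\<iota> \<in> hom (additive_group M) (additive_group ?F)"
    using hom_mult[OF hom]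
    by (auto simp: hom_def \<iota>_def free_module_def M.eps_add add intro!: restrict_ext)
  have eps: "dual 0 1 \<otimes>\<^bsub>dual_integers\<^esub> dual a b = dual 0 a" for a b
    by (rule dual_eqI) (simp_all add: dual_mult)
  \<comment> \<open>At \<open>eps M x\<close> the constant part vanishes, since \<open>eps\<close>
    squares to zero, and the former constant part becomes the \<open>\<epsilon>\<close>-part.
    Multiplication by \<open>\<epsilon>\<close> does the same.\<close>
  have \<iota>_eps: "\<iota> (eps M x) = eps ?F (\<iota> x)" if "x \<in> carrier M" for x
  proof -
    have "eps ?F y = (\<lambda>i \<in> {..<n}. dual 0 1 \<otimes>\<^bsub>dual_integers\<^esub> y i)" for y
      by (simp add: eps_def free_module_def)
    then show ?thesis using that zero by (auto simp: \<iota>_def eps intro!: restrict_ext)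
  qed
  interpret \<iota>: group_hom "additive_group M" "additive_group ?F" \<iota>
    using \<iota>_hom M.comm_group_add F.comm_group_add by (simp add: group_hom_if_hom)
  have inj: "inj_on \<iota> (carrier M)"
    using \<iota>.inj_on_one_iff
  proof (simp, intro allI impI)
    fix x assume x: "x \<in> carrier M" "\<iota> x = \<zero>\<^bsub>?F\<^esub>"
    have "\<phi> x = 0" if "\<phi> \<in> \<Phi>" for \<phi>
    proof -
      have "\<phi> \<in> set \<phi>s" using that \<phi>s by simp
      then obtain i where i: "i < n" "\<phi> = \<phi>s ! i" unfolding n_def in_set_conv_nth by metis
      then have "dual (\<phi> (eps M x)) (\<phi> x) = \<zero>\<^bsub>dual_integers\<^esub>"
        using fun_cong[OF x(2), of i] x(1) by (simp add: \<iota>_def free_module_def)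
      then show ?thesis by (metis dual_im_dual dual_zero(2))
    qed
    then show "x = \<zero>\<^bsub>M\<^esub>" using \<Phi>(3)[of x] x by simp
  qed
  have "submodule (\<iota> ` carrier M) dual_integers ?F"
    unfolding F.submodule_iff using \<iota>.img_is_subgroup \<iota>_eps by (auto simp flip: \<iota>_eps)
  moreover have "\<iota> \<in> module_homs dual_integers M (?F\<lparr>carrier := \<iota> ` carrier M\<rparr>)"
  proof -
    have "\<iota> \<in> module_homs dual_integers M ?F"
      using \<iota>_hom \<iota>_eps unfolding module_homs_dual_integers[OF M.dual_integers_module_axioms F.dual_integers_module_axioms]
      by (auto simp: \<iota>_def)
    then show ?thesis by (auto simp: module_homs_def hom_def)
  qed
  ultimately show "torsionless_module dual_integers M"
    using inj unfolding torsionless_module_def isomorphic_modules_def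
    by (intro exI[of _ n] exI[of _ "\<iota> ` carrier M"]) (auto simp: bij_betw_def)
qed

section \<open>Gorenstein projective modules\<close>

lemma differential_group_iso:
  assumes "differential_group A e" "comm_group B" "group_isomorphisms A B \<theta> \<theta>'"
  shows "differential_group B (\<theta> \<circ> e \<circ> \<theta>')"
proof -
  have \<theta>: "\<theta> \<in> hom A B" "\<theta>' \<in> hom B A" "\<And>x. x \<in> carrier A \<Longrightarrow> \<theta>' (\<theta> x) = x"
    using assms(3) by (auto simp: group_isomorphisms_def)
  have e: "e \<in> hom A A" "\<And>x. x \<in> carrier A \<Longrightarrow> e (e x) = \<one>\<^bsub>A\<^esub>"
    using assms(1) by (auto simp: differential_group_def)
  have "\<theta> \<circ> e \<circ> \<theta>' \<in> hom B B"
    using \<theta> e by (blast intro: hom_compose)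
  moreover have "(\<theta> \<circ> e \<circ> \<theta>') ((\<theta> \<circ> e \<circ> \<theta>') x) = \<one>\<^bsub>B\<^esub>" if "x \<in> carrier B" for x
  proof -
    have "\<theta>' x \<in> carrier A" "e (\<theta>' x) \<in> carrier A" using \<theta>(2) e(1) that by (auto simp: hom_def)
    moreover have "\<theta> \<one>\<^bsub>A\<^esub> = \<one>\<^bsub>B\<^esub>"
      using assms \<theta>(1) by (auto simp: differential_group_def comm_group_imp_group intro: hom_one)
    ultimately show ?thesis using \<theta>(3) e(2) by simp
  qed
  ultimately show ?thesis using assms(2) by (simp add: differential_group_def)
qed

lemma group_isomorphisms_transport:
  assumes "fg_free_abelian_group (A :: 'a monoid)" "infinite (UNIV :: 'b set)"
  obtains \<theta> \<theta>' and B :: "'b monoid" where "comm_group B" "group_isomorphisms A B \<theta> \<theta>'"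
proof -
  obtain \<theta> and B :: "'b monoid" where "comm_group B" "\<theta> \<in> iso A B"
    using fg_free_transport[OF assms] by blast
  moreover have "group A" using assms by (simp add: fg_free_abelian_group_def comm_group_imp_group)
  ultimately show ?thesis using that group.iso_iff_group_isomorphisms by blast
qed

lemma module_regular_module:
  fixes R (structure)
  assumes "cring R" shows "module R (regular_module R)"
proof -
  interpret R: cring R by (rule assms)
  show ?thesis
  proof (rule moduleI)
    have "additive_group (regular_module R) = additive_group R"
      by (simp add: additive_group_def regular_module_def)
    then show "abelian_group (regular_module R)"
      using R.a_comm_group by (intro comm_group_abelian_groupI) (simp only: comm_group_add_monoid)
  qed (auto simp: assms regular_module_def R.l_distr R.r_distr R.m_assoc)
qed

lemma eps_regular_module [simp]:
  "r \<in> carrier dual_integers \<Longrightarrow> eps (regular_module dual_integers) r = dual 0 (dual_re r)"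
  unfolding eps_def regular_module_def
  by (rule dual_eqI) (simp_all add: dual_mult cring.cring_simprules(5) cring_dual_integers)

lemma isomorphic_modules_onto_image:
  assumes "f \<in> module_homs R M N" "inj_on f (carrier M)" "f ` carrier M = K"
  shows "isomorphic_modules R M (N\<lparr>carrier := K\<rparr>)"
proof -
  have "f \<in> module_homs R M (N\<lparr>carrier := K\<rparr>)"
    using assms(1,3) by (auto simp: module_homs_def hom_def)
  then show ?thesis using assms(2,3) by (auto simp: isomorphic_modules_def bij_betw_def)
qed

text \<open>
  \<open>dual_module B e\<close> is a copy of the induced module \<open>A \<otimes> \<int>[\<epsilon>]\<close>; the element \<open>a + b\<epsilon>\<close> is
  \<open>\<theta> (a, b)\<close>.
\<close>

locale induced_module =
  fixes A :: "'a monoid" and B :: "'b monoid" and e :: "'b \<Rightarrow> 'b"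
    and \<theta> :: "'a \<times> 'a \<Rightarrow> 'b" and \<theta>' :: "'b \<Rightarrow> 'a \<times> 'a"
  assumes A_free: "fg_free_abelian_group A" and B_e: "differential_group B e"
    and \<theta>_\<theta>': "group_isomorphisms (A \<times>\<times> A) B \<theta> \<theta>'"
    and e_\<theta>: "\<lbrakk>a \<in> carrier A; b \<in> carrier A\<rbrakk> \<Longrightarrow> e (\<theta> (a, b)) = \<theta> (\<one>\<^bsub>A\<^esub>, a)"

lemma induced_module_exists:
  assumes A: "fg_free_abelian_group (A :: 'a monoid)" and "infinite (UNIV :: 'b set)"
  obtains B :: "'b monoid" and e \<theta> \<theta>' where "induced_module A B e \<theta> \<theta>'"
proof -
  have A2: "fg_free_abelian_group (A \<times>\<times> A)" using A by (simp add: fg_free_DirProd)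
  obtain B :: "'b monoid" and \<theta> \<theta>' where B: "comm_group B" "group_isomorphisms (A \<times>\<times> A) B \<theta> \<theta>'"
    using group_isomorphisms_transport[OF A2 assms(2)] by metis
  interpret A: comm_group A using A by (simp add: fg_free_abelian_group_def)
  \<comment> \<open>Multiplication by \<open>\<epsilon>\<close> takes a + b\<open>\<epsilon>\<close>
    to a\<open>\<epsilon>\<close>.\<close>
  let ?e = "\<lambda>(a, b). (\<one>\<^bsub>A\<^esub>, a)"
  have "differential_group (A \<times>\<times> A) ?e"
    using A2 by (auto simp: differential_group_def fg_free_abelian_group_def hom_def)
  then have "differential_group B (\<theta> \<circ> ?e \<circ> \<theta>')" using B by (rule differential_group_iso)
  then have "induced_module A B (\<theta> \<circ> ?e \<circ> \<theta>') \<theta> \<theta>'"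
    using A B by (auto simp: induced_module_def group_isomorphisms_def)
  then show ?thesis by (rule that)
qed

context induced_module
begin

sublocale A: comm_group A using A_free by (simp add: fg_free_abelian_group_def)
sublocale B: comm_group B using B_e by (simp add: differential_group_def)
sublocale e: group_hom B B e using B_e by (simp add: differential_group_def group_hom_if_hom)
sublocale module: dual_integers_module "dual_module B e"
  by (rule dual_integers_module_dual_module[OF B_e])

lemma \<theta>_closed [simp]: "\<lbrakk>a \<in> carrier A; b \<in> carrier A\<rbrakk> \<Longrightarrow> \<theta> (a, b) \<in> carrier B"
  using \<theta>_\<theta>' by (auto simp: group_isomorphisms_def hom_def)

lemma \<theta>'_\<theta> [simp]: "\<lbrakk>a \<in> carrier A; b \<in> carrier A\<rbrakk> \<Longrightarrow> \<theta>' (\<theta> (a, b)) = (a, b)"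
  using \<theta>_\<theta>' by (auto simp: group_isomorphisms_def)

lemma B_cases:
  assumes "y \<in> carrier B"
  obtains a b where "a \<in> carrier A" "b \<in> carrier A" "y = \<theta> (a, b)"
proof -
  have "\<theta>' y \<in> carrier (A \<times>\<times> A)" "\<theta> (\<theta>' y) = y"
    using \<theta>_\<theta>' assms by (auto simp: group_isomorphisms_def dest: hom_in_carrier)
  then show ?thesis using that[of "fst (\<theta>' y)" "snd (\<theta>' y)"] by auto
qed

lemma \<theta>_mult:
  "\<lbrakk>a \<in> carrier A; b \<in> carrier A; c \<in> carrier A; d \<in> carrier A\<rbrakk>
    \<Longrightarrow> \<theta> (a, b) \<otimes>\<^bsub>B\<^esub> \<theta> (c, d) = \<theta> (a \<otimes>\<^bsub>A\<^esub> c, b \<otimes>\<^bsub>A\<^esub> d)"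
  using \<theta>_\<theta>' hom_mult[of \<theta> "A \<times>\<times> A" B "(a, b)" "(c, d)"] by (auto simp: group_isomorphisms_def)

lemma \<theta>_one: "\<theta> (\<one>\<^bsub>A\<^esub>, \<one>\<^bsub>A\<^esub>) = \<one>\<^bsub>B\<^esub>"
  using e_\<theta>[of "\<one>\<^bsub>A\<^esub>" "\<one>\<^bsub>A\<^esub>"] \<theta>_mult[of "\<one>\<^bsub>A\<^esub>" "\<one>\<^bsub>A\<^esub>" "\<one>\<^bsub>A\<^esub>" "\<one>\<^bsub>A\<^esub>"]
  by (metis A.one_closed A.r_one B.r_cancel_one' \<theta>_closed)

lemma \<theta>_eq_iff:
  "\<lbrakk>a \<in> carrier A; b \<in> carrier A; c \<in> carrier A; d \<in> carrier A\<rbrakk>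
    \<Longrightarrow> \<theta> (a, b) = \<theta> (c, d) \<longleftrightarrow> a = c \<and> b = d"
  by (metis \<theta>'_\<theta> prod.inject)

lemma eps_B: "y \<in> carrier B \<Longrightarrow> eps (dual_module B e) y = e y"
  by (rule eps_dual_module[OF B_e])

text \<open>Induction is left adjoint to restriction to \<open>\<int>\<close>.\<close>

definition induce :: "((nat \<Rightarrow> int) set, 'c) module \<Rightarrow> ('a \<Rightarrow> 'c) \<Rightarrow> 'b \<Rightarrow> 'c" where
  "induce M h = (\<lambda>y \<in> carrier B. h (fst (\<theta>' y)) \<oplus>\<^bsub>M\<^esub> eps M (h (snd (\<theta>' y))))"

lemma induce_\<theta>: "\<lbrakk>a \<in> carrier A; b \<in> carrier A\<rbrakk> \<Longrightarrow> induce M h (\<theta> (a, b)) = h a \<oplus>\<^bsub>M\<^esub> eps M (h b)"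
  by (simp add: induce_def)

text \<open>\<open>eps M\<close> kills the summand \<open>eps M (h b)\<close>, just as
  \<open>e\<close> discards the coordinate \<open>b\<close> and moves \<open>a\<close> into its
  place.\<close>

lemma induce_in_module_homs:
  assumes "dual_integers_module M" "h \<in> hom A (additive_group M)"
  shows "induce M h \<in> module_homs dual_integers (dual_module B e) M"
proof -
  interpret M: dual_integers_module M by (rule assms)
  interpret h: group_hom A "additive_group M" h
    using assms A.comm_group_axioms M.comm_group_add by (simp add: group_hom_if_hom)
  have [simp]: "h a \<in> carrier M" if "a \<in> carrier A" for a using h.hom_closed that by simp
  have hm: "h (a \<otimes>\<^bsub>A\<^esub> b) = h a \<oplus>\<^bsub>M\<^esub> h b" if "a \<in> carrier A" "b \<in> carrier A" for a b
    using h.hom_mult that by simp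
  have h1: "h \<one>\<^bsub>A\<^esub> = \<zero>\<^bsub>M\<^esub>" using h.hom_one by simp
  have e0: "eps M \<zero>\<^bsub>M\<^esub> = \<zero>\<^bsub>M\<^esub>" by (simp add: eps_def)
  have "induce M h y \<in> carrier M" if "y \<in> carrier B" for y
    using that by (elim B_cases) (simp add: induce_\<theta>)
  moreover have "induce M h (y \<otimes>\<^bsub>B\<^esub> z) = induce M h y \<oplus>\<^bsub>M\<^esub> induce M h z"
    if "y \<in> carrier B" "z \<in> carrier B" for y z
    using that by (elim B_cases) (simp add: induce_\<theta> \<theta>_mult hm M.eps_add M.a_ac)
  moreover have "induce M h (e y) = eps M (induce M h y)" if "y \<in> carrier B" for y
    using that by (elim B_cases) (simp add: induce_\<theta> e_\<theta> M.eps_add h1 M.a_ac)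
  moreover have "induce M h \<in> extensional (carrier B)" by (simp add: induce_def)
  ultimately show ?thesis
    unfolding module_homs_dual_integers[OF module.dual_integers_module_axioms assms(1)]
    by (auto simp: hom_def eps_B)
qed

text \<open>A linear map out of the induced module is determined on the copy of \<open>A\<close>
  formed by the elements \<open>\<theta> (a, \<one>)\<close>. There a lift exists because
  \<open>A\<close> is a free abelian group, and \<open>induce\<close> extends it linearly.\<close>

lemma projective: "projective_module dual_integers (dual_module B e)"
  unfolding projective_module_def
proof (intro conjI allI impI)
  show "module dual_integers (dual_module B e)" by (rule module_dual_module[OF B_e])
  fix M N :: "((nat \<Rightarrow> int) set, 'b) module" and g f
  assume "module dual_integers M" "module dual_integers N"
    and g: "g \<in> module_homs dual_integers M N" "g ` carrier M = carrier N"
    and f: "f \<in> module_homs dual_integers (dual_module B e) N"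
  then interpret M: dual_integers_module M + N: dual_integers_module N
    by (simp_all add: dual_integers_module_def)
  have fhom: "f \<in> hom B (additive_group N)" and fe: "\<And>y. y \<in> carrier B \<Longrightarrow> f (e y) = eps N (f y)"
    and fext: "f \<in> extensional (carrier B)"
    using f unfolding module_homs_dual_integers[OF module.dual_integers_module_axioms N.dual_integers_module_axioms]
    by (auto simp: eps_B)
  have ghom: "g \<in> hom (additive_group M) (additive_group N)"
    and ge: "\<And>x. x \<in> carrier M \<Longrightarrow> g (eps M x) = eps N (g x)"
    using g unfolding module_homs_dual_integers[OF M.dual_integers_module_axioms N.dual_integers_module_axioms]
    by auto
  have "(\<lambda>a. f (\<theta> (a, \<one>\<^bsub>A\<^esub>))) \<in> hom A (additive_group N)"
  proof (rule homI)
    show "f (\<theta> (a, \<one>\<^bsub>A\<^esub>)) \<in> carrier (additive_group N)" if "a \<in> carrier A" for a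
      using hom_in_carrier[OF fhom, of "\<theta> (a, \<one>\<^bsub>A\<^esub>)"] that by simp
    show "f (\<theta> (a \<otimes>\<^bsub>A\<^esub> b, \<one>\<^bsub>A\<^esub>)) =
        f (\<theta> (a, \<one>\<^bsub>A\<^esub>)) \<otimes>\<^bsub>additive_group N\<^esub> f (\<theta> (b, \<one>\<^bsub>A\<^esub>))"
      if "a \<in> carrier A" "b \<in> carrier A" for a b
      using hom_mult[OF fhom, of "\<theta> (a, \<one>\<^bsub>A\<^esub>)" "\<theta> (b, \<one>\<^bsub>A\<^esub>)"] that by (simp add: \<theta>_mult)
  qed
  then obtain h where h: "h \<in> hom A (additive_group M)"
    and gh: "\<And>a. a \<in> carrier A \<Longrightarrow> g (h a) = f (\<theta> (a, \<one>\<^bsub>A\<^esub>))"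
    using fg_free_projective[OF A_free M.comm_group_add N.comm_group_add ghom] g(2)
    by (metis additive_group_simps(1))
  have hc: "h a \<in> carrier M" if "a \<in> carrier A" for a using hom_in_carrier[OF h] that by simp
  have "g (induce M h y) = f y" if "y \<in> carrier B" for y
    using that
  proof (elim B_cases)
    fix a b assume ab: "a \<in> carrier A" "b \<in> carrier A" "y = \<theta> (a, b)"
    have "g (induce M h y) = g (h a) \<oplus>\<^bsub>N\<^esub> eps N (g (h b))"
      using ab hc hom_mult[OF ghom] by (simp add: induce_\<theta> ge)
    also have "\<dots> = f (\<theta> (a, \<one>\<^bsub>A\<^esub>)) \<oplus>\<^bsub>N\<^esub> f (e (\<theta> (b, \<one>\<^bsub>A\<^esub>)))"
      using ab by (simp add: gh fe)
    also have "\<dots> = f (\<theta> (a, \<one>\<^bsub>A\<^esub>) \<otimes>\<^bsub>B\<^esub> e (\<theta> (b, \<one>\<^bsub>A\<^esub>)))"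
      using ab hom_mult[OF fhom] by simp
    also have "\<dots> = f y" using ab by (simp add: e_\<theta> \<theta>_mult)
    finally show ?thesis .
  qed
  then have "compose (carrier (dual_module B e)) g (induce M h) = f"
    using fext by (auto simp: compose_def extensional_def)
  then show "\<exists>h \<in> module_homs dual_integers (dual_module B e) M. compose (carrier (dual_module B e)) g h = f"
    using induce_in_module_homs[OF M.dual_integers_module_axioms h] by blast
qed

lemma B_free: "fg_free_abelian_group B"
proof (rule fg_free_iso)
  show "fg_free_abelian_group (A \<times>\<times> A)" using A_free by (simp add: fg_free_DirProd)
  show "\<theta> \<in> iso (A \<times>\<times> A) B" using \<theta>_\<theta>' by (rule group_isomorphisms_imp_iso)
qed (rule B.comm_group_axioms)

lemma fg: "fg_module dual_integers (dual_module B e)"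
  by (rule fg_module_if_fg_free) (simp_all add: module_dual_module[OF B_e] B_free)

text \<open>
  A square-zero endomorphism \<open>\<delta>\<close> of \<open>A\<close> turns \<open>A\<close> into a \<open>\<int>[\<epsilon>]\<close>-module.  The map
  \<open>a + b\<epsilon> \<mapsto> a - \<delta> b\<close> is a surjection of the induced module onto \<open>A\<close> with \<open>\<epsilon>\<close> acting as \<open>-\<delta>\<close>,
  and \<open>c \<mapsto> - \<delta> c + c\<epsilon>\<close> embeds the latter into the induced module.
\<close>

definition res_dif :: "('a \<Rightarrow> 'a) \<Rightarrow> 'b \<Rightarrow> 'b" where
  "res_dif \<delta> = (\<lambda>y \<in> carrier B. \<theta> (inv\<^bsub>A\<^esub> \<delta> (fst (\<theta>' y)), fst (\<theta>' y) \<otimes>\<^bsub>A\<^esub> inv\<^bsub>A\<^esub> \<delta> (snd (\<theta>' y))))"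

lemma res_dif_\<theta>:
  "\<lbrakk>a \<in> carrier A; b \<in> carrier A\<rbrakk> \<Longrightarrow> res_dif \<delta> (\<theta> (a, b)) = \<theta> (inv\<^bsub>A\<^esub> \<delta> a, a \<otimes>\<^bsub>A\<^esub> inv\<^bsub>A\<^esub> \<delta> b)"
  by (simp add: res_dif_def)

lemma differential_group_inv:
  assumes "differential_group A \<delta>" shows "differential_group A (\<lambda>a. inv\<^bsub>A\<^esub> \<delta> a)"
proof -
  interpret \<delta>: group_hom A A \<delta> using assms by (simp add: differential_group_def group_hom_if_hom)
  show ?thesis
    using assms by (auto simp: differential_group_def hom_def A.inv_mult \<delta>.hom_inv)
qed

lemma res_dif_in_module_homs:
  assumes "differential_group A \<delta>"
  shows "res_dif \<delta> \<in> module_homs dual_integers (dual_module B e) (dual_module B e)"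
proof -
  interpret \<delta>: group_hom A A \<delta> using assms by (simp add: differential_group_def group_hom_if_hom)
  have c: "res_dif \<delta> y \<in> carrier B" if "y \<in> carrier B" for y
    using that by (elim B_cases) (simp add: res_dif_\<theta>)
  moreover have "res_dif \<delta> (y \<otimes>\<^bsub>B\<^esub> z) = res_dif \<delta> y \<otimes>\<^bsub>B\<^esub> res_dif \<delta> z"
    if "y \<in> carrier B" "z \<in> carrier B" for y z
    using that by (elim B_cases) (simp add: res_dif_\<theta> \<theta>_mult A.inv_mult A.m_ac)
  moreover have "res_dif \<delta> (e y) = e (res_dif \<delta> y)" if "y \<in> carrier B" for y
    using that by (elim B_cases) (simp add: res_dif_\<theta> e_\<theta>)
  moreover have "res_dif \<delta> \<in> extensional (carrier B)" by (simp add: res_dif_def)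
  ultimately show ?thesis
    unfolding module_homs_dual_integers[OF module.dual_integers_module_axioms module.dual_integers_module_axioms]
    by (auto simp: hom_def eps_B)
qed

text \<open>With c = a - \<open>\<delta>\<close> b one has \<open>\<delta>\<close> c =
  \<open>\<delta>\<close> a, because \<open>\<delta>\<close> squares to zero; so the first
  coordinate of every value is determined by the second.\<close>

lemma res_dif_image:
  assumes "differential_group A \<delta>"
  shows "res_dif \<delta> ` carrier B = {\<theta> (inv\<^bsub>A\<^esub> \<delta> c, c) | c. c \<in> carrier A}"
proof -
  interpret \<delta>: group_hom A A \<delta> using assms by (simp add: differential_group_def group_hom_if_hom)
  have dd: "\<delta> (\<delta> a) = \<one>\<^bsub>A\<^esub>" if "a \<in> carrier A" for a
    using assms that by (simp add: differential_group_def)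
  have "res_dif \<delta> (\<theta> (a, b)) = \<theta> (inv\<^bsub>A\<^esub> \<delta> (a \<otimes>\<^bsub>A\<^esub> inv\<^bsub>A\<^esub> \<delta> b), a \<otimes>\<^bsub>A\<^esub> inv\<^bsub>A\<^esub> \<delta> b)"
    if "a \<in> carrier A" "b \<in> carrier A" for a b
    using that by (simp add: res_dif_\<theta> dd \<delta>.hom_inv)
  moreover have "\<theta> (inv\<^bsub>A\<^esub> \<delta> c, c) = res_dif \<delta> (\<theta> (c, \<one>\<^bsub>A\<^esub>))" if "c \<in> carrier A" for c
    using that by (simp add: res_dif_\<theta>)
  ultimately show ?thesis
    by (fastforce elim!: B_cases)
qed

text \<open>The second coordinate forces a = \<open>\<delta>\<close> b, and then
  \<open>\<delta>\<close> a vanishes by itself. For one \<open>\<delta>\<close> the image and the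
  kernel are graphs of opposite maps, which is why the resolution alternates the sign.\<close>

lemma res_dif_kernel:
  assumes "differential_group A \<delta>"
  shows "{y \<in> carrier B. res_dif \<delta> y = \<one>\<^bsub>B\<^esub>} = {\<theta> (\<delta> c, c) | c. c \<in> carrier A}"
proof -
  interpret \<delta>: group_hom A A \<delta> using assms by (simp add: differential_group_def group_hom_if_hom)
  have dd: "\<delta> (\<delta> a) = \<one>\<^bsub>A\<^esub>" if "a \<in> carrier A" for a
    using assms that by (simp add: differential_group_def)
  have "res_dif \<delta> (\<theta> (a, b)) = \<one>\<^bsub>B\<^esub> \<longleftrightarrow> a = \<delta> b" if ab: "a \<in> carrier A" "b \<in> carrier A" for a b
  proof -
    have "res_dif \<delta> (\<theta> (a, b)) = \<one>\<^bsub>B\<^esub> \<longleftrightarrow> \<delta> a = \<one>\<^bsub>A\<^esub> \<and> a \<otimes>\<^bsub>A\<^esub> inv\<^bsub>A\<^esub> \<delta> b = \<one>\<^bsub>A\<^esub>"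
      using ab \<theta>_eq_iff[of _ _ "\<one>\<^bsub>A\<^esub>" "\<one>\<^bsub>A\<^esub>"] by (simp add: res_dif_\<theta> \<theta>_one)
    also have "a \<otimes>\<^bsub>A\<^esub> inv\<^bsub>A\<^esub> \<delta> b = \<one>\<^bsub>A\<^esub> \<longleftrightarrow> a = \<delta> b"
      using ab by (metis A.inv_equality A.inv_inv A.inv_closed A.r_inv \<delta>.hom_closed)
    finally show ?thesis using ab dd by auto
  qed
  then show ?thesis by (fastforce elim!: B_cases)
qed

text \<open>The elements \<open>\<theta> (\<delta> c, c)\<close> form the kernel of
  \<open>res_dif \<delta>\<close>, so \<open>\<phi>\<close> descends to its image. The point is that
  the form on the image extends to the whole induced module; this is the nontrivial half of
  exactness after dualizing.\<close>

lemma res_dif_extend: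
  assumes \<delta>: "differential_group A \<delta>"
    and \<phi>: "\<phi> \<in> module_homs dual_integers (dual_module B e) (regular_module dual_integers)"
    and 0: "\<And>c. c \<in> carrier A \<Longrightarrow> \<phi> (\<theta> (\<delta> c, c)) = \<zero>\<^bsub>dual_integers\<^esub>"
  obtains \<psi> where "\<psi> \<in> module_homs dual_integers (dual_module B e) (regular_module dual_integers)"
    "compose (carrier B) \<psi> (res_dif \<delta>) = \<phi>"
proof -
  interpret \<delta>: group_hom A A \<delta> using \<delta> by (simp add: differential_group_def group_hom_if_hom)
  interpret R: cring dual_integers by (rule cring_dual_integers)
  interpret Q: dual_integers_module "regular_module dual_integers"
    by (simp add: dual_integers_module_def module_regular_module cring_dual_integers)
  have regular [simp]: "carrier (regular_module dual_integers) = carrier dual_integers"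
    "ring.add (regular_module dual_integers) = ring.add dual_integers"
    by (simp_all add: regular_module_def)
  note homs = module_homs_dual_integers[OF module.dual_integers_module_axioms Q.dual_integers_module_axioms]
  have dd: "\<delta> (\<delta> a) = \<one>\<^bsub>A\<^esub>" if "a \<in> carrier A" for a
    using \<delta> that by (simp add: differential_group_def)
  have c [simp]: "\<phi> y \<in> carrier dual_integers" if "y \<in> carrier B" for y
    using \<phi> that unfolding homs by (auto simp: hom_def)
  have add: "\<phi> (y \<otimes>\<^bsub>B\<^esub> z) = \<phi> y \<oplus>\<^bsub>dual_integers\<^esub> \<phi> z" if "y \<in> carrier B" "z \<in> carrier B" for y z
    using \<phi> that unfolding homs by (auto simp: hom_def)
  have \<phi>e: "\<phi> (e y) = dual 0 (dual_re (\<phi> y))" if "y \<in> carrier B" for y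
    using \<phi> that unfolding homs by (auto simp: eps_B)
  define p where "p a = \<phi> (\<theta> (a, \<one>\<^bsub>A\<^esub>))" for a
  have p [simp]: "p a \<in> carrier dual_integers" if "a \<in> carrier A" for a
    using that by (simp add: p_def)
  have p_mult: "p (a \<otimes>\<^bsub>A\<^esub> b) = p a \<oplus>\<^bsub>dual_integers\<^esub> p b" if "a \<in> carrier A" "b \<in> carrier A" for a b
    using that add[of "\<theta> (a, \<one>\<^bsub>A\<^esub>)" "\<theta> (b, \<one>\<^bsub>A\<^esub>)"] by (simp add: p_def \<theta>_mult)
  have p_one: "p \<one>\<^bsub>A\<^esub> = \<zero>\<^bsub>dual_integers\<^esub>"
    by (rule dual_eqI) (use p_mult[of "\<one>\<^bsub>A\<^esub>" "\<one>\<^bsub>A\<^esub>"] dual_add[of "p \<one>\<^bsub>A\<^esub>" "p \<one>\<^bsub>A\<^esub>"] in simp_all)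
  have split: "\<phi> (\<theta> (a, b)) = p a \<oplus>\<^bsub>dual_integers\<^esub> dual 0 (dual_re (p b))"
    if "a \<in> carrier A" "b \<in> carrier A" for a b
    using that add[of "\<theta> (a, \<one>\<^bsub>A\<^esub>)" "\<theta> (\<one>\<^bsub>A\<^esub>, b)"] \<phi>e[of "\<theta> (b, \<one>\<^bsub>A\<^esub>)"]
    by (simp add: p_def \<theta>_mult e_\<theta>)
  \<comment> \<open>The vanishing hypothesis, read off in the two coordinates of the ring.\<close>
  have im_\<delta>: "dual_im (p (\<delta> b)) = - dual_re (p b)" and re_\<delta>: "dual_re (p (\<delta> b)) = 0"
    if "b \<in> carrier A" for b
    using 0[OF that] that dual_add[of "p (\<delta> b)" "dual 0 (dual_re (p b))"] by (simp_all add: split)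
  have inv: "dual_re (p (inv\<^bsub>A\<^esub> a)) = - dual_re (p a)" "dual_im (p (inv\<^bsub>A\<^esub> a)) = - dual_im (p a)"
    if "a \<in> carrier A" for a
  proof -
    have "p (inv\<^bsub>A\<^esub> a) \<oplus>\<^bsub>dual_integers\<^esub> p a = \<zero>\<^bsub>dual_integers\<^esub>"
      using that p_mult[of "inv\<^bsub>A\<^esub> a" a] p_one by simp
    then show "dual_re (p (inv\<^bsub>A\<^esub> a)) = - dual_re (p a)" "dual_im (p (inv\<^bsub>A\<^esub> a)) = - dual_im (p a)"
      using that dual_add[of "p (inv\<^bsub>A\<^esub> a)" "p a"] by simp_all
  qed
  \<comment> \<open>The linear form whose \<open>\<epsilon>\<close>-part at a +
    b\<open>\<epsilon>\<close> is \<open>dual_im (p b)\<close>. At -\<open>\<delta>\<close> a + (a -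
    \<open>\<delta>\<close> b)\<open>\<epsilon>\<close>, the relations for
    \<open>p (\<delta> b)\<close> turn its value into \<open>dual_re (p a)\<close> +
    (\<open>dual_im (p a)\<close> + \<open>dual_re (p b)\<close>)\<open>\<epsilon>\<close>, which is
    the value of \<open>\<phi>\<close> at a + b\<open>\<epsilon>\<close>.\<close>
  define \<psi> where "\<psi> = (\<lambda>y \<in> carrier B. dual (dual_im (p (fst (\<theta>' y)))) (dual_im (p (snd (\<theta>' y)))))"
  have \<psi>: "\<psi> (\<theta> (a, b)) = dual (dual_im (p a)) (dual_im (p b))"
    if "a \<in> carrier A" "b \<in> carrier A" for a b
    using that by (simp add: \<psi>_def)
  show ?thesis
  proof
    have "\<psi> y \<in> carrier dual_integers" if "y \<in> carrier B" for y
      using that by (simp add: \<psi>_def)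
    moreover have "\<psi> (y \<otimes>\<^bsub>B\<^esub> z) = \<psi> y \<oplus>\<^bsub>dual_integers\<^esub> \<psi> z" if "y \<in> carrier B" "z \<in> carrier B" for y z
      using that by (elim B_cases) (simp add: \<theta>_mult \<psi> p_mult dual_add dual_eqI)
    moreover have "\<psi> (e y) = dual 0 (dual_re (\<psi> y))" if "y \<in> carrier B" for y
      using that by (elim B_cases) (simp add: e_\<theta> \<psi> p_one)
    moreover have "\<psi> \<in> extensional (carrier B)" by (simp add: \<psi>_def)
    ultimately show "\<psi> \<in> module_homs dual_integers (dual_module B e) (regular_module dual_integers)"
      unfolding homs by (auto simp: hom_def eps_B)
    have "\<psi> (res_dif \<delta> y) = \<phi> y" if "y \<in> carrier B" for y
      using that
    proof (elim B_cases)
      fix a b assume ab: "a \<in> carrier A" "b \<in> carrier A" "y = \<theta> (a, b)"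
      show ?thesis
        by (rule dual_eqI)
          (use ab in \<open>simp_all add: res_dif_\<theta> \<psi> split p_mult dual_add inv im_\<delta> re_\<delta>\<close>)
    qed
    then show "compose (carrier B) \<psi> (res_dif \<delta>) = \<phi>"
      using \<phi> unfolding homs by (intro extensionalityI[of _ "carrier B"]) (auto simp: compose_def)
  qed
qed

end

theorem Gorenstein_projective_if_fg_free:
  fixes M :: "((nat \<Rightarrow> int) set, 'b) module"
  assumes "infinite (UNIV :: 'b set)" "module dual_integers M"
    "fg_free_abelian_group (additive_group M)"
  shows "Gorenstein_projective dual_integers M"
proof -
  interpret M: dual_integers_module M using assms by (simp add: dual_integers_module_def)
  obtain B :: "'b monoid" and e \<theta> \<theta>' where "induced_module (additive_group M) B e \<theta> \<theta>'"
    using induced_module_exists[OF assms(3,1)] by metis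
  then interpret induced_module "additive_group M" B e \<theta> \<theta>' .
  let ?B = "dual_module B e"
  define \<delta> where "\<delta> n = (if even n then eps M else (\<lambda>a. inv\<^bsub>additive_group M\<^esub> eps M a))" for n :: int
  have \<delta>: "differential_group (additive_group M) (\<delta> n)" for n
    using M.differential_group differential_group_inv by (simp add: \<delta>_def)
  \<comment> \<open>This matches the graph that is the image in degree \<open>n\<close> with the
    graph that is the kernel in degree \<open>n + 1\<close>.\<close>
  have \<delta>_succ: "inv\<^bsub>additive_group M\<^esub> (\<delta> n c) = \<delta> (n + 1) c" if "c \<in> carrier M" for n c
    using that M.A.inv_inv[of "eps M c"] by (simp add: \<delta>_def)
  let ?d = "\<lambda>n. res_dif (\<delta> n)"
  have ker: "a_kernel ?B ?B (?d n) = {\<theta> (\<delta> n c, c) | c. c \<in> carrier M}" for n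
    using res_dif_kernel[OF \<delta>[of n]] by (simp add: a_kernel_def kernel_def)
  have im: "?d n ` carrier B = {\<theta> (\<delta> (n + 1) c, c) | c. c \<in> carrier M}" for n
    using res_dif_image[OF \<delta>[of n]] \<delta>_succ[of _ n] by (auto simp: setcompr_eq_image)
  show ?thesis
    unfolding Gorenstein_projective_def
  proof (intro exI[of _ "\<lambda>n. ?B"] exI[of _ ?d] conjI allI)
    show "fg_module dual_integers ?B" "projective_module dual_integers ?B"
      by (rule fg, rule projective)
    show "?d n \<in> module_homs dual_integers ?B ?B" for n
      by (rule res_dif_in_module_homs[OF \<delta>])
    show "?d n ` carrier ?B = a_kernel ?B ?B (?d (n + 1))" for n
      by (simp add: im ker)
    show "(\<lambda>\<psi>. compose (carrier ?B) \<psi> (?d (n + 1))) ` module_homs dual_integers ?B (regular_module dual_integers) =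
        {\<phi> \<in> module_homs dual_integers ?B (regular_module dual_integers).
          \<forall>x \<in> carrier ?B. \<phi> (?d n x) = \<zero>\<^bsub>dual_integers\<^esub>}" (is "?L = ?R") for n
    proof
      show "?R \<subseteq> ?L"
      proof
        fix \<phi> assume \<phi>: "\<phi> \<in> ?R"
        \<comment> \<open>Vanishing on the image of one differential is vanishing on the kernel of
          the next, which is what \<open>res_dif_extend\<close> asks for.\<close>
        have "\<phi> (\<theta> (\<delta> (n + 1) c, c)) = \<zero>\<^bsub>dual_integers\<^esub>" if "c \<in> carrier (additive_group M)" for c
        proof -
          have "\<theta> (\<delta> (n + 1) c, c) \<in> ?d n ` carrier B" using that im by auto
          then show ?thesis using \<phi> by auto
        qed
        moreover have "\<phi> \<in> module_homs dual_integers ?B (regular_module dual_integers)" using \<phi> by simp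
        ultimately obtain \<psi> where "\<psi> \<in> module_homs dual_integers ?B (regular_module dual_integers)"
          "compose (carrier B) \<psi> (?d (n + 1)) = \<phi>"
          using res_dif_extend[OF \<delta>] by metis
        then show "\<phi> \<in> ?L" by auto
      qed
      show "?L \<subseteq> ?R"
      proof
        fix \<phi> assume "\<phi> \<in> ?L"
        then obtain \<psi> where \<psi>: "\<psi> \<in> module_homs dual_integers ?B (regular_module dual_integers)"
          "\<phi> = compose (carrier B) \<psi> (?d (n + 1))" by auto
        have "module dual_integers (regular_module dual_integers)"
          by (simp add: module_regular_module cring_dual_integers)
        then interpret Q: dual_integers_module "regular_module dual_integers"
          by (simp add: dual_integers_module_def)
        note homs = module_homs_dual_integers[OF module.dual_integers_module_axioms]
        have d: "?d (n + 1) \<in> hom B B" "\<And>y. y \<in> carrier B \<Longrightarrow> ?d (n + 1) (e y) = e (?d (n + 1) y)"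
          using res_dif_in_module_homs[OF \<delta>[of "n + 1"]]
          unfolding homs[OF module.dual_integers_module_axioms]
          by (auto simp: eps_B dest: hom_in_carrier)
        have \<psi>h: "\<psi> \<in> hom B (additive_group (regular_module dual_integers))"
          "\<And>y. y \<in> carrier B \<Longrightarrow> \<psi> (e y) = eps (regular_module dual_integers) (\<psi> y)"
          using \<psi>(1) unfolding homs[OF Q.dual_integers_module_axioms] by (auto simp: eps_B)
        have "\<phi> \<in> module_homs dual_integers ?B (regular_module dual_integers)"
          unfolding homs[OF Q.dual_integers_module_axioms]
          using d \<psi>h hom_in_carrier[OF d(1)] hom_compose[OF d(1) \<psi>h(1)]
          by (auto simp: \<psi>(2) eps_B compose_def hom_def Pi_iff)
        moreover have "\<phi> (?d n x) = \<zero>\<^bsub>dual_integers\<^esub>" if x: "x \<in> carrier B" for x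
        proof -
          have "?d n x \<in> {y \<in> carrier B. ?d (n + 1) y = \<one>\<^bsub>B\<^esub>}"
            using x im[of n] unfolding res_dif_kernel[OF \<delta>[of "n + 1"]] by (simp only: additive_group_simps) blast
          moreover have "\<psi> \<one>\<^bsub>B\<^esub> = \<zero>\<^bsub>dual_integers\<^esub>"
            using hom_one[OF \<psi>h(1)] Q.comm_group_add
            by (simp add: comm_group_imp_group B.group_axioms) (simp add: regular_module_def)
          ultimately show ?thesis by (simp add: \<psi>(2) compose_def)
        qed
        ultimately show "\<phi> \<in> ?R" by simp
      qed
    qed
    \<comment> \<open>Since \<open>\<delta> 0\<close> is \<open>eps M\<close>, the kernel in degree
      0 is the graph of \<open>eps M\<close>, parametrized by its second coordinate.\<close>
    let ?\<iota> = "\<lambda>m \<in> carrier M. \<theta> (eps M m, m)"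
    show "isomorphic_modules dual_integers M (?B\<lparr>carrier := a_kernel ?B ?B (?d 0)\<rparr>)"
    proof (rule isomorphic_modules_onto_image)
      show "?\<iota> \<in> module_homs dual_integers M ?B"
        unfolding module_homs_dual_integers[OF M.dual_integers_module_axioms module.dual_integers_module_axioms]
        using \<theta>_mult \<theta>_closed e_\<theta> by (auto simp: hom_def eps_B M.eps_add)
      show "inj_on ?\<iota> (carrier M)" using \<theta>_eq_iff by (auto simp: inj_on_def)
      show "?\<iota> ` carrier M = a_kernel ?B ?B (?d 0)" 
        using ker[of 0] by (simp add: \<delta>_def setcompr_eq_image)
    qed
  qed
qed

section \<open>From projectivity to free additive groups\<close>

text \<open>The module induced from the free abelian group on the generators \<open>S\<close> covers
  \<open>P\<close>, and \<open>inf\<close> lets its carrier lie in \<open>'b\<close>, where the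
  lifting property is tested. The resulting section embeds \<open>P\<close> into a free
  group.\<close>

lemma fg_free_if_projective:
  fixes P :: "((nat \<Rightarrow> int) set, 'b) module"
  assumes inf: "infinite (UNIV :: 'b set)" and P: "fg_module dual_integers P"
    and proj: "projective_module dual_integers P"
  shows "fg_free_abelian_group (additive_group P)"
proof -
  interpret P: dual_integers_module P using P by (simp add: dual_integers_module_def fg_module_def)
  obtain S where S: "finite S" "S \<subseteq> carrier P"
    "\<And>N. \<lbrakk>submodule N dual_integers P; S \<subseteq> N\<rbrakk> \<Longrightarrow> N = carrier P"
    using P by (auto simp: fg_module_def)
  let ?A = "free_Abelian_group S"
  have "S \<approx> {..<card S}" using S(1) by (simp add: eqpoll_iff_card)
  then have "fg_free_abelian_group ?A"
    by (auto simp: fg_free_abelian_group_def abelian_free_Abelian_group isomorphic_free_Abelian_groups)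
  then obtain B :: "'b monoid" and e \<theta> \<theta>' where "induced_module ?A B e \<theta> \<theta>'"
    using induced_module_exists[OF _ inf] by metis
  then interpret induced_module ?A B e \<theta> \<theta>' .
  obtain u where u: "u \<in> hom ?A (additive_group P)" "\<And>x. x \<in> S \<Longrightarrow> u (frag_of x) = x"
    using comm_group.free_Abelian_group_universal[OF P.comm_group_add, of "\<lambda>x. x" S] S(2) by auto
  let ?g = "induce P u"
  have g: "?g \<in> module_homs dual_integers (dual_module B e) P"
    by (rule induce_in_module_homs[OF P.dual_integers_module_axioms u(1)])
  then have ghom: "?g \<in> hom B (additive_group P)" and ge: "\<And>y. y \<in> carrier B \<Longrightarrow> ?g (e y) = eps P (?g y)"
    unfolding module_homs_dual_integers[OF module.dual_integers_module_axioms P.dual_integers_module_axioms]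
    by (auto simp: eps_B)
  interpret g: group_hom B "additive_group P" ?g
    using ghom B.comm_group_axioms P.comm_group_add by (simp add: group_hom_if_hom)
  have "submodule (?g ` carrier B) dual_integers P"
    unfolding P.submodule_iff using g.img_is_subgroup by (auto simp flip: ge)
  moreover have "S \<subseteq> ?g ` carrier B"
  proof
    fix x assume x: "x \<in> S"
    have "u 0 = \<zero>\<^bsub>P\<^esub>" using hom_one[OF u(1)] P.A.group_axioms by simp
    then have "?g (\<theta> (frag_of x, 0)) = x"
      using x u(2) S(2) induce_\<theta>[of "frag_of x" 0 P u] by (auto simp: eps_def)
    moreover have "\<theta> (frag_of x, 0) \<in> carrier B" using x \<theta>_closed[of "frag_of x" 0] by simp
    ultimately show "x \<in> ?g ` carrier B" by (metis image_eqI)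
  qed
  ultimately have surj: "?g ` carrier (dual_module B e) = carrier P" using S(3) by simp
  have "(\<lambda>x \<in> carrier P. x) \<in> module_homs dual_integers P P"
    by (auto simp: module_homs_def hom_def)
  then obtain h where h: "h \<in> module_homs dual_integers P (dual_module B e)"
    "compose (carrier P) ?g h = (\<lambda>x \<in> carrier P. x)"
    using proj g surj module_dual_module[OF B_e] P.module_axioms unfolding projective_module_def by blast
  have "h \<in> hom (additive_group P) B"
    using h(1) unfolding module_homs_dual_integers[OF P.dual_integers_module_axioms module.dual_integers_module_axioms]
    by simp
  moreover have "inj_on h (carrier P)"
  proof (rule inj_on_inverseI)
    show "?g (h x) = x" if "x \<in> carrier P" for x
      using fun_cong[OF h(2), of x] that by (simp add: compose_def)
  qed
  ultimately show ?thesis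
    using fg_free_inj[OF B_free P.comm_group_add] by simp
qed

text \<open>From left to right, \<open>M\<close> is embedded into the projective module
  \<open>P 0\<close>, and freeness of the additive group descends along injections.\<close>

theorem Gorenstein_projective_iff_fg_free:
  fixes M :: "((nat \<Rightarrow> int) set, 'b) module"
  assumes inf: "infinite (UNIV :: 'b set)" and M: "module dual_integers M"
  shows "Gorenstein_projective dual_integers M \<longleftrightarrow> fg_free_abelian_group (additive_group M)"
proof
  assume "Gorenstein_projective dual_integers M"
  then obtain P :: "int \<Rightarrow> ((nat \<Rightarrow> int) set, 'b) module" and d where
    P: "\<forall>n. fg_module dual_integers (P n) \<and> projective_module dual_integers (P n)"
    and iso: "isomorphic_modules dual_integers M ((P 0)\<lparr>carrier := a_kernel (P 0) (P 1) (d 0)\<rparr>)"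
    unfolding Gorenstein_projective_def by (elim exE conjE) (rule that; assumption)
  let ?K = "a_kernel (P 0) (P 1) (d 0)"
  interpret M: dual_integers_module M using M by (simp add: dual_integers_module_def)
  obtain f where f: "f \<in> module_homs dual_integers M ((P 0)\<lparr>carrier := ?K\<rparr>)"
    "bij_betw f (carrier M) ?K"
    using iso by (auto simp: isomorphic_modules_def)
  have "?K \<subseteq> carrier (P 0)" by (auto simp: a_kernel_def kernel_def)
  then have "f \<in> hom (additive_group M) (additive_group (P 0))"
    using f(1) by (auto simp: module_homs_def hom_def)
  then show "fg_free_abelian_group (additive_group M)"
    using fg_free_inj[OF fg_free_if_projective[OF inf, of "P 0"] M.comm_group_add, of f] P f(2)
    by (simp add: bij_betw_def)
qed (rule Gorenstein_projective_if_fg_free[OF inf M])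

section \<open>The category of torsionless modules\<close>

lemma compose_in_module_homs:
  assumes "f \<in> module_homs R L M" "g \<in> module_homs R M N" "module R L"
  shows "compose (carrier L) g f \<in> module_homs R L N"
proof -
  interpret L: module R L by (rule assms)
  show ?thesis
    using assms by (auto simp: module_homs_def hom_def compose_def Pi_iff)
qed

lemma id_in_module_homs: "module R M \<Longrightarrow> (\<lambda>x \<in> carrier M. x) \<in> module_homs R M M"
proof -
  assume "module R M"
  then interpret module R M .
  show ?thesis by (auto simp: module_homs_def hom_def)
qed

lemma module_homs_closed: "\<lbrakk>f \<in> module_homs R M N; x \<in> carrier M\<rbrakk> \<Longrightarrow> f x \<in> carrier N"
  by (auto simp: module_homs_def hom_def)

lemma compose_id_module_homs:
  "f \<in> module_homs R M N \<Longrightarrow> compose (carrier M) f (\<lambda>x \<in> carrier M. x) = f"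
  "f \<in> module_homs R M N \<Longrightarrow> compose (carrier M) (\<lambda>x \<in> carrier N. x) f = f"
  by (rule extensionalityI[of _ "carrier M"];
      auto simp: compose_def module_homs_def hom_def Pi_iff)+

lemma category_module_category: "category (module_category R)"
proof unfold_locales
  let ?C = "module_category R"
  show "Comp ?C W X Z (Comp ?C X Y Z h g) f = Comp ?C W Y Z h (Comp ?C W X Y g f)"
    if "f \<in> Mor ?C W X" for W X Y Z f g h
    using that by (auto simp: module_category_def compose_def module_homs_closed intro!: restrict_ext)
qed (auto simp: module_category_def id_in_module_homs fg_module_def compose_in_module_homs
      compose_id_module_homs)

lemma inverse_module_hom:
  assumes "module R M" "f \<in> module_homs R M N" "bij_betw f (carrier M) (carrier N)"
  shows "(\<lambda>y \<in> carrier N. inv_into (carrier M) f y) \<in> module_homs R N M"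
    "bij_betw (\<lambda>y \<in> carrier N. inv_into (carrier M) f y) (carrier N) (carrier M)"
proof -
  interpret M: module R M by (rule assms)
  let ?g = "inv_into (carrier M) f"
  have g: "?g y \<in> carrier M" "f (?g y) = y" if "y \<in> carrier N" for y
    using assms(3) that by (auto simp: bij_betw_def inv_into_into f_inv_into_f)
  have gf: "?g (f x) = x" if "x \<in> carrier M" for x
    using assms(3) that by (auto simp: bij_betw_def)
  have add: "f (x \<oplus>\<^bsub>M\<^esub> y) = f x \<oplus>\<^bsub>N\<^esub> f y" if "x \<in> carrier M" "y \<in> carrier M" for x y
    using assms(2) that by (auto simp: module_homs_def hom_def)
  have smult: "f (r \<odot>\<^bsub>M\<^esub> x) = r \<odot>\<^bsub>N\<^esub> f x" if "r \<in> carrier R" "x \<in> carrier M" for r x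
    using assms(2) that by (auto simp: module_homs_def)
  have fc: "f x \<in> carrier N" if "x \<in> carrier M" for x
    using assms(2) that by (rule module_homs_closed)
  have 1: "y \<oplus>\<^bsub>N\<^esub> z \<in> carrier N" "?g (y \<oplus>\<^bsub>N\<^esub> z) = ?g y \<oplus>\<^bsub>M\<^esub> ?g z"
    if "y \<in> carrier N" "z \<in> carrier N" for y z
    using add[of "?g y" "?g z"] gf[of "?g y \<oplus>\<^bsub>M\<^esub> ?g z"] fc[of "?g y \<oplus>\<^bsub>M\<^esub> ?g z"] g[OF that(1)] g[OF that(2)]
    by auto
  have 2: "r \<odot>\<^bsub>N\<^esub> y \<in> carrier N" "?g (r \<odot>\<^bsub>N\<^esub> y) = r \<odot>\<^bsub>M\<^esub> ?g y"
    if "r \<in> carrier R" "y \<in> carrier N" for r y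
    using smult[of r "?g y"] gf[of "r \<odot>\<^bsub>M\<^esub> ?g y"] fc[of "r \<odot>\<^bsub>M\<^esub> ?g y"] g[OF that(2)] that(1)
    by auto
  show "(\<lambda>y \<in> carrier N. ?g y) \<in> module_homs R N M"
    using g 1 2 by (auto simp: module_homs_def hom_def)
  show "bij_betw (\<lambda>y \<in> carrier N. ?g y) (carrier N) (carrier M)"
    using bij_betw_inv_into[OF assms(3)] by (simp add: bij_betw_restrict_eq)
qed

lemma isomorphic_modules_sym:
  "\<lbrakk>module R M; isomorphic_modules R M N\<rbrakk> \<Longrightarrow> isomorphic_modules R N M"
  unfolding isomorphic_modules_def using inverse_module_hom by blast

lemma isomorphic_modules_trans:
  "\<lbrakk>module R L; isomorphic_modules R L M; isomorphic_modules R M N\<rbrakk> \<Longrightarrow> isomorphic_modules R L N"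
  unfolding isomorphic_modules_def
proof (elim bexE)
  fix f g
  assume fg: "module R L" "f \<in> module_homs R L M" "bij_betw f (carrier L) (carrier M)"
    "g \<in> module_homs R M N" "bij_betw g (carrier M) (carrier N)"
  have "bij_betw (compose (carrier L) g f) (carrier L) (carrier N)"
    using bij_betw_trans[OF fg(3,5)] by (simp add: compose_def o_def bij_betw_restrict_eq)
  then show "\<exists>h \<in> module_homs R L N. bij_betw h (carrier L) (carrier N)"
    using compose_in_module_homs[OF fg(2,4,1)] by blast
qed

lemma isomorphisms_module_category:
  assumes "module R M" "isomorphic_modules R M N" "M \<in> Obj (module_category R)" "N \<in> Obj (module_category R)"
  shows "isomorphisms (full_subcategory (module_category R) P) M N \<noteq> {}"
proof -
  obtain f where f: "f \<in> module_homs R M N" "bij_betw f (carrier M) (carrier N)"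
    using assms(2) by (auto simp: isomorphic_modules_def)
  let ?g = "\<lambda>y \<in> carrier N. inv_into (carrier M) f y"
  have g: "?g \<in> module_homs R N M" using assms(1) f by (rule inverse_module_hom)
  have "compose (carrier M) ?g f = (\<lambda>x \<in> carrier M. x)"
    using f bij_betwE[OF f(2)] by (auto simp: compose_def bij_betw_def intro!: restrict_ext)
  moreover have "compose (carrier N) f ?g = (\<lambda>x \<in> carrier N. x)"
    using f(2) by (auto simp: compose_def bij_betw_def f_inv_into_f intro!: restrict_ext)
  ultimately have "f \<in> isomorphisms (full_subcategory (module_category R) P) M N"
    using f(1) g by (auto simp: isomorphisms_def full_subcategory_def module_category_def)
  then show ?thesis by blast
qed

lemma Obj_sub_category:
  "Obj (sub_category dual_integers) =
    {M. module dual_integers M \<and> fg_free_abelian_group (additive_group M)}"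
  unfolding sub_category_def full_subcategory_def module_category_def
  using torsionless_iff_fg_free fg_module_if_fg_free by (auto simp: fg_module_def)

lemma sub_category_simps [simp]:
  "Mor (sub_category R) = module_homs R"
  "Ident (sub_category R) = (\<lambda>M. \<lambda>x \<in> carrier M. x)"
  "Comp (sub_category R) = (\<lambda>L M N g f. compose (carrier L) g f)"
  by (simp_all add: sub_category_def full_subcategory_def module_category_def)

lemma category_sub_category: "category (sub_category R)"
  unfolding sub_category_def by (rule category.full_subcategory[OF category_module_category])

lemma Gproj_category_eq_sub_category:
  assumes "infinite (UNIV :: 'b set)"
  shows "(Gproj_category dual_integers :: (((nat \<Rightarrow> int) set, 'b) module, 'b \<Rightarrow> 'b) category) =
    sub_category dual_integers"
proof -
  have "Gorenstein_projective dual_integers M \<longleftrightarrow> torsionless_module dual_integers M"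
    if "fg_module dual_integers M" for M :: "((nat \<Rightarrow> int) set, 'b) module"
    using that assms by (simp add: fg_module_def Gorenstein_projective_iff_fg_free torsionless_iff_fg_free)
  then have "{M :: ((nat \<Rightarrow> int) set, 'b) module. fg_module dual_integers M \<and> Gorenstein_projective dual_integers M} =
      {M. fg_module dual_integers M \<and> torsionless_module dual_integers M}"
    by blast
  then show ?thesis
    by (simp add: Gproj_category_def sub_category_def full_subcategory_def module_category_def)
qed

section \<open>Moving modules to another carrier type\<close>

lemma isomorphic_copy:
  fixes M :: "((nat \<Rightarrow> int) set, 'a) module"
  assumes "infinite (UNIV :: 'b set)" "M \<in> Obj (sub_category dual_integers)"
  obtains N :: "((nat \<Rightarrow> int) set, 'b) module"
  where "N \<in> Obj (sub_category dual_integers)" "isomorphic_modules dual_integers M N"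
proof -
  interpret M: dual_integers_module M
    using assms by (simp add: Obj_sub_category dual_integers_module_def)
  have free: "fg_free_abelian_group (additive_group M)" using assms by (simp add: Obj_sub_category)
  obtain B :: "'b monoid" and \<theta> \<theta>' where B: "comm_group B" "group_isomorphisms (additive_group M) B \<theta> \<theta>'"
    using group_isomorphisms_transport[OF free assms(1)] by metis
  let ?e = "\<theta> \<circ> eps M \<circ> \<theta>'"
  have e: "differential_group B ?e" using M.differential_group B by (rule differential_group_iso)
  then interpret N: dual_integers_module "dual_module B ?e" by (rule dual_integers_module_dual_module)
  have \<theta>: "\<theta> \<in> iso (additive_group M) B" using B(2) by (rule group_isomorphisms_imp_iso)
  have "fg_free_abelian_group B" using free B(1) \<theta> by (rule fg_free_iso)
  then have "dual_module B ?e \<in> Obj (sub_category dual_integers)"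
    by (simp add: Obj_sub_category N.module_axioms)
  moreover have "restrict \<theta> (carrier M) \<in> module_homs dual_integers M (dual_module B ?e)"
    unfolding module_homs_dual_integers[OF M.dual_integers_module_axioms N.dual_integers_module_axioms]
    using B(2) by (auto simp: group_isomorphisms_def hom_def eps_dual_module[OF e] Pi_iff)
  moreover have "bij_betw (restrict \<theta> (carrier M)) (carrier M) (carrier (dual_module B ?e))"
    using \<theta> by (simp add: iso_def bij_betw_restrict_eq)
  ultimately show ?thesis using that unfolding isomorphic_modules_def by blast
qed

lemma fully_faithful_compose:
  assumes "fully_faithful C D FO FM" "fully_faithful D E GO GM"
  shows "fully_faithful C E (\<lambda>X. GO (FO X)) (\<lambda>X Y f. GM (FO X) (FO Y) (FM X Y f))"
proof -
  interpret F: fully_faithful C D FO FM by (rule assms)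
  interpret G: fully_faithful D E GO GM by (rule assms)
  show ?thesis
  proof unfold_locales
    show "bij_betw (\<lambda>f. GM (FO X) (FO Y) (FM X Y f)) (Mor C X Y) (Mor E (GO (FO X)) (GO (FO Y)))"
      if "X \<in> Obj C" "Y \<in> Obj C" for X Y
      using bij_betw_trans[OF F.FM_bij[OF that] G.FM_bij[OF F.FO F.FO]] that by (simp add: o_def)
  qed (simp_all add: F.Ident_C F.Comp_C F.FO G.FO F.FM_Id G.FM_Id F.FM_Co G.FM_Co F.FM)
qed

text \<open>Total modules have carriers in \<open>int \<Rightarrow> 'a\<close>, but the target
  category has carriers in \<open>'b\<close>. Each object is sent to a chosen copy, and morphisms
  are conjugated by the chosen isomorphisms \<open>t\<close>.\<close>

lemma transport_fully_faithful:
  assumes inf: "infinite (UNIV :: 'b set)"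
  obtains GO :: "((nat \<Rightarrow> int) set, 'a) module \<Rightarrow> ((nat \<Rightarrow> int) set, 'b) module" and GM
  where "fully_faithful (sub_category dual_integers) (sub_category dual_integers) GO GM"
    "\<And>M. M \<in> Obj (sub_category dual_integers) \<Longrightarrow> isomorphic_modules dual_integers M (GO M)"
proof -
  let ?S = "sub_category dual_integers :: (((nat \<Rightarrow> int) set, 'a) module, 'a \<Rightarrow> 'a) category"
  let ?T = "sub_category dual_integers :: (((nat \<Rightarrow> int) set, 'b) module, 'b \<Rightarrow> 'b) category"
  have "\<exists>N t. N \<in> Obj ?T \<and> t \<in> module_homs dual_integers M N \<and> bij_betw t (carrier M) (carrier N)"
    if M: "M \<in> Obj ?S" for M
    using isomorphic_copy[OF inf M] unfolding isomorphic_modules_def by metis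
  then obtain GO t where GO: "\<And>M. M \<in> Obj ?S \<Longrightarrow> GO M \<in> Obj ?T"
    and t: "\<And>M. M \<in> Obj ?S \<Longrightarrow> t M \<in> module_homs dual_integers M (GO M)"
    and bij: "\<And>M. M \<in> Obj ?S \<Longrightarrow> bij_betw (t M) (carrier M) (carrier (GO M))"
    by metis
  define t' where "t' M = (\<lambda>y \<in> carrier (GO M). inv_into (carrier M) (t M) y)" for M
  have mod: "module dual_integers M" if "M \<in> Obj ?S" for M using that by (simp add: Obj_sub_category)
  have modG: "module dual_integers (GO M)" if "M \<in> Obj ?S" for M
    using GO[OF that] by (simp add: Obj_sub_category)
  have t': "t' M \<in> module_homs dual_integers (GO M) M" if "M \<in> Obj ?S" for M
    unfolding t'_def using that by (intro inverse_module_hom mod t bij)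
  have tc: "t M x \<in> carrier (GO M)" if "M \<in> Obj ?S" "x \<in> carrier M" for M x
    using t[OF that(1)] that(2) by (rule module_homs_closed)
  have t'c: "t' M x \<in> carrier M" if "M \<in> Obj ?S" "x \<in> carrier (GO M)" for M x
    using t'[OF that(1)] that(2) by (rule module_homs_closed)
  have t't: "t' M (t M x) = x" if "M \<in> Obj ?S" "x \<in> carrier M" for M x
    using bij[OF that(1)] that tc by (auto simp: t'_def bij_betw_def)
  have tt': "t M (t' M y) = y" if "M \<in> Obj ?S" "y \<in> carrier (GO M)" for M y
    using bij[OF that(1)] that by (auto simp: t'_def bij_betw_def f_inv_into_f)
  define GM where "GM M N f = compose (carrier (GO M)) (t N) (compose (carrier (GO M)) f (t' M))" for M N f
  define GM' where "GM' M N f = compose (carrier M) (t' N) (compose (carrier M) f (t M))" for M N f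
  have GM: "GM M N f \<in> module_homs dual_integers (GO M) (GO N)"
    if "M \<in> Obj ?S" "N \<in> Obj ?S" "f \<in> module_homs dual_integers M N" for M N f
    unfolding GM_def
    by (rule compose_in_module_homs[OF compose_in_module_homs[OF t'[OF that(1)] that(3) modG[OF that(1)]]
          t[OF that(2)] modG[OF that(1)]])
  have GM': "GM' M N f \<in> module_homs dual_integers M N"
    if "M \<in> Obj ?S" "N \<in> Obj ?S" "f \<in> module_homs dual_integers (GO M) (GO N)" for M N f
    unfolding GM'_def
    by (rule compose_in_module_homs[OF compose_in_module_homs[OF t[OF that(1)] that(3) mod[OF that(1)]]
          t'[OF that(2)] mod[OF that(1)]])
  show ?thesis
  proof (rule that)
    show "fully_faithful ?S ?T GO GM"
    proof (intro fully_faithful.intro category_sub_category fully_faithful_axioms.intro)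
      fix M N assume M: "M \<in> Obj ?S" and N: "N \<in> Obj ?S"
      show "bij_betw (GM M N) (Mor ?S M N) (Mor ?T (GO M) (GO N))"
      proof (rule bij_betwI[where g = "GM' M N"])
        show "GM' M N (GM M N f) = f" if "f \<in> Mor ?S M N" for f
        proof (rule ext)
          fix x
          show "GM' M N (GM M N f) x = f x"
          proof (cases "x \<in> carrier M")
            case True
            then show ?thesis using M N module_homs_closed[of f dual_integers M N] that
              by (simp add: GM_def GM'_def compose_def tc t't)
          next
            case False
            then show ?thesis using that by (simp add: GM'_def compose_def module_homs_def extensional_def)
          qed
        qed
        show "GM M N (GM' M N f) = f" if "f \<in> Mor ?T (GO M) (GO N)" for f
        proof (rule ext)
          fix x
          show "GM M N (GM' M N f) x = f x"
          proof (cases "x \<in> carrier (GO M)")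
            case True
            then show ?thesis using M N module_homs_closed[of f dual_integers "GO M" "GO N"] that
              by (simp add: GM_def GM'_def compose_def t'c tt')
          next
            case False
            then show ?thesis using that by (simp add: GM_def compose_def module_homs_def extensional_def)
          qed
        qed
      qed (use GM GM' M N in auto)
    next
      fix L M N f g
      assume L: "L \<in> Obj ?S" and M: "M \<in> Obj ?S" and N: "N \<in> Obj ?S"
        and f: "f \<in> Mor ?S L M" and g: "g \<in> Mor ?S M N"
      show "Comp ?S L M N g f \<in> Mor ?S L N"
        using f g mod[OF L] by (simp add: compose_in_module_homs)
      show "GM L N (Comp ?S L M N g f) = Comp ?T (GO L) (GO M) (GO N) (GM M N g) (GM L M f)"
        using L M N module_homs_closed[of f dual_integers L M] f
        by (auto simp: GM_def compose_def tc t'c t't intro!: restrict_ext)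
    next
      fix M assume M: "M \<in> Obj ?S"
      show "Ident ?S M \<in> Mor ?S M M" using mod[OF M] by (simp add: id_in_module_homs)
      show "GM M M (Ident ?S M) = Ident ?T (GO M)"
        using M by (auto simp: GM_def compose_def t'c tt' intro!: restrict_ext)
    qed (rule GO)
    show "isomorphic_modules dual_integers M (GO M)" if "M \<in> Obj ?S" for M
      unfolding isomorphic_modules_def using t[OF that] bij[OF that] by blast
  qed
qed

section \<open>Total modules of bounded complexes\<close>

text \<open>The element (-1)^k y in multiplicative notation. Parity also makes sense for the
  negative degrees that occur.\<close>

definition signed :: "('a, 'k) monoid_scheme \<Rightarrow> int \<Rightarrow> 'a \<Rightarrow> 'a" where
  "signed G k y = (if even k then y else inv\<^bsub>G\<^esub> y)"

context comm_group
begin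

lemma signed_closed [simp]: "y \<in> carrier G \<Longrightarrow> signed G k y \<in> carrier G"
  by (simp add: signed_def)

lemma signed_signed: "y \<in> carrier G \<Longrightarrow> signed G j (signed G k y) = signed G (j + k) y"
  by (auto simp: signed_def)

lemma signed_one [simp]: "signed G k \<one> = \<one>"
  by (simp add: signed_def)

lemma signed_mult: "\<lbrakk>x \<in> carrier G; y \<in> carrier G\<rbrakk> \<Longrightarrow> signed G k (x \<otimes> y) = signed G k x \<otimes> signed G k y"
  by (simp add: signed_def inv_mult)

lemma signed_eqD: "\<lbrakk>signed G k x = signed G k y; x \<in> carrier G; y \<in> carrier G\<rbrakk> \<Longrightarrow> x = y"
  by (auto simp: signed_def split: if_splits)

end

lemma (in group_hom) hom_signed: "x \<in> carrier G \<Longrightarrow> h (signed G k x) = signed H k (h x)"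
  by (simp add: signed_def hom_inv)

locale bounded_complex =
  fixes X :: "'a cochain_complex"
  assumes bounded: "X \<in> bounded_free_complexes"
begin

lemma free: "fg_free_abelian_group (cgrp X n)"
  using bounded by (simp add: bounded_free_complexes_def)

sublocale G: comm_group "cgrp X n" for n
  using free by (simp add: fg_free_abelian_group_def)

lemma cdif: "cdif X n \<in> group_homs (cgrp X n) (cgrp X (n + 1))"
  using bounded by (simp add: bounded_free_complexes_def)

sublocale d: group_hom "cgrp X n" "cgrp X (n + 1)" "cdif X n" for n
  using cdif[of n] by (simp add: group_hom_def group_hom_axioms_def group_homs_def)

lemma cdif_cdif: "x \<in> carrier (cgrp X n) \<Longrightarrow> cdif X (n + 1) (cdif X n x) = \<one>\<^bsub>cgrp X (n + 2)\<^esub>"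
  using bounded by (simp add: bounded_free_complexes_def)

definition supp :: "int set" where "supp = {n. carrier (cgrp X n) \<noteq> {\<one>\<^bsub>cgrp X n\<^esub>}}"

lemma finite_supp: "finite supp"
  using bounded by (simp add: supp_def bounded_free_complexes_def)

lemma trivial: "\<lbrakk>n \<notin> supp; x \<in> carrier (cgrp X n)\<rbrakk> \<Longrightarrow> x = \<one>\<^bsub>cgrp X n\<^esub>"
  by (auto simp: supp_def)

end

section \<open>Shifts and groups of chain maps\<close>

lemma shift_bounded:
  assumes "X \<in> bounded_free_complexes"
  shows "shift_complex i X \<in> bounded_free_complexes"
proof -
  interpret bounded_complex X by (rule bounded_complex.intro[OF assms])
  have d: "cdif (shift_complex i X) n x = signed (cgrp X (n + i + 1)) i (cdif X (n + i) x)"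
    if "x \<in> carrier (cgrp X (n + i))" for n x
    using that by (simp add: shift_complex_def signed_def)
  have c: "cdif X (n + i) x \<in> carrier (cgrp X (n + i + 1))" if "x \<in> carrier (cgrp X (n + i))" for n x
    using that by (rule d.hom_closed)
  have ix: "n + 1 + i = n + i + 1" "n + 2 + i = n + i + 2" "n + i + 1 + 1 = n + i + 2" for n by auto
  have "cdif (shift_complex i X) n \<in> group_homs (cgrp X (n + i)) (cgrp X (n + 1 + i))" for n
    unfolding group_homs_def ix
    by (auto simp: hom_def d c G.signed_mult) (simp add: shift_complex_def)
  moreover have "cdif (shift_complex i X) (n + 1) (cdif (shift_complex i X) n x) = \<one>\<^bsub>cgrp X (n + 2 + i)\<^esub>"
    if x: "x \<in> carrier (cgrp X (n + i))" for n x
  proof -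
    let ?y = "cdif X (n + i) x" and ?z = "signed (cgrp X (n + i + 1)) i (cdif X (n + i) x)"
    have z: "?z \<in> carrier (cgrp X (n + i + 1))" using c[OF x] by (rule G.signed_closed)
    have "cdif X (n + i + 1) ?z = signed (cgrp X (n + i + 2)) i (cdif X (n + i + 1) ?y)"
      using d.hom_signed[OF c[OF x]] by (simp only: ix)
    also have "\<dots> = \<one>\<^bsub>cgrp X (n + i + 2)\<^esub>" using cdif_cdif[OF x] by simp
    finally have "cdif (shift_complex i X) (n + 1) ?z = signed (cgrp X (n + i + 2)) i \<one>\<^bsub>cgrp X (n + i + 2)\<^esub>"
      using d[of ?z "n + 1"] z by (simp only: ix)
    then show ?thesis by (simp only: d[OF x] ix G.signed_one)
  qed
  moreover have "finite {n. carrier (cgrp X (n + i)) \<noteq> {\<one>\<^bsub>cgrp X (n + i)\<^esub>}}"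
  proof (rule finite_subset)
    show "{n. carrier (cgrp X (n + i)) \<noteq> {\<one>\<^bsub>cgrp X (n + i)\<^esub>}} \<subseteq> (\<lambda>m. m - i) ` supp"
    proof
      fix n assume "n \<in> {n. carrier (cgrp X (n + i)) \<noteq> {\<one>\<^bsub>cgrp X (n + i)\<^esub>}}"
      then show "n \<in> (\<lambda>m. m - i) ` supp" by (intro image_eqI[of n _ "n + i"]) (auto simp: supp_def)
    qed
  qed (simp add: finite_supp)
  ultimately show ?thesis
    by (simp add: bounded_free_complexes_def free shift_complex_def)
qed

text \<open>Both the direct sums that form the morphism sets of the orbit category and the sums in
  its composition take place in these groups.\<close>

lemma comm_group_chain_map_group:
  assumes "X \<in> bounded_free_complexes" "Y \<in> bounded_free_complexes"
  shows "comm_group (chain_map_group X Y)"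
proof -
  interpret X: bounded_complex X by (rule bounded_complex.intro[OF assms(1)])
  interpret Y: bounded_complex Y by (rule bounded_complex.intro[OF assms(2)])
  let ?H = "chain_map_group X Y"
  have hom: "f n x \<in> carrier (cgrp Y n)" if "f \<in> carrier ?H" "x \<in> carrier (cgrp X n)" for f n x
    using that by (auto simp: chain_map_group_def group_homs_def hom_def)
  have mult: "f n (x \<otimes>\<^bsub>cgrp X n\<^esub> y) = f n x \<otimes>\<^bsub>cgrp Y n\<^esub> f n y"
    if "f \<in> carrier ?H" "x \<in> carrier (cgrp X n)" "y \<in> carrier (cgrp X n)" for f n x y
    using that by (auto simp: chain_map_group_def group_homs_def hom_def)
  have d: "f (n + 1) (cdif X n x) = cdif Y n (f n x)"
    if "f \<in> carrier ?H" "x \<in> carrier (cgrp X n)" for f n x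
    using that by (auto simp: chain_map_group_def)
  have Hext: "f n \<in> extensional (carrier (cgrp X n))" if "f \<in> carrier ?H" for f n
    using that by (auto simp: chain_map_group_def group_homs_def)
  have HI: "f \<in> carrier ?H"
    if "\<And>n x. x \<in> carrier (cgrp X n) \<Longrightarrow> f n x \<in> carrier (cgrp Y n)"
      "\<And>n x y. \<lbrakk>x \<in> carrier (cgrp X n); y \<in> carrier (cgrp X n)\<rbrakk>
        \<Longrightarrow> f n (x \<otimes>\<^bsub>cgrp X n\<^esub> y) = f n x \<otimes>\<^bsub>cgrp Y n\<^esub> f n y"
      "\<And>n x. x \<in> carrier (cgrp X n) \<Longrightarrow> f (n + 1) (cdif X n x) = cdif Y n (f n x)"
      "\<And>n. f n \<in> extensional (carrier (cgrp X n))" for f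
    using that by (auto simp: chain_map_group_def group_homs_def hom_def)
  have eqI: "f = g" if "f \<in> carrier ?H" "g \<in> carrier ?H"
      "\<And>n x. x \<in> carrier (cgrp X n) \<Longrightarrow> f n x = g n x" for f g
    using that Hext by (intro ext[of f g] extensionalityI) auto
  have m: "(f \<otimes>\<^bsub>?H\<^esub> g) n x = f n x \<otimes>\<^bsub>cgrp Y n\<^esub> g n x" if "x \<in> carrier (cgrp X n)" for f g n x
    using that by (simp add: chain_map_group_def)
  have o: "\<one>\<^bsub>?H\<^esub> n x = \<one>\<^bsub>cgrp Y n\<^esub>" if "x \<in> carrier (cgrp X n)" for n x
    using that by (simp add: chain_map_group_def)
  have mc: "f \<otimes>\<^bsub>?H\<^esub> g \<in> carrier ?H" if "f \<in> carrier ?H" "g \<in> carrier ?H" for f g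
  proof (rule HI)
    show "(f \<otimes>\<^bsub>?H\<^esub> g) n \<in> extensional (carrier (cgrp X n))" for n
      by (simp add: chain_map_group_def)
  qed (use that in \<open>simp_all add: m hom mult Y.G.m_ac d\<close>)
  have oc: "\<one>\<^bsub>?H\<^esub> \<in> carrier ?H"
  proof (rule HI)
    show "\<one>\<^bsub>?H\<^esub> n \<in> extensional (carrier (cgrp X n))" for n
      by (simp add: chain_map_group_def)
  qed (simp_all add: o)
  show ?thesis
  proof (rule comm_groupI)
    show "\<exists>g \<in> carrier ?H. g \<otimes>\<^bsub>?H\<^esub> f = \<one>\<^bsub>?H\<^esub>" if f: "f \<in> carrier ?H" for f
    proof
      let ?g = "\<lambda>n. \<lambda>x \<in> carrier (cgrp X n). inv\<^bsub>cgrp Y n\<^esub> f n x"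
      show g: "?g \<in> carrier ?H"
        by (rule HI) (use f in \<open>simp_all add: hom mult Y.G.inv_mult d Y.d.hom_inv\<close>)
      show "?g \<otimes>\<^bsub>?H\<^esub> f = \<one>\<^bsub>?H\<^esub>"
        by (rule eqI) (use f g mc oc in \<open>simp_all add: m o hom\<close>)
    qed
    show "f \<otimes>\<^bsub>?H\<^esub> g \<otimes>\<^bsub>?H\<^esub> h = f \<otimes>\<^bsub>?H\<^esub> (g \<otimes>\<^bsub>?H\<^esub> h)"
      if "f \<in> carrier ?H" "g \<in> carrier ?H" "h \<in> carrier ?H" for f g h
      by (rule eqI) (use that mc in \<open>simp_all add: m hom Y.G.m_assoc\<close>)
    show "f \<otimes>\<^bsub>?H\<^esub> g = g \<otimes>\<^bsub>?H\<^esub> f" if "f \<in> carrier ?H" "g \<in> carrier ?H" for f g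
      by (rule eqI) (use that mc in \<open>simp_all add: m hom Y.G.m_comm\<close>)
    show "\<one>\<^bsub>?H\<^esub> \<otimes>\<^bsub>?H\<^esub> f = f" if "f \<in> carrier ?H" for f
      by (rule eqI) (use that mc oc in \<open>simp_all add: m o hom\<close>)
  qed (rule mc oc; assumption?)+
qed

lemma complex_orbit_simps:
  "Obj complex_orbit_category = bounded_free_complexes"
  "Mor complex_orbit_category X Y = carrier (sum_group UNIV (\<lambda>i. chain_map_group X (shift_complex i Y)))"
  "Ident complex_orbit_category X =
    (\<lambda>i. if i = 0 then (\<lambda>n. \<lambda>x \<in> carrier (cgrp X n). x) else \<one>\<^bsub>chain_map_group X (shift_complex i X)\<^esub>)"
  "Comp complex_orbit_category X Y Z g f m = gfinprod (chain_map_group X (shift_complex m Z))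
    (\<lambda>i n. compose (carrier (cgrp X n)) (g (m - i) (n + i)) (f i n)) UNIV"
  by (simp_all add: complex_orbit_category_def orbit_category_def bounded_complex_category_def
      shift_chain_map_def cong: if_cong)

text \<open>The sign of the shifted differential is written with \<open>signed\<close>, so that it
  can be combined with the signs in \<open>total_dif\<close>.\<close>

lemma chain_map_to_shift_iff:
  assumes "Y \<in> bounded_free_complexes"
  shows "f \<in> carrier (chain_map_group X (shift_complex i Y)) \<longleftrightarrow>
    (\<forall>n. f n \<in> group_homs (cgrp X n) (cgrp Y (n + i))) \<and>
    (\<forall>n. \<forall>x \<in> carrier (cgrp X n).
      f (n + 1) (cdif X n x) = signed (cgrp Y (n + i + 1)) i (cdif Y (n + i) (f n x)))"
proof -
  have "(cdif (shift_complex i Y) n (f n x) = signed (cgrp Y (n + i + 1)) i (cdif Y (n + i) (f n x)))"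
    if "f n \<in> group_homs (cgrp X n) (cgrp Y (n + i))" "x \<in> carrier (cgrp X n)" for n x
    using that by (auto simp: shift_complex_def signed_def group_homs_def hom_def)
  moreover have "cgrp (shift_complex i Y) n = cgrp Y (n + i)" for n by (simp add: shift_complex_def)
  ultimately show ?thesis by (auto simp: chain_map_group_def)
qed

locale two_complexes = X: bounded_complex X + Y: bounded_complex Y
  for X Y :: "'a cochain_complex"
begin

text \<open>A nonzero component of \<open>f i\<close> in degree \<open>n\<close> needs
  \<open>n\<close> in the support of \<open>X\<close> and \<open>n + i\<close> in that of
  \<open>Y\<close>, so \<open>i\<close> is one of finitely many differences. Hence the
  finite-support clause in the orbit category holds automatically.\<close>

lemma chain_maps_finite_support:
  assumes "\<And>i. f i \<in> carrier (chain_map_group X (shift_complex i Y))"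
  shows "finite {i. f i \<noteq> \<one>\<^bsub>chain_map_group X (shift_complex i Y)\<^esub>}"
proof (rule finite_subset)
  show "finite ((\<lambda>(m, n). m - n) ` (Y.supp \<times> X.supp))"
    using X.finite_supp Y.finite_supp by simp
  show "{i. f i \<noteq> \<one>\<^bsub>chain_map_group X (shift_complex i Y)\<^esub>} \<subseteq> (\<lambda>(m, n). m - n) ` (Y.supp \<times> X.supp)"
  proof
    fix i assume "i \<in> {i. f i \<noteq> \<one>\<^bsub>chain_map_group X (shift_complex i Y)\<^esub>}"
    then obtain n where n: "f i n \<noteq> (\<lambda>x \<in> carrier (cgrp X n). \<one>\<^bsub>cgrp Y (n + i)\<^esub>)"
      by (auto simp: chain_map_group_def shift_complex_def)
    have f: "f i n \<in> hom (cgrp X n) (cgrp Y (n + i))" "f i n \<in> extensional (carrier (cgrp X n))"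
      using assms[of i] unfolding chain_map_to_shift_iff[OF Y.bounded] by (auto simp: group_homs_def)
    obtain x where x: "x \<in> carrier (cgrp X n)" "f i n x \<noteq> \<one>\<^bsub>cgrp Y (n + i)\<^esub>"
      using n f(2) extensionalityI[of "f i n" "carrier (cgrp X n)" "\<lambda>x \<in> carrier (cgrp X n). \<one>\<^bsub>cgrp Y (n + i)\<^esub>"]
      by auto
    have "n \<in> X.supp"
      using X.trivial[of n x] x hom_one[OF f(1)] by (auto simp: X.G.group_axioms Y.G.group_axioms)
    moreover have "n + i \<in> Y.supp"
      using Y.trivial[of "n + i" "f i n x"] x hom_in_carrier[OF f(1)] by auto
    ultimately show "i \<in> (\<lambda>(m, n). m - n) ` (Y.supp \<times> X.supp)"
      by (intro image_eqI[of _ _ "(n + i, n)"]) auto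
  qed
qed

lemma chain_map_comm_group: "comm_group (chain_map_group X (shift_complex i Y))"
  by (intro comm_group_chain_map_group X.bounded shift_bounded Y.bounded)

lemma Mor_iff:
  "f \<in> Mor complex_orbit_category X Y \<longleftrightarrow> (\<forall>i. f i \<in> carrier (chain_map_group X (shift_complex i Y)))"
proof -
  have "f \<in> Mor complex_orbit_category X Y \<longleftrightarrow>
      (\<forall>i. f i \<in> carrier (chain_map_group X (shift_complex i Y))) \<and>
      finite {i. f i \<noteq> \<one>\<^bsub>chain_map_group X (shift_complex i Y)\<^esub>}"
    unfolding complex_orbit_simps
    by (subst carrier_sum_group) (auto simp: chain_map_comm_group comm_group_imp_group PiE_iff)
  then show ?thesis using chain_maps_finite_support by blast
qed

end

section \<open>The total module of one complex\<close>

context bounded_complex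
begin

text \<open>For a bounded complex the product over all degrees coincides with the direct
  sum.\<close>

definition total :: "(int \<Rightarrow> 'a) monoid" where "total = product_group UNIV (cgrp X)"

text \<open>The sign belongs to the source degree, which is \<open>m - 1\<close> for the component
  landing in degree \<open>m\<close>.\<close>

definition total_dif :: "(int \<Rightarrow> 'a) \<Rightarrow> int \<Rightarrow> 'a" where
  "total_dif x = (\<lambda>m. signed (cgrp X m) (m - 1) (cdif X (m - 1) (x (m - 1))))"

definition gen :: "int \<Rightarrow> 'a \<Rightarrow> int \<Rightarrow> 'a" where
  "gen n x = (\<lambda>k. if k = n then x else \<one>\<^bsub>cgrp X k\<^esub>)"

lemma total_carrier [simp]: "x \<in> carrier total \<longleftrightarrow> (\<forall>n. x n \<in> carrier (cgrp X n))"
  by (auto simp: total_def PiE_iff)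

lemma total_mult [simp]: "x \<otimes>\<^bsub>total\<^esub> y = (\<lambda>n. x n \<otimes>\<^bsub>cgrp X n\<^esub> y n)"
  by (simp add: total_def restrict_def)

lemma total_one [simp]: "\<one>\<^bsub>total\<^esub> = (\<lambda>n. \<one>\<^bsub>cgrp X n\<^esub>)"
  by (simp add: total_def restrict_def)

lemma total_free: "fg_free_abelian_group total"
  unfolding total_def using finite_supp
  by (intro fg_free_product_group free) (simp add: supp_def)

sublocale total: comm_group total
  using total_free by (simp add: fg_free_abelian_group_def)

lemma cdif_pred: "x \<in> carrier (cgrp X (n - 1)) \<Longrightarrow> cdif X (n - 1) x \<in> carrier (cgrp X n)"
  using d.hom_closed[of x "n - 1"] by simp

lemma total_dif_hom: "total_dif \<in> hom total total"
proof (rule homI)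
  show "total_dif x \<in> carrier total" if "x \<in> carrier total" for x
    using that by (simp add: total_dif_def cdif_pred)
  show "total_dif (x \<otimes>\<^bsub>total\<^esub> y) = total_dif x \<otimes>\<^bsub>total\<^esub> total_dif y"
    if "x \<in> carrier total" "y \<in> carrier total" for x y
  proof
    fix n
    have "cdif X (n - 1) (x (n - 1) \<otimes>\<^bsub>cgrp X (n - 1)\<^esub> y (n - 1)) =
        cdif X (n - 1) (x (n - 1)) \<otimes>\<^bsub>cgrp X n\<^esub> cdif X (n - 1) (y (n - 1))"
      using d.hom_mult[of "x (n - 1)" "n - 1" "y (n - 1)"] that by simp
    then show "total_dif (x \<otimes>\<^bsub>total\<^esub> y) n = (total_dif x \<otimes>\<^bsub>total\<^esub> total_dif y) n"
      using that by (simp add: total_dif_def G.signed_mult cdif_pred)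
  qed
qed

lemma total_dif_total_dif:
  assumes "x \<in> carrier total" shows "total_dif (total_dif x) = \<one>\<^bsub>total\<^esub>"
proof
  fix n
  let ?y = "cdif X (n - 2) (x (n - 2))"
  have x: "x (n - 2) \<in> carrier (cgrp X (n - 2))" using assms by simp
  have ix: "n - 2 + 1 = n - 1" "n - 1 - 1 = n - 2" "n - 1 + 1 = n" "n - 2 + 2 = n" by auto
  have y: "?y \<in> carrier (cgrp X (n - 1))" using d.hom_closed[OF x] by (simp only: ix)
  have "cdif X (n - 1) (signed (cgrp X (n - 1)) (n - 2) ?y) = signed (cgrp X n) (n - 2) (cdif X (n - 1) ?y)"
    using d.hom_signed[OF y] by (simp only: ix)
  also have "cdif X (n - 1) ?y = \<one>\<^bsub>cgrp X n\<^esub>" using cdif_cdif[OF x] by (simp only: ix)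
  finally show "total_dif (total_dif x) n = \<one>\<^bsub>total\<^esub> n" by (simp add: total_dif_def ix)
qed

lemma total_differential_group: "differential_group total total_dif"
  using total_dif_hom total_dif_total_dif total.comm_group_axioms
  unfolding differential_group_def by blast

lemma gen_closed [simp]: "x \<in> carrier (cgrp X n) \<Longrightarrow> gen n x \<in> carrier total"
  by (simp add: gen_def)

lemma gen_hom: "gen n \<in> hom (cgrp X n) total"
  by (auto simp: hom_def gen_def)

lemma total_dif_gen:
  assumes "x \<in> carrier (cgrp X n)"
  shows "total_dif (gen n x) = gen (n + 1) (signed (cgrp X (n + 1)) n (cdif X n x))"
proof
  fix k
  show "total_dif (gen n x) k = gen (n + 1) (signed (cgrp X (n + 1)) n (cdif X n x)) k"
  proof (cases "k = n + 1")
    case False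
    moreover have "cdif X (k - 1) \<one>\<^bsub>cgrp X (k - 1)\<^esub> = \<one>\<^bsub>cgrp X k\<^esub>" using d.hom_one[of "k - 1"] by simp
    ultimately show ?thesis by (auto simp: total_dif_def gen_def)
  qed (simp add: total_dif_def gen_def)
qed

text \<open>By boundedness every element is a finite product of homogeneous elements
  \<open>gen n x\<close>; the induction strips one degree at a time from the support.\<close>

lemma hom_total_eqI:
  assumes "group H" "\<phi> \<in> hom total H" "\<psi> \<in> hom total H"
    and gen: "\<And>n x. x \<in> carrier (cgrp X n) \<Longrightarrow> \<phi> (gen n x) = \<psi> (gen n x)"
    and x: "x \<in> carrier total"
  shows "\<phi> x = \<psi> x"
proof -
  have "\<phi> x = \<psi> x" if "finite S" "x \<in> carrier total" "\<And>n. n \<notin> S \<Longrightarrow> x n = \<one>\<^bsub>cgrp X n\<^esub>" for S x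
    using that
  proof (induction S arbitrary: x rule: finite_induct)
    case empty
    then have "x = \<one>\<^bsub>total\<^esub>" by auto
    then show ?case
      using hom_one[OF assms(2)] hom_one[OF assms(3)] assms(1) total.group_axioms by simp
  next
    case (insert n S)
    let ?y = "\<lambda>k. if k = n then \<one>\<^bsub>cgrp X k\<^esub> else x k"
    have y: "?y \<in> carrier total" using insert.prems by simp
    have g: "gen n (x n) \<in> carrier total" by (rule gen_closed) (use insert.prems in simp)
    have "x = gen n (x n) \<otimes>\<^bsub>total\<^esub> ?y" using insert.prems by (auto simp: gen_def)
    moreover have "\<phi> ?y = \<psi> ?y" by (rule insert.IH) (use y insert.prems in auto)
    moreover have "\<phi> (gen n (x n)) = \<psi> (gen n (x n))" using gen insert.prems by simp
    ultimately show ?case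
      using hom_mult[OF assms(2) g y] hom_mult[OF assms(3) g y] by metis
  qed
  from this[OF finite_supp x] show ?thesis using trivial x by auto
qed

end

section \<open>Morphisms of the orbit category as matrices\<close>

context two_complexes
begin

text \<open>A matrix acts on a column: the entry from degree \<open>n\<close> to degree
  \<open>m\<close> is the component of shift \<open>m - n\<close>. Summing over
  \<open>X.supp\<close> keeps the sum finite and omits only trivial terms when \<open>f\<close> is a
  morphism.\<close>

definition total_map :: "(int \<Rightarrow> int \<Rightarrow> 'a \<Rightarrow> 'a) \<Rightarrow> (int \<Rightarrow> 'a) \<Rightarrow> int \<Rightarrow> 'a" where
  "total_map f = (\<lambda>x \<in> carrier X.total. \<lambda>m. finprod (cgrp Y m) (\<lambda>n. f (m - n) n (x n)) X.supp)"

text \<open>The matrix entries are recovered from the values on homogeneous elements, which makes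
  this the inverse of \<open>total_map\<close>.\<close>

definition components :: "((int \<Rightarrow> 'a) \<Rightarrow> int \<Rightarrow> 'a) \<Rightarrow> int \<Rightarrow> int \<Rightarrow> 'a \<Rightarrow> 'a" where
  "components \<phi> = (\<lambda>i n. \<lambda>x \<in> carrier (cgrp X n). \<phi> (X.gen n x) (n + i))"

definition total_homs :: "((int \<Rightarrow> 'a) \<Rightarrow> int \<Rightarrow> 'a) set" where
  "total_homs = {\<phi> \<in> hom X.total Y.total \<inter> extensional (carrier X.total).
     \<forall>x \<in> carrier X.total. \<phi> (X.total_dif x) = Y.total_dif (\<phi> x)}"

lemma total_homs_eq_module_homs:
  "total_homs = module_homs dual_integers (dual_module X.total X.total_dif) (dual_module Y.total Y.total_dif)"
proof -
  have "eps (dual_module Y.total Y.total_dif) (\<phi> x) = Y.total_dif (\<phi> x)"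
    if "\<phi> \<in> hom X.total Y.total" "x \<in> carrier X.total" for \<phi> x
    using hom_in_carrier[OF that] by (rule eps_dual_module[OF Y.total_differential_group])
  then show ?thesis
    unfolding total_homs_def module_homs_dual_integers[OF
        dual_integers_module_dual_module[OF X.total_differential_group]
        dual_integers_module_dual_module[OF Y.total_differential_group]]
    by (auto simp: eps_dual_module[OF X.total_differential_group] simp del: X.total_carrier)
qed

lemma MorD:
  assumes "f \<in> Mor complex_orbit_category X Y"
  shows "f i n \<in> hom (cgrp X n) (cgrp Y (n + i))"
    and "f i n \<in> extensional (carrier (cgrp X n))"
    and "x \<in> carrier (cgrp X n) \<Longrightarrow> f i (n + 1) (cdif X n x) = signed (cgrp Y (n + i + 1)) i (cdif Y (n + i) (f i n x))"
  using assms unfolding Mor_iff chain_map_to_shift_iff[OF Y.bounded] by (auto simp: group_homs_def)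

lemma Mor_hom:
  assumes "f \<in> Mor complex_orbit_category X Y"
  shows "f (m - n) n \<in> hom (cgrp X n) (cgrp Y m)"
  using MorD(1)[OF assms, of "m - n" n] by simp

lemma Mor_one:
  assumes "f \<in> Mor complex_orbit_category X Y"
  shows "f i n \<one>\<^bsub>cgrp X n\<^esub> = \<one>\<^bsub>cgrp Y (n + i)\<^esub>"
  using hom_one[OF MorD(1)[OF assms]] X.G.group_axioms Y.G.group_axioms by blast

lemma total_map_gen:
  assumes f: "f \<in> Mor complex_orbit_category X Y" and x: "x \<in> carrier (cgrp X n)"
  shows "total_map f (X.gen n x) m = f (m - n) n x"
proof -
  have c: "f (m - n) n x \<in> carrier (cgrp Y m)" using hom_in_carrier[OF Mor_hom[OF f] x] .
  have "total_map f (X.gen n x) m = finprod (cgrp Y m) (\<lambda>k. f (m - k) k (X.gen n x k)) X.supp"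
    using X.gen_closed[OF x] by (simp add: total_map_def del: X.total_carrier)
  \<comment> \<open>Only column \<open>n\<close> survives. The index set is an intersection because
    \<open>n\<close> may lie outside the support; then it is empty and \<open>x\<close> is
    trivial.\<close>
  also have "\<dots> = finprod (cgrp Y m) (\<lambda>k. f (m - n) n x) ({n} \<inter> X.supp)"
  proof (rule Y.G.finprod_mono_neutral_cong_right)
    show "f (m - k) k (X.gen n x k) = \<one>\<^bsub>cgrp Y m\<^esub>" if "k \<in> X.supp - {n} \<inter> X.supp" for k
      using that Mor_one[OF f, of "m - k" k] by (auto simp: X.gen_def)
    show "(\<lambda>k. f (m - k) k (X.gen n x k)) \<in> X.supp \<rightarrow> carrier (cgrp Y m)"
    proof
      fix k
      have "X.gen n x k \<in> carrier (cgrp X k)" using X.gen_closed[OF x] by simp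
      then show "f (m - k) k (X.gen n x k) \<in> carrier (cgrp Y m)" by (rule hom_in_carrier[OF Mor_hom[OF f]])
    qed
  qed (auto simp: X.finite_supp X.gen_def)
  also have "\<dots> = f (m - n) n x"
  proof (cases "n \<in> X.supp")
    case True
    then show ?thesis using c by simp
  next
    case False
    then show ?thesis using X.trivial[OF False x] Mor_one[OF f, of "m - n" n] by simp
  qed
  finally show ?thesis .
qed

lemma total_map_hom:
  assumes f: "f \<in> Mor complex_orbit_category X Y"
  shows "total_map f \<in> hom X.total Y.total"
proof (rule homI)
  have c: "(\<lambda>n. f (m - n) n (x n)) \<in> X.supp \<rightarrow> carrier (cgrp Y m)" if "x \<in> carrier X.total" for x m
    using that hom_in_carrier[OF Mor_hom[OF f]] by auto
  show "total_map f x \<in> carrier Y.total" if "x \<in> carrier X.total" for x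
    using Y.G.finprod_closed[OF c[OF that]] that by (simp add: total_map_def)
  show "total_map f (x \<otimes>\<^bsub>X.total\<^esub> y) = total_map f x \<otimes>\<^bsub>Y.total\<^esub> total_map f y"
    if x: "x \<in> carrier X.total" and y: "y \<in> carrier X.total" for x y
  proof
    fix m
    have "finprod (cgrp Y m) (\<lambda>n. f (m - n) n (x n \<otimes>\<^bsub>cgrp X n\<^esub> y n)) X.supp =
        finprod (cgrp Y m) (\<lambda>n. f (m - n) n (x n) \<otimes>\<^bsub>cgrp Y m\<^esub> f (m - n) n (y n)) X.supp"
      using c[OF x, of m] c[OF y, of m] x y hom_mult[OF Mor_hom[OF f]]
      by (intro Y.G.finprod_cong') auto
    also have "\<dots> = finprod (cgrp Y m) (\<lambda>n. f (m - n) n (x n)) X.supp \<otimes>\<^bsub>cgrp Y m\<^esub>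
        finprod (cgrp Y m) (\<lambda>n. f (m - n) n (y n)) X.supp"
      by (rule Y.G.finprod_multf[OF c[OF x] c[OF y]])
    finally show "total_map f (x \<otimes>\<^bsub>X.total\<^esub> y) m = (total_map f x \<otimes>\<^bsub>Y.total\<^esub> total_map f y) m"
      using x y by (simp add: total_map_def)
  qed
qed

text \<open>
  The sign of the shift is absorbed by the signs in \<open>total_dif\<close>, so that \<open>total_map\<close> needs none.
\<close>

lemma total_map_total_dif:
  assumes f: "f \<in> Mor complex_orbit_category X Y" and x: "x \<in> carrier X.total"
  shows "total_map f (X.total_dif x) = Y.total_dif (total_map f x)"
proof -
  note T = total_map_hom[OF f]
  have "(total_map f \<circ> X.total_dif) x = (Y.total_dif \<circ> total_map f) x"
  proof (rule X.hom_total_eqI[OF Y.total.group_axioms _ _ _ x])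
    show "total_map f \<circ> X.total_dif \<in> hom X.total Y.total"
      by (rule hom_compose[OF X.total_dif_hom T])
    show "Y.total_dif \<circ> total_map f \<in> hom X.total Y.total"
      by (rule hom_compose[OF T Y.total_dif_hom])
    fix n x assume x: "x \<in> carrier (cgrp X n)"
    have dx: "cdif X n x \<in> carrier (cgrp X (n + 1))" using X.d.hom_closed[OF x] .
    show "(total_map f \<circ> X.total_dif) (X.gen n x) = (Y.total_dif \<circ> total_map f) (X.gen n x)"
    proof
      fix m
      \<comment> \<open>The same shift leads from degree \<open>n + 1\<close> to \<open>m\<close>
        and from \<open>n\<close> to \<open>m - 1\<close>, so both paths around the square use
        components of one chain map.\<close>
      let ?i = "m - (n + 1)"
      have ix: "n + ?i + 1 = m" "n + 1 + ?i = m" "n + ?i = m - 1" "m - 1 - n = ?i" "m - 1 + 1 = m" by auto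
      interpret F: group_hom "cgrp X (n + 1)" "cgrp Y m" "f ?i (n + 1)"
        using Mor_hom[OF f] by (simp add: group_hom_def group_hom_axioms_def X.G.group_axioms Y.G.group_axioms)
      have fx: "f ?i n x \<in> carrier (cgrp Y (m - 1))"
        using hom_in_carrier[OF MorD(1)[OF f] x, of ?i] by (simp only: ix)
      have dfx: "cdif Y (m - 1) (f ?i n x) \<in> carrier (cgrp Y m)" by (rule Y.cdif_pred[OF fx])
      have "(total_map f \<circ> X.total_dif) (X.gen n x) m = f ?i (n + 1) (signed (cgrp X (n + 1)) n (cdif X n x))"
        using total_map_gen[OF f X.G.signed_closed[OF dx]] by (simp add: X.total_dif_gen[OF x])
      also have "\<dots> = signed (cgrp Y m) n (f ?i (n + 1) (cdif X n x))"
        by (rule F.hom_signed[OF dx])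
      also have "f ?i (n + 1) (cdif X n x) = signed (cgrp Y m) ?i (cdif Y (m - 1) (f ?i n x))"
        using MorD(3)[OF f x, of ?i] by (simp only: ix)
      also have "signed (cgrp Y m) n \<dots> = signed (cgrp Y m) (n + ?i) (cdif Y (m - 1) (f ?i n x))"
        by (rule Y.G.signed_signed[OF dfx])
      also have "\<dots> = (Y.total_dif \<circ> total_map f) (X.gen n x) m"
        using total_map_gen[OF f x, of "m - 1"] by (simp only: Y.total_dif_def o_def ix)
      finally show "(total_map f \<circ> X.total_dif) (X.gen n x) m = (Y.total_dif \<circ> total_map f) (X.gen n x) m" .
    qed
  qed
  then show ?thesis by simp
qed

lemma total_map_in_total_homs:
  "f \<in> Mor complex_orbit_category X Y \<Longrightarrow> total_map f \<in> total_homs"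
  using total_map_hom total_map_total_dif by (auto simp: total_homs_def) (simp add: total_map_def)

lemma total_homs_eqI:
  assumes "\<phi> \<in> total_homs" "\<psi> \<in> total_homs"
    "\<And>n x. x \<in> carrier (cgrp X n) \<Longrightarrow> \<phi> (X.gen n x) = \<psi> (X.gen n x)"
  shows "\<phi> = \<psi>"
proof (rule extensionalityI)
  show "\<phi> x = \<psi> x" if "x \<in> carrier X.total" for x
    by (rule X.hom_total_eqI[OF Y.total.group_axioms _ _ _ that]) (use assms in \<open>auto simp: total_homs_def\<close>)
qed (use assms in \<open>auto simp: total_homs_def\<close>)

text \<open>The computation in \<open>total_map_total_dif\<close> read backwards: commuting with the
  total differentials is the chain map rule up to a common sign (-1)^n, which
  \<open>signed_eqD\<close> cancels.\<close>

lemma components_in_Mor: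
  assumes "\<phi> \<in> total_homs"
  shows "components \<phi> \<in> Mor complex_orbit_category X Y"
  unfolding Mor_iff chain_map_to_shift_iff[OF Y.bounded]
proof (intro allI conjI ballI)
  have \<phi>: "\<phi> \<in> hom X.total Y.total" "\<And>x. x \<in> carrier X.total \<Longrightarrow> \<phi> (X.total_dif x) = Y.total_dif (\<phi> x)"
    using assms by (auto simp: total_homs_def)
  have h: "(\<lambda>x. \<phi> (X.gen n x) m) \<in> hom (cgrp X n) (cgrp Y m)" for n m
  proof -
    have "\<phi> \<circ> X.gen n \<in> hom (cgrp X n) Y.total" by (rule hom_compose[OF X.gen_hom \<phi>(1)])
    then show ?thesis by (auto simp: hom_def Pi_iff)
  qed
  fix i n
  show "components \<phi> i n \<in> group_homs (cgrp X n) (cgrp Y (n + i))"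
    using h[of n "n + i"] by (auto simp: components_def group_homs_def hom_def)
  fix x assume x: "x \<in> carrier (cgrp X n)"
  let ?m = "n + i + 1"
  let ?dx = "cdif X n x" and ?z = "\<phi> (X.gen n x) (n + i)"
  have dx: "?dx \<in> carrier (cgrp X (n + 1))" using X.d.hom_closed[OF x] .
  have z: "?z \<in> carrier (cgrp Y (n + i))" using hom_in_carrier[OF h x] .
  interpret H: group_hom "cgrp X (n + 1)" "cgrp Y ?m" "\<lambda>x. \<phi> (X.gen (n + 1) x) ?m"
    using h by (simp add: group_hom_def group_hom_axioms_def X.G.group_axioms Y.G.group_axioms)
  have dz: "cdif Y (n + i) ?z \<in> carrier (cgrp Y ?m)" using Y.d.hom_closed[OF z] .
  have Hd: "\<phi> (X.gen (n + 1) ?dx) ?m \<in> carrier (cgrp Y ?m)" using H.hom_closed[OF dx] .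
  have "signed (cgrp Y ?m) n (\<phi> (X.gen (n + 1) ?dx) ?m) = \<phi> (X.total_dif (X.gen n x)) ?m"
    using H.hom_signed[OF dx] by (simp add: X.total_dif_gen[OF x])
  also have "\<dots> = Y.total_dif (\<phi> (X.gen n x)) ?m" by (simp only: \<phi>(2)[OF X.gen_closed[OF x]])
  also have "\<dots> = signed (cgrp Y ?m) (n + i) (cdif Y (n + i) ?z)" by (simp add: Y.total_dif_def)
  also have "\<dots> = signed (cgrp Y ?m) n (signed (cgrp Y ?m) i (cdif Y (n + i) ?z))"
    using Y.G.signed_signed[OF dz] by simp
  finally have "\<phi> (X.gen (n + 1) ?dx) ?m = signed (cgrp Y ?m) i (cdif Y (n + i) ?z)"
    using Y.G.signed_eqD Hd dz by (meson Y.G.signed_closed)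
  moreover have "n + 1 + i = ?m" by simp
  ultimately show "components \<phi> i (n + 1) (cdif X n x) =
      signed (cgrp Y (n + i + 1)) i (cdif Y (n + i) (components \<phi> i n x))"
    using x dx by (simp only: components_def restrict_apply') 
qed

lemma bij_betw_total_map: "bij_betw total_map (Mor complex_orbit_category X Y) total_homs"
proof (rule bij_betwI[where g = components])
  show "total_map \<in> Mor complex_orbit_category X Y \<rightarrow> total_homs"
    using total_map_in_total_homs by blast
  show "components \<in> total_homs \<rightarrow> Mor complex_orbit_category X Y"
    using components_in_Mor by blast
  show "components (total_map f) = f" if f: "f \<in> Mor complex_orbit_category X Y" for f
  proof (intro ext)
    fix i n x
    show "components (total_map f) i n x = f i n x"
      using total_map_gen[OF f, of x n "n + i"] MorD(2)[OF f, of i n]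
      by (auto simp: components_def extensional_def)
  qed
  show "total_map (components \<phi>) = \<phi>" if \<phi>: "\<phi> \<in> total_homs" for \<phi>
  proof (rule total_homs_eqI[OF total_map_in_total_homs[OF components_in_Mor[OF \<phi>]] \<phi>])
    fix n x assume x: "x \<in> carrier (cgrp X n)"
    show "total_map (components \<phi>) (X.gen n x) = \<phi> (X.gen n x)"
    proof
      fix m
      have "total_map (components \<phi>) (X.gen n x) m = components \<phi> (m - n) n x"
        by (rule total_map_gen[OF components_in_Mor[OF \<phi>] x])
      then show "total_map (components \<phi>) (X.gen n x) m = \<phi> (X.gen n x) m"
        using x by (simp add: components_def)
    qed
  qed
qed

end

section \<open>Composition in the orbit category\<close>

locale three_complexes = XY: two_complexes X Y + YZ: two_complexes Y Z + XZ: two_complexes X Z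
  for X Y Z :: "'a cochain_complex"
begin

context
  fixes f g
  assumes f: "f \<in> Mor complex_orbit_category X Y" and g: "g \<in> Mor complex_orbit_category Y Z"
begin

text \<open>The part of the degree \<open>m\<close> composite that passes through shift
  \<open>i\<close>. Shifting the component of \<open>g\<close> by \<open>i\<close> only re-indexes
  it, hence the argument \<open>n + i\<close>.\<close>

definition summand :: "int \<Rightarrow> int \<Rightarrow> int \<Rightarrow> 'a \<Rightarrow> 'a" where
  "summand m i n = compose (carrier (cgrp X n)) (g (m - i) (n + i)) (f i n)"

lemma g_hom: "g (m - i) (n + i) \<in> hom (cgrp Y (n + i)) (cgrp Z (n + m))"
  using YZ.MorD(1)[OF g, of "m - i" "n + i"] by simp

text \<open>Passing the differential through \<open>f\<close> and then \<open>g\<close> produces the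
  signs (-1)^i and (-1)^(m-i), whose product is the sign (-1)^m required of a map into the shift by
  \<open>m\<close>.\<close>

lemma summand_closed: "summand m i \<in> carrier (chain_map_group X (shift_complex m Z))"
  unfolding chain_map_to_shift_iff[OF YZ.Y.bounded]
proof (intro allI conjI ballI)
  fix n
  show "summand m i n \<in> group_homs (cgrp X n) (cgrp Z (n + m))"
    using hom_compose[OF XY.MorD(1)[OF f, of i n] g_hom[of m i n]]
    by (auto simp: group_homs_def summand_def compose_def hom_def Pi_iff)
  fix x assume x: "x \<in> carrier (cgrp X n)"
  have dx: "cdif X n x \<in> carrier (cgrp X (n + 1))" using XY.X.d.hom_closed[OF x] .
  have fx: "f i n x \<in> carrier (cgrp Y (n + i))" using hom_in_carrier[OF XY.MorD(1)[OF f] x] .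
  have dfx: "cdif Y (n + i) (f i n x) \<in> carrier (cgrp Y (n + i + 1))" using XY.Y.d.hom_closed[OF fx] .
  have gfx: "g (m - i) (n + i) (f i n x) \<in> carrier (cgrp Z (n + m))" using hom_in_carrier[OF g_hom fx] .
  have dgfx: "cdif Z (n + m) (g (m - i) (n + i) (f i n x)) \<in> carrier (cgrp Z (n + m + 1))"
    using YZ.Y.d.hom_closed[OF gfx] .
  have ix: "n + 1 + i = n + i + 1" "n + 1 + m = n + m + 1" "n + i + (m - i) = n + m" by auto
  interpret G: group_hom "cgrp Y (n + i + 1)" "cgrp Z (n + m + 1)" "g (m - i) (n + i + 1)"
    using g_hom[of m i "n + 1"]
    by (simp only: ix) (simp add: group_hom_def group_hom_axioms_def XY.Y.G.group_axioms YZ.Y.G.group_axioms)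
  have "g (m - i) (n + i + 1) (f i (n + 1) (cdif X n x)) =
      g (m - i) (n + i + 1) (signed (cgrp Y (n + i + 1)) i (cdif Y (n + i) (f i n x)))"
    by (simp only: XY.MorD(3)[OF f x])
  also have "\<dots> = signed (cgrp Z (n + m + 1)) i (g (m - i) (n + i + 1) (cdif Y (n + i) (f i n x)))"
    by (rule G.hom_signed[OF dfx])
  also have "g (m - i) (n + i + 1) (cdif Y (n + i) (f i n x)) =
      signed (cgrp Z (n + m + 1)) (m - i) (cdif Z (n + m) (g (m - i) (n + i) (f i n x)))"
    using YZ.MorD(3)[OF g fx, of "m - i"] by (simp only: ix)
  also have "signed (cgrp Z (n + m + 1)) i \<dots> =
      signed (cgrp Z (n + m + 1)) m (cdif Z (n + m) (g (m - i) (n + i) (f i n x)))"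
    using YZ.Y.G.signed_signed[OF dgfx, of i "m - i"] by simp
  finally show "summand m i (n + 1) (cdif X n x) =
      signed (cgrp Z (n + m + 1)) m (cdif Z (n + m) (summand m i n x))"
    using x dx by (simp only: summand_def compose_def restrict_apply' ix)
qed

lemma Comp_eq: "Comp complex_orbit_category X Y Z g f m =
    gfinprod (chain_map_group X (shift_complex m Z)) (summand m) UNIV"
  by (simp add: complex_orbit_simps summand_def[abs_def])

lemma Comp_in_Mor: "Comp complex_orbit_category X Y Z g f \<in> Mor complex_orbit_category X Z"
  unfolding XZ.Mor_iff Comp_eq
  using summand_closed by (auto intro!: comm_monoid.gfinprod_closed comm_group.axioms(1) XZ.chain_map_comm_group)

lemma summand_one:
  assumes "f i = \<one>\<^bsub>chain_map_group X (shift_complex i Y)\<^esub>"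
  shows "summand m i = \<one>\<^bsub>chain_map_group X (shift_complex m Z)\<^esub>"
proof -
  have "g (m - i) (n + i) \<one>\<^bsub>cgrp Y (n + i)\<^esub> = \<one>\<^bsub>cgrp Z (n + m)\<^esub>" for n
    using hom_one[OF g_hom] XY.Y.G.group_axioms YZ.Y.G.group_axioms by blast
  then show ?thesis
    using assms by (auto simp: summand_def chain_map_group_def shift_complex_def compose_def fun_eq_iff)
qed

text \<open>The sum over all shifts is first cut down to the finite support of \<open>f\<close>;
  evaluation at \<open>x\<close> is a homomorphism on chain maps and then passes inside the finite
  sum.\<close>

lemma Comp_apply:
  assumes x: "x \<in> carrier (cgrp X n)"
  shows "Comp complex_orbit_category X Y Z g f m n x =
    finprod (cgrp Z (n + m)) (\<lambda>i. summand m i n x) {i. f i \<noteq> \<one>\<^bsub>chain_map_group X (shift_complex i Y)\<^esub>}"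
proof -
  let ?H = "chain_map_group X (shift_complex m Z)"
  let ?S = "{i. f i \<noteq> \<one>\<^bsub>chain_map_group X (shift_complex i Y)\<^esub>}"
  interpret H: comm_group ?H by (rule XZ.chain_map_comm_group)
  have fin: "finite ?S" using f unfolding XY.Mor_iff by (intro XY.chain_maps_finite_support) auto
  have c: "h n x \<in> carrier (cgrp Z (n + m))" if "h \<in> carrier ?H" for h
    using that x unfolding chain_map_to_shift_iff[OF YZ.Y.bounded]
    by (auto simp: group_homs_def dest: hom_in_carrier)
  have one: "\<one>\<^bsub>?H\<^esub> n x = \<one>\<^bsub>cgrp Z (n + m)\<^esub>"
    and mult: "(a \<otimes>\<^bsub>?H\<^esub> b) n x = a n x \<otimes>\<^bsub>cgrp Z (n + m)\<^esub> b n x" for a b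
    using x by (simp_all add: chain_map_group_def shift_complex_def)
  have "gfinprod ?H (summand m) UNIV = gfinprod ?H (summand m) ?S"
    by (rule H.gfinprod_mono_neutral_cong_right) (use summand_one summand_closed in auto)
  also have "\<dots> = finprod ?H (summand m) ?S"
    by (rule H.gfinprod_eq_finprod[OF fin]) (use summand_closed in auto)
  finally have "Comp complex_orbit_category X Y Z g f m = finprod ?H (summand m) ?S"
    by (simp only: Comp_eq)
  moreover have "finprod ?H (summand m) S n x = finprod (cgrp Z (n + m)) (\<lambda>i. summand m i n x) S"
    if "finite S" for S
    using that
  proof (induction S rule: finite_induct)
    case empty
    show ?case by (simp add: one)
  next
    case (insert i S)
    have "finprod ?H (summand m) (insert i S) = summand m i \<otimes>\<^bsub>?H\<^esub> finprod ?H (summand m) S"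
      by (rule H.finprod_insert) (use insert summand_closed in auto)
    moreover have "finprod (cgrp Z (n + m)) (\<lambda>i. summand m i n x) (insert i S) =
        summand m i n x \<otimes>\<^bsub>cgrp Z (n + m)\<^esub> finprod (cgrp Z (n + m)) (\<lambda>i. summand m i n x) S"
      by (rule YZ.Y.G.finprod_insert) (use insert c summand_closed in auto)
    ultimately show ?case
      using insert.IH by (simp add: mult)
  qed
  ultimately show ?thesis using fin by simp
qed

text \<open>This is matrix multiplication, with intermediate degree k = n + i. Both sides are
  linear, so homogeneous elements suffice.\<close>

lemma total_map_Comp:
  "XZ.total_map (Comp complex_orbit_category X Y Z g f) =
    compose (carrier XY.X.total) (YZ.total_map g) (XY.total_map f)"
proof (rule XZ.total_homs_eqI)
  show "XZ.total_map (Comp complex_orbit_category X Y Z g f) \<in> XZ.total_homs"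
    by (rule XZ.total_map_in_total_homs[OF Comp_in_Mor])
  have "module dual_integers (dual_module XY.X.total XY.X.total_dif)"
    by (rule module_dual_module[OF XY.X.total_differential_group])
  then show "compose (carrier XY.X.total) (YZ.total_map g) (XY.total_map f) \<in> XZ.total_homs"
    using compose_in_module_homs XY.total_map_in_total_homs[OF f] YZ.total_map_in_total_homs[OF g]
    unfolding XZ.total_homs_eq_module_homs XY.total_homs_eq_module_homs YZ.total_homs_eq_module_homs
    by fastforce
  fix n x assume x: "x \<in> carrier (cgrp X n)"
  show "XZ.total_map (Comp complex_orbit_category X Y Z g f) (XY.X.gen n x) =
      compose (carrier XY.X.total) (YZ.total_map g) (XY.total_map f) (XY.X.gen n x)"
  proof
    fix m
    let ?p = "m - n"
    let ?S = "{i. f i \<noteq> \<one>\<^bsub>chain_map_group X (shift_complex i Y)\<^esub>}"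
    let ?T = "(\<lambda>k. k - n) ` XY.Y.supp"
    let ?h = "\<lambda>i. g (?p - i) (n + i) (f i n x)"
    have fin: "finite ?S" using f unfolding XY.Mor_iff by (intro XY.chain_maps_finite_support) auto
    have fx: "f i n x \<in> carrier (cgrp Y (n + i))" for i using hom_in_carrier[OF XY.MorD(1)[OF f] x] .
    have hc: "?h i \<in> carrier (cgrp Z m)" for i using hom_in_carrier[OF g_hom[of ?p i n] fx[of i]] by simp
    have g1: "g (?p - i) (n + i) \<one>\<^bsub>cgrp Y (n + i)\<^esub> = \<one>\<^bsub>cgrp Z m\<^esub>" for i
      using hom_one[OF g_hom[of ?p i n]] XY.Y.G.group_axioms YZ.Y.G.group_axioms by simp
    have Tx: "XY.total_map f (XY.X.gen n x) = (\<lambda>k. f (k - n) n x)"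
      using XY.total_map_gen[OF f x] by auto
    have Txc: "XY.total_map f (XY.X.gen n x) \<in> carrier XY.Y.total"
      by (rule hom_in_carrier[OF XY.total_map_hom[OF f] XY.X.gen_closed[OF x]])
    have "XZ.total_map (Comp complex_orbit_category X Y Z g f) (XY.X.gen n x) m =
        finprod (cgrp Z (n + ?p)) (\<lambda>i. summand ?p i n x) ?S"
      by (simp only: XZ.total_map_gen[OF Comp_in_Mor x] Comp_apply[OF x])
    also have "\<dots> = finprod (cgrp Z m) ?h ?S"
      using x by (simp add: summand_def compose_def)
    \<comment> \<open>The composite sums over the shifts where \<open>f\<close> is nonzero, the
      matrix product over those that reach the support of \<open>Y\<close>. A term belonging to only
      one of the two sets is trivial, because \<open>f i\<close> or the group in degree
      \<open>n + i\<close> is.\<close>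
    also have "\<dots> = finprod (cgrp Z m) ?h ?T"
    proof (rule YZ.Y.G.finprod_mono_neutral_cong)
      show "?h i = \<one>\<^bsub>cgrp Z m\<^esub>" if "i \<in> ?T - ?S" for i
        using that x g1 by (auto simp: chain_map_group_def shift_complex_def)
      show "?h i = \<one>\<^bsub>cgrp Z m\<^esub>" if "i \<in> ?S - ?T" for i
      proof -
        have "n + i \<notin> XY.Y.supp" using that by (force intro: image_eqI[of _ _ "n + i"])
        then show ?thesis using XY.Y.trivial[OF _ fx] g1 by simp
      qed
    qed (use fin hc XY.Y.finite_supp in auto)
    also have "\<dots> = finprod (cgrp Z m) (\<lambda>k. ?h (k - n)) XY.Y.supp"
      by (rule YZ.Y.G.finprod_reindex) (use hc in \<open>auto simp: inj_on_def\<close>)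
    also have "\<dots> = finprod (cgrp Z m) (\<lambda>k. g (m - k) k (f (k - n) n x)) XY.Y.supp"
      by simp
    also have "\<dots> = YZ.total_map g (XY.total_map f (XY.X.gen n x)) m"
      using Txc by (simp add: YZ.total_map_def Tx)
    also have "\<dots> = compose (carrier XY.X.total) (YZ.total_map g) (XY.total_map f) (XY.X.gen n x) m"
      using XY.X.gen_closed[OF x] by (simp add: compose_def del: XY.X.total_carrier)
    finally show "XZ.total_map (Comp complex_orbit_category X Y Z g f) (XY.X.gen n x) m =
        compose (carrier XY.X.total) (YZ.total_map g) (XY.total_map f) (XY.X.gen n x) m" .
  qed
qed

end

end

lemma two_complexesI:
  "\<lbrakk>X \<in> bounded_free_complexes; Y \<in> bounded_free_complexes\<rbrakk> \<Longrightarrow> two_complexes X Y"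
  by (simp add: two_complexes_def bounded_complex_def)

lemma three_complexesI:
  "\<lbrakk>X \<in> bounded_free_complexes; Y \<in> bounded_free_complexes; Z \<in> bounded_free_complexes\<rbrakk>
    \<Longrightarrow> three_complexes X Y Z"
  by (simp add: three_complexes_def two_complexesI)

definition total_module :: "'a cochain_complex \<Rightarrow> ((nat \<Rightarrow> int) set, int \<Rightarrow> 'a) module" where
  "total_module X = dual_module (bounded_complex.total X) (bounded_complex.total_dif X)"

lemma Ident_complex_orbit_category:
  assumes "X \<in> bounded_free_complexes"
  shows "Ident complex_orbit_category X \<in> Mor complex_orbit_category X X"
    "two_complexes.total_map X X (Ident complex_orbit_category X) =
      (\<lambda>x \<in> carrier (bounded_complex.total X). x)"
proof -
  interpret two_complexes X X using assms by (simp add: two_complexesI)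
  have one: "\<one>\<^bsub>chain_map_group X (shift_complex i X)\<^esub> \<in> carrier (chain_map_group X (shift_complex i X))" for i
    using chain_map_comm_group[of i] by (simp add: comm_group_def group_def monoid.one_closed)
  have "(\<lambda>n. \<lambda>x \<in> carrier (cgrp X n). x) \<in> carrier (chain_map_group X (shift_complex 0 X))"
    unfolding chain_map_to_shift_iff[OF X.bounded]
    by (auto simp: group_homs_def hom_def signed_def X.d.hom_closed[simplified])
  then show I: "Ident complex_orbit_category X \<in> Mor complex_orbit_category X X"
    unfolding Mor_iff using one by (simp add: complex_orbit_simps)
  show "total_map (Ident complex_orbit_category X) = (\<lambda>x \<in> carrier X.total. x)"
  proof (rule total_homs_eqI[OF total_map_in_total_homs[OF I]])
    show "(\<lambda>x \<in> carrier X.total. x) \<in> total_homs"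
      unfolding total_homs_eq_module_homs
      using id_in_module_homs[OF module_dual_module[OF X.total_differential_group]] by simp
    fix n x assume x: "x \<in> carrier (cgrp X n)"
    have "total_map (Ident complex_orbit_category X) (X.gen n x) m = X.gen n x m" for m
      unfolding total_map_gen[OF I x] using x
      by (simp add: complex_orbit_simps X.gen_def chain_map_group_def shift_complex_def)
    then show "total_map (Ident complex_orbit_category X) (X.gen n x) = (\<lambda>x \<in> carrier X.total. x) (X.gen n x)"
      using X.gen_closed[OF x] by (auto simp del: X.total_carrier)
  qed
qed

lemma total_module_fully_faithful:
  "fully_faithful complex_orbit_category (sub_category dual_integers) total_module two_complexes.total_map"
proof (intro fully_faithful.intro category_sub_category fully_faithful_axioms.intro; unfold complex_orbit_simps(1))
  fix X :: "'a cochain_complex" assume X: "X \<in> bounded_free_complexes"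
  interpret bounded_complex X by (rule bounded_complex.intro[OF X])
  show "total_module X \<in> Obj (sub_category dual_integers)"
    by (simp add: Obj_sub_category total_module_def module_dual_module total_differential_group total_free)
  show "Ident complex_orbit_category X \<in> Mor complex_orbit_category X X"
    using X by (rule Ident_complex_orbit_category)
  show "two_complexes.total_map X X (Ident complex_orbit_category X) = Ident (sub_category dual_integers) (total_module X)"
    using Ident_complex_orbit_category[OF X] by (simp add: total_module_def)
next
  fix X Y :: "'a cochain_complex" assume "X \<in> bounded_free_complexes" "Y \<in> bounded_free_complexes"
  then interpret two_complexes X Y by (rule two_complexesI)
  show "bij_betw (two_complexes.total_map X Y) (Mor complex_orbit_category X Y)
      (Mor (sub_category dual_integers) (total_module X) (total_module Y))"
    using bij_betw_total_map by (simp add: total_module_def total_homs_eq_module_homs)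
next
  fix X Y Z :: "'a cochain_complex" and f g
  assume "X \<in> bounded_free_complexes" "Y \<in> bounded_free_complexes" "Z \<in> bounded_free_complexes"
    and f: "f \<in> Mor complex_orbit_category X Y" and g: "g \<in> Mor complex_orbit_category Y Z"
  then interpret three_complexes X Y Z by (simp add: three_complexesI)
  show "Comp complex_orbit_category X Y Z g f \<in> Mor complex_orbit_category X Z"
    using f g by (rule Comp_in_Mor)
  show "XZ.total_map (Comp complex_orbit_category X Y Z g f) =
      Comp (sub_category dual_integers) (total_module X) (total_module Y) (total_module Z)
        (YZ.total_map g) (XY.total_map f)"
    using total_map_Comp[OF f g] by (simp add: total_module_def)
qed

section \<open>The equivalences\<close>

lemma fg_free_singleton_group: "fg_free_abelian_group (singleton_group a)"
  by (rule fg_free_if_coordinates[of "{}"])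
    (auto simp: singleton_group_def intro!: comm_groupI)

text \<open>Outside degrees 0 and 1 the group is trivial with \<open>undefined\<close> as its unit,
  so a map constantly \<open>undefined\<close> is a zero map there. The zero map out of degree -1
  ends in \<open>A\<close> and needs the unit of \<open>A\<close> instead.\<close>

lemma two_term_complex:
  assumes A: "fg_free_abelian_group (A :: 'a monoid)" and B: "fg_free_abelian_group B"
    and d: "d \<in> group_homs A B"
  defines "X \<equiv> \<lparr>cgrp = (\<lambda>n. if n = 0 then A else if n = 1 then B else singleton_group undefined),
    cdif = (\<lambda>n. if n = 0 then d else (\<lambda>x \<in> carrier (if n = 1 then B else singleton_group undefined).
      if n = - 1 then \<one>\<^bsub>A\<^esub> else undefined))\<rparr>"
  shows "X \<in> bounded_free_complexes"
proof -
  interpret A: comm_group A using A by (simp add: fg_free_abelian_group_def)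
  interpret B: comm_group B using B by (simp add: fg_free_abelian_group_def)
  interpret d: group_hom A B d
    using d by (simp add: group_homs_def group_hom_if_hom A.comm_group_axioms B.comm_group_axioms)
  have "fg_free_abelian_group (cgrp X n)" for n
    using A B by (simp add: X_def fg_free_singleton_group)
  moreover have "cdif X n \<in> group_homs (cgrp X n) (cgrp X (n + 1))" for n
    using d by (auto simp: X_def group_homs_def hom_def singleton_group_def)
  moreover have "cdif X (n + 1) (cdif X n x) = \<one>\<^bsub>cgrp X (n + 2)\<^esub>" if "x \<in> carrier (cgrp X n)" for n x
    using that by (auto simp: X_def singleton_group_def)
  moreover have "finite {n. carrier (cgrp X n) \<noteq> {\<one>\<^bsub>cgrp X n\<^esub>}}"
    by (rule finite_subset[of _ "{0, 1}"]) (auto simp: X_def singleton_group_def)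
  ultimately show ?thesis by (simp add: bounded_free_complexes_def)
qed

text \<open>
  Since the image of \<open>\<epsilon>\<close> is free, \<open>\<epsilon>\<close> has a section over it, and \<open>M\<close> is the total module of the
  inclusion of the image of \<open>\<epsilon>\<close> into the kernel of \<open>\<epsilon>\<close>, placed in degrees 0 and 1.
\<close>

lemma total_module_essentially_surjective:
  fixes M :: "((nat \<Rightarrow> int) set, 'b) module"
  assumes inf: "infinite (UNIV :: 'a set)" and M: "module dual_integers M"
    and free: "fg_free_abelian_group (additive_group M)"
  obtains X :: "'a cochain_complex"
  where "X \<in> bounded_free_complexes" "isomorphic_modules dual_integers (total_module X) M"
proof -
  interpret M: dual_integers_module M using M by (simp add: dual_integers_module_def)
  let ?G = "additive_group M"
  interpret e: group_hom ?G ?G "eps M"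
    using M.differential_group by (simp add: differential_group_def group_hom_if_hom)
  define K where "K = kernel ?G ?G (eps M)"
  define I where "I = eps M ` carrier M"
  have K: "x \<in> K \<longleftrightarrow> x \<in> carrier M \<and> eps M x = \<zero>\<^bsub>M\<^esub>" for x by (auto simp: K_def kernel_def)
  have IK: "I \<subseteq> K" by (auto simp: I_def K)
  have sK: "subgroup K ?G" unfolding K_def by (rule e.subgroup_kernel)
  have sI: "subgroup I ?G" unfolding I_def using e.img_is_subgroup by simp
  let ?I = "?G\<lparr>carrier := I\<rparr>" and ?K = "?G\<lparr>carrier := K\<rparr>"
  have fI: "fg_free_abelian_group ?I" by (rule fg_free_subgroup[OF free sI])
  have fK: "fg_free_abelian_group ?K" by (rule fg_free_subgroup[OF free sK])
  have eI: "eps M \<in> hom ?G ?I" using e.homh by (auto simp: hom_def I_def)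
  have idI: "(\<lambda>x. x) \<in> hom ?I ?I" using fI
    by (auto simp: hom_def fg_free_abelian_group_def comm_group_def comm_monoid_def group_def monoid.m_closed)
  have "comm_group ?I" using fI by (simp add: fg_free_abelian_group_def)
  then obtain s where s: "s \<in> hom ?I ?G" and es: "\<And>y. y \<in> I \<Longrightarrow> eps M (s y) = y"
    using fg_free_projective[OF fI M.comm_group_add _ eI _ idI] by (auto simp: I_def)
  \<comment> \<open>Copies of the image and the kernel of \<open>eps M\<close> whose carriers lie in
    \<open>'a\<close>, the type used by the complexes.\<close>
  obtain A :: "'a monoid" and \<beta> \<beta>' where A: "comm_group A" and \<beta>: "group_isomorphisms ?I A \<beta> \<beta>'"
    using group_isomorphisms_transport[OF fI inf] by metis
  obtain B :: "'a monoid" and \<gamma> \<gamma>' where B: "comm_group B" and \<gamma>: "group_isomorphisms ?K B \<gamma> \<gamma>'"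
    using group_isomorphisms_transport[OF fK inf] by metis
  have \<beta>h: "\<beta> \<in> hom ?I A" "\<beta>' \<in> hom A ?I" and \<gamma>h: "\<gamma> \<in> hom ?K B" "\<gamma>' \<in> hom B ?K"
    using \<beta> \<gamma> by (auto simp: group_isomorphisms_def)
  have fA: "fg_free_abelian_group A" using fI A group_isomorphisms_imp_iso[OF \<beta>] by (rule fg_free_iso)
  have fB: "fg_free_abelian_group B" using fK B group_isomorphisms_imp_iso[OF \<gamma>] by (rule fg_free_iso)
  have \<beta>c: "\<beta> y \<in> carrier A" "\<beta>' (\<beta> y) = y" if "y \<in> I" for y
    using \<beta> that by (auto simp: group_isomorphisms_def hom_def)
  have \<beta>'c: "\<beta>' a \<in> I" "\<beta> (\<beta>' a) = a" if "a \<in> carrier A" for a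
    using \<beta> that by (auto simp: group_isomorphisms_def hom_def)
  have \<gamma>c: "\<gamma> y \<in> carrier B" "\<gamma>' (\<gamma> y) = y" if "y \<in> K" for y
    using \<gamma> that by (auto simp: group_isomorphisms_def hom_def)
  have \<gamma>'c: "\<gamma>' b \<in> K" "\<gamma> (\<gamma>' b) = b" if "b \<in> carrier B" for b
    using \<gamma> that by (auto simp: group_isomorphisms_def hom_def)
  have sc: "s y \<in> carrier M" if "y \<in> I" for y using hom_in_carrier[OF s] that by simp
  have sI0: "\<zero>\<^bsub>M\<^esub> \<in> I" "\<zero>\<^bsub>M\<^esub> \<in> K" using subgroup.one_closed[OF sI] subgroup.one_closed[OF sK] by simp_all
  have gI: "group ?I" and gK: "group ?K" and gA: "group A" and gB: "group B" and gG: "group ?G"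
    using fI fK A B M.comm_group_add by (simp_all add: fg_free_abelian_group_def comm_group_imp_group)
  have \<beta>'1: "\<beta>' \<one>\<^bsub>A\<^esub> = \<zero>\<^bsub>M\<^esub>" using hom_one[OF \<beta>h(2) gA gI] by simp
  have s1: "s \<zero>\<^bsub>M\<^esub> = \<zero>\<^bsub>M\<^esub>" using hom_one[OF s gI gG] by simp
  have \<gamma>1: "\<gamma> \<zero>\<^bsub>M\<^esub> = \<one>\<^bsub>B\<^esub>" using hom_one[OF \<gamma>h(1) gK gB] by simp
  have \<beta>1: "\<beta> \<zero>\<^bsub>M\<^esub> = \<one>\<^bsub>A\<^esub>" using hom_one[OF \<beta>h(1) gI gA] by simp
  \<comment> \<open>The inclusion of the image into the kernel, read through the two copies.\<close>
  define d where "d = (\<lambda>a \<in> carrier A. \<gamma> (\<beta>' a))"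
  have "d \<in> hom A B"
  proof (rule homI)
    show "d a \<in> carrier B" if "a \<in> carrier A" for a
      using that \<beta>'c(1)[OF that] IK \<gamma>c(1) by (auto simp: d_def)
    show "d (a \<otimes>\<^bsub>A\<^esub> b) = d a \<otimes>\<^bsub>B\<^esub> d b" if a: "a \<in> carrier A" and b: "b \<in> carrier A" for a b
    proof -
      have "\<beta>' a \<in> K" "\<beta>' b \<in> K" using \<beta>'c(1) IK a b by auto
      then show ?thesis
        using a b hom_mult[OF \<beta>h(2) a b] hom_mult[OF \<gamma>h(1), of "\<beta>' a" "\<beta>' b"] gA
        by (simp add: d_def group_def monoid.m_closed)
    qed
  qed
  then have d: "d \<in> group_homs A B" by (simp add: group_homs_def d_def)
  define X where "X = \<lparr>cgrp = (\<lambda>n. if n = 0 then A else if n = 1 then B else singleton_group undefined),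
    cdif = (\<lambda>n :: int. if n = 0 then d else (\<lambda>x \<in> carrier (if n = 1 then B else singleton_group undefined).
      if n = - 1 then \<one>\<^bsub>A\<^esub> else undefined))\<rparr>"
  have X: "X \<in> bounded_free_complexes" unfolding X_def by (rule two_term_complex[OF fA fB d])
  interpret X: bounded_complex X by (rule bounded_complex.intro[OF X])
  have cg: "cgrp X 0 = A" "cgrp X 1 = B" "\<And>n. n \<noteq> 0 \<Longrightarrow> n \<noteq> 1 \<Longrightarrow> cgrp X n = singleton_group undefined"
    by (simp_all add: X_def)
  have x01: "x 0 \<in> carrier A" "x 1 \<in> carrier B" if "x \<in> carrier X.total" for x
    using that cg(1,2) unfolding X.total_carrier by metis+
  have dif0: "X.total_dif x 0 = \<one>\<^bsub>A\<^esub>" if "x \<in> carrier X.total" for x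
  proof -
    have "x (- 1) \<in> carrier (singleton_group undefined)"
      using that cg(3)[of "- 1"] unfolding X.total_carrier by (metis one_neq_neg_one zero_neq_neg_one)
    then have "cdif X (- 1) (x (- 1)) = \<one>\<^bsub>A\<^esub>" by (simp add: X_def)
    then show ?thesis
      using monoid.inv_one[OF group.is_monoid[OF gA]] by (simp add: X.total_dif_def signed_def cg)
  qed
  \<comment> \<open>The source degree is 0, so the differential enters without a sign.\<close>
  have dif1: "X.total_dif x 1 = d (x 0)" for x
    by (simp add: X.total_dif_def signed_def) (simp add: X_def)
  let ?T = "dual_module X.total X.total_dif"
  interpret T: dual_integers_module ?T
    by (rule dual_integers_module_dual_module[OF X.total_differential_group])
  \<comment> \<open>\<open>M\<close> is the direct sum of \<open>s\<close> applied to the image,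
    carried by degree 0, and the kernel, carried by degree 1.\<close>
  define \<psi> where "\<psi> = (\<lambda>x \<in> carrier X.total. s (\<beta>' (x 0)) \<oplus>\<^bsub>M\<^esub> \<gamma>' (x 1))"
  have c: "s (\<beta>' a) \<in> carrier M" if "a \<in> carrier A" for a using sc \<beta>'c(1) that by blast
  have c': "\<gamma>' b \<in> carrier M" "eps M (\<gamma>' b) = \<zero>\<^bsub>M\<^esub>" if "b \<in> carrier B" for b
    using \<gamma>'c(1)[OF that] by (auto simp: K)
  have \<psi>hom: "\<psi> \<in> hom X.total ?G"
  proof (rule homI)
    show "\<psi> x \<in> carrier ?G" if "x \<in> carrier X.total" for x
      using that c[OF x01(1)[OF that]] c'(1)[OF x01(2)[OF that]] by (simp add: \<psi>_def del: X.total_carrier)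
    show "\<psi> (x \<otimes>\<^bsub>X.total\<^esub> y) = \<psi> x \<otimes>\<^bsub>?G\<^esub> \<psi> y"
      if x: "x \<in> carrier X.total" and y: "y \<in> carrier X.total" for x y
    proof -
      have "s (\<beta>' (x 0 \<otimes>\<^bsub>A\<^esub> y 0)) = s (\<beta>' (x 0)) \<oplus>\<^bsub>M\<^esub> s (\<beta>' (y 0))"
        using hom_mult[OF \<beta>h(2) x01(1)[OF x] x01(1)[OF y]]
          hom_mult[OF s, of "\<beta>' (x 0)" "\<beta>' (y 0)"] \<beta>'c(1) x01(1)[OF x] x01(1)[OF y] by simp
      moreover have "\<gamma>' (x 1 \<otimes>\<^bsub>B\<^esub> y 1) = \<gamma>' (x 1) \<oplus>\<^bsub>M\<^esub> \<gamma>' (y 1)"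
        using hom_mult[OF \<gamma>h(2) x01(2)[OF x] x01(2)[OF y]] by simp
      moreover have "x \<otimes>\<^bsub>X.total\<^esub> y \<in> carrier X.total" using x y by (rule X.total.m_closed)
      ultimately show ?thesis
        using x y c[OF x01(1)[OF x]] c[OF x01(1)[OF y]] c'(1)[OF x01(2)[OF x]] c'(1)[OF x01(2)[OF y]]
        by (simp add: \<psi>_def cg M.a_ac del: X.total_carrier)
    qed
  qed
  \<comment> \<open>\<open>eps M\<close> kills the kernel summand and undoes the section. This one
    formula serves both linearity and injectivity of \<open>\<psi>\<close>.\<close>
  have e\<psi>: "eps M (\<psi> x) = \<beta>' (x 0)" if x: "x \<in> carrier X.total" for x
  proof -
    have "\<beta>' (x 0) \<in> carrier M" using \<beta>'c(1)[OF x01(1)[OF x]] IK K by auto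
    then show ?thesis
      using x c[OF x01(1)[OF x]] c'[OF x01(2)[OF x]] es[OF \<beta>'c(1)[OF x01(1)[OF x]]]
      by (simp add: \<psi>_def M.eps_add del: X.total_carrier)
  qed
  have \<psi>e: "\<psi> (X.total_dif x) = eps M (\<psi> x)" if x: "x \<in> carrier X.total" for x
  proof -
    have I: "\<beta>' (x 0) \<in> I" by (rule \<beta>'c(1)[OF x01(1)[OF x]])
    have "\<gamma>' (d (x 0)) = \<beta>' (x 0)" using x01(1)[OF x] \<gamma>c(2) I IK by (auto simp: d_def)
    moreover have "\<beta>' (x 0) \<in> carrier M" using I IK K by auto
    ultimately show ?thesis
      using hom_in_carrier[OF X.total_dif_hom x] unfolding e\<psi>[OF x]
      by (simp add: \<psi>_def dif0[OF x] dif1 \<beta>'1 s1 del: X.total_carrier)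
  qed
  have "\<psi> \<in> module_homs dual_integers ?T M"
    unfolding module_homs_dual_integers[OF T.dual_integers_module_axioms M.dual_integers_module_axioms]
    using \<psi>hom \<psi>e by (auto simp: eps_dual_module[OF X.total_differential_group] simp del: X.total_carrier)
      (simp add: \<psi>_def)
  moreover have "bij_betw \<psi> (carrier X.total) (carrier M)"
    unfolding bij_betw_def
  proof
    interpret \<psi>: group_hom X.total ?G \<psi>
      using \<psi>hom by (simp add: group_hom_if_hom X.total.comm_group_axioms M.comm_group_add)
    show "inj_on \<psi> (carrier X.total)"
      unfolding \<psi>.inj_on_one_iff
    proof (intro allI impI)
      fix x assume x: "x \<in> carrier X.total" and "\<psi> x = \<one>\<^bsub>?G\<^esub>"
      then have 0: "\<psi> x = \<zero>\<^bsub>M\<^esub>" by simp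
      have "\<beta>' (x 0) = \<zero>\<^bsub>M\<^esub>" using e\<psi>[OF x] 0 by (simp add: eps_def)
      then have x0: "x 0 = \<one>\<^bsub>A\<^esub>" using \<beta>'c(2)[OF x01(1)[OF x]] \<beta>1 by simp
      then have "\<gamma>' (x 1) = \<zero>\<^bsub>M\<^esub>"
        using 0 x c'(1)[OF x01(2)[OF x]] by (simp add: \<psi>_def \<beta>'1 s1 del: X.total_carrier)
      then have x1: "x 1 = \<one>\<^bsub>B\<^esub>" using \<gamma>'c(2)[OF x01(2)[OF x]] \<gamma>1 by simp
      have "x n = \<one>\<^bsub>cgrp X n\<^esub>" for n
      proof (cases "n = 0 \<or> n = 1")
        case False
        moreover have "x n \<in> carrier (cgrp X n)" using x by simp
        ultimately show ?thesis using cg(3)[of n] by (simp add: singleton_group_def)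
      qed (use x0 x1 cg in auto)
      then show "x = \<one>\<^bsub>X.total\<^esub>" by auto
    qed
    have "z \<in> \<psi> ` carrier X.total" if z: "z \<in> carrier M" for z
    proof -
      let ?y = "eps M z"
      \<comment> \<open>Subtracting \<open>s (eps M z)\<close> leaves an element killed by
        \<open>eps M\<close>, since \<open>s\<close> is a section.\<close>
      let ?k = "z \<oplus>\<^bsub>M\<^esub> inv\<^bsub>?G\<^esub> s ?y"
      have y: "?y \<in> I" using z by (simp add: I_def)
      have sy: "s ?y \<in> carrier M" by (rule sc[OF y])
      have isy: "inv\<^bsub>?G\<^esub> s ?y \<in> carrier M" using sy by simp
      have "eps M (inv\<^bsub>?G\<^esub> s ?y) = inv\<^bsub>?G\<^esub> ?y"
        using e.hom_inv[of "s ?y"] sy es[OF y] by simp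
      then have k: "?k \<in> K" using z isy M.A.r_inv[of ?y] by (simp add: K M.eps_add)
      \<comment> \<open>In the remaining degrees \<open>undefined\<close> is the only element of the
        group.\<close>
      define x where "x n = (if n = 0 then \<beta> ?y else if n = 1 then \<gamma> ?k else undefined)" for n :: int
      have x: "x \<in> carrier X.total"
        unfolding X.total_carrier
        using \<beta>c(1)[OF y] \<gamma>c(1)[OF k] by (auto simp: x_def X_def singleton_group_def)
      have "\<psi> x = s ?y \<oplus>\<^bsub>M\<^esub> ?k"
        using x \<beta>c(2)[OF y] \<gamma>c(2)[OF k] by (simp add: \<psi>_def x_def del: X.total_carrier)
      also have "\<dots> = z \<oplus>\<^bsub>M\<^esub> (s ?y \<oplus>\<^bsub>M\<^esub> inv\<^bsub>?G\<^esub> s ?y)" using z sy isy by (simp add: M.a_ac)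
      also have "\<dots> = z" using z sy M.A.r_inv[of "s ?y"] by simp
      finally show ?thesis using x by (metis image_eqI)
    qed
    then show "\<psi> ` carrier X.total = carrier M" using \<psi>.hom_closed by auto
  qed
  ultimately have "isomorphic_modules dual_integers (total_module X) M"
    by (auto simp: isomorphic_modules_def total_module_def simp del: X.total_carrier)
  with X show ?thesis by (rule that)
qed

text \<open>An infinite type contains a copy of every finitely generated free abelian group, so
  fixing the carrier types loses no isomorphism class of complexes or of torsionless
  modules.\<close>

theorem theorem2p3p4:
  assumes "infinite (UNIV :: 'a set)" and "infinite (UNIV :: 'b set)"
  shows "equivalent_categories
      (complex_orbit_category :: ('a cochain_complex, int \<Rightarrow> int \<Rightarrow> 'a \<Rightarrow> 'a) category)
      (sub_category dual_integers :: (((nat \<Rightarrow> int) set, 'b) module, 'b \<Rightarrow> 'b) category) \<and>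
    equivalent_categories
      (sub_category dual_integers :: (((nat \<Rightarrow> int) set, 'b) module, 'b \<Rightarrow> 'b) category)
      (Gproj_category dual_integers :: (((nat \<Rightarrow> int) set, 'b) module, 'b \<Rightarrow> 'b) category)"
proof
  let ?T = "sub_category dual_integers :: (((nat \<Rightarrow> int) set, 'b) module, 'b \<Rightarrow> 'b) category"
  \<comment> \<open>The total module functor ends in modules on \<open>int \<Rightarrow> 'a\<close>;
    \<open>GO\<close> carries them over to modules on \<open>'b\<close>.\<close>
  obtain GO :: "((nat \<Rightarrow> int) set, int \<Rightarrow> 'a) module \<Rightarrow> ((nat \<Rightarrow> int) set, 'b) module" and GM
    where G: "fully_faithful (sub_category dual_integers) (sub_category dual_integers) GO GM"
      and iso: "\<And>M. M \<in> Obj (sub_category dual_integers) \<Longrightarrow> isomorphic_modules dual_integers M (GO M)"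
    using transport_fully_faithful[OF assms(2)] by metis
  interpret F: fully_faithful complex_orbit_category "sub_category dual_integers" total_module
    "two_complexes.total_map :: 'a cochain_complex \<Rightarrow> _"
    by (rule total_module_fully_faithful)
  interpret G: fully_faithful "sub_category dual_integers" "sub_category dual_integers" GO GM
    by (rule G)
  interpret GF: fully_faithful complex_orbit_category "sub_category dual_integers"
    "\<lambda>X. GO (total_module X)"
    "\<lambda>X Y f. GM (total_module X) (total_module Y) (two_complexes.total_map X Y f)"
    by (rule fully_faithful_compose[OF total_module_fully_faithful G])
  show "equivalent_categories
      (complex_orbit_category :: ('a cochain_complex, int \<Rightarrow> int \<Rightarrow> 'a \<Rightarrow> 'a) category) ?T"
  proof (rule GF.equivalent_categories_if_essentially_surjective)
    fix Z assume Z: "Z \<in> Obj ?T"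
    then obtain X :: "'a cochain_complex" where X: "X \<in> bounded_free_complexes"
      and XZ: "isomorphic_modules dual_integers (total_module X) Z"
      using total_module_essentially_surjective[OF assms(1)] by (auto simp: Obj_sub_category)
    have TX: "total_module X \<in> Obj (sub_category dual_integers)"
      using F.FO X by (simp add: complex_orbit_simps)
    then have mod: "module dual_integers (total_module X)" "module dual_integers (GO (total_module X))"
      using G.FO by (auto simp: Obj_sub_category)
    have "isomorphic_modules dual_integers (GO (total_module X)) Z"
      by (rule isomorphic_modules_trans[OF mod(2) isomorphic_modules_sym[OF mod(1) iso[OF TX]] XZ])
    then have "isomorphisms ?T (GO (total_module X)) Z \<noteq> {}"
      unfolding sub_category_def
      by (rule isomorphisms_module_category[OF mod(2)])
        (use G.FO[OF TX] Z in \<open>auto simp: sub_category_def full_subcategory_def\<close>)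
    then show "\<exists>X \<in> Obj complex_orbit_category. isomorphisms ?T (GO (total_module X)) Z \<noteq> {}"
      using X by (auto simp: complex_orbit_simps)
  qed
  show "equivalent_categories ?T
      (Gproj_category dual_integers :: (((nat \<Rightarrow> int) set, 'b) module, 'b \<Rightarrow> 'b) category)"
    unfolding Gproj_category_eq_sub_category[OF assms(2)]
    by (rule category.equivalent_categories_refl[OF category_sub_category])
qed

end
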